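(* Let $A_0:X_0\to Y_0$ and $A_1:X_1\to Y_1$ be bounded linear operators between Banach spaces. If $A_0$ and $A_1$ have summable Szlenk index, then so does the induced operator $A_0\otimes A_1:X_0\hat{\otimes}_\varepsilon X_1\to Y_0\hat{\otimes}_\varepsilon Y_1$ between the injective tensor products. If neither $A_0$ nor $A_1$ is the zero operator, then the converse holds as well; that is, if $A_0\otimes A_1$ has summable Szlenk index, then so do $A_0$ and $A_1$.
   Context: The scalar field $\mathbb{K}$ is $\mathbb{R}$ or $\mathbb{C}$. Summable Szlenk index: for a Banach space $X$, a weak$^*$-compact $K\subset X^*$ and $\varepsilon>0$, $s_\varepsilon(K)$ denotes the set of those $x^*\in K$ such that $\mathrm{diam}(V\cap K)>\varepsilon$ (norm diameter) for every weak$^*$-neighborhood $V$ of $x^*$; for $\varepsilon\leqslant 0$, $s_\varepsilon(K)=K$. For $M\geqslant 0$, $K$ has $M$-summable Szlenk index if whenever $n\in\mathbb{N}$ and $\varepsilon_1,\ldots,\varepsilon_n\in\mathbb{R}$ are such that $s_{\varepsilon_1}\cdots s_{\varepsilon_n}(K)\neq\varnothing$ (with $s_{\varepsilon_n}$ applied first), then $\sum_{i=1}^n\varepsilon_i\leqslant M$. $K$ has summable Szlenk index if it has $M$-summable Szlenk index for some $M\geqslant 0$. An operator $A:X\to Y$ has summable Szlenk index if the weak$^*$-compact set $A^*B_{Y^*}\subset X^*$ does, where $B_{Y^*}$ is the closed unit ball of $Y^*$. Injective tensor product: $X\hat{\otimes}_\varepsilon Y$ is the closed span, in the space of bounded linear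 operators from $Y^*$ to $X$ with the operator norm, of the operators $x\otimes y:Y^*\to X$, $(x\otimes y)(y^* )=y^*(y)x$. The operator $A_0\otimes A_1$ is given by $(A_0\otimes A_1)(u)=A_0uA_1^*:Y_1^*\to Y_0$. *)

theory Defs
  imports "HOL-Analysis.Analysis" "HOL-Library.Function_Algebras"
begin

section \<open>Scalars\<close>

text \<open>
  A norm-preserving unital embedding over the reals into the complex numbers has a
  subfield containing the reals as its image, so the types of this class are, up to
  isometric isomorphism, exactly the real and the complex numbers
  (lemma \<open>real_or_complex_cases\<close>).
\<close>

class real_or_complex = real_normed_field +
  assumes ex_complex_embedding:
    "\<exists>h :: 'a \<Rightarrow> complex. (\<forall>x y. h (x + y) = h x + h y) \<and> (\<forall>x y. h (x * y) = h x * h y)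
       \<and> (\<forall>r. h (r *\<^sub>R 1) = of_real r) \<and> (\<forall>x. cmod (h x) = norm x)"

instance real :: real_or_complex
  by standard (rule exI[of _ complex_of_real], simp)

instance complex :: real_or_complex
  by standard (rule exI[of _ "\<lambda>z. z"], simp add: scaleR_conv_of_real)

lemma real_or_complex_cases:
  "\<exists>h :: 'k::real_or_complex \<Rightarrow> complex. inj h \<and> (range h = \<real> \<or> range h = UNIV)
     \<and> (\<forall>x y. h (x + y) = h x + h y) \<and> (\<forall>x y. h (x * y) = h x * h y)
     \<and> (\<forall>r. h (of_real r) = of_real r) \<and> (\<forall>x. cmod (h x) = norm x)"
proof -
  obtain h :: "'k \<Rightarrow> complex" where add: "\<And>x y. h (x + y) = h x + h y"
    and mult: "\<And>x y. h (x * y) = h x * h y"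
    and real: "\<And>r. h (of_real r) = of_real r" and norm: "\<And>x. cmod (h x) = norm x"
    using ex_complex_embedding unfolding of_real_def[where 'a='k] by blast
  have diff: "h (x - y) = h x - h y" for x y
    using add[of "x - y" y] by simp
  have "inj h"
  proof (rule injI)
    fix x y assume "h x = h y"
    then have "norm (x - y) = 0" using norm[of "x - y"] by (simp add: diff)
    then show "x = y" by simp
  qed
  moreover have "range h = \<real> \<or> range h = UNIV"
  proof (cases "range h \<subseteq> \<real>")
    case True
    moreover have "\<real> \<subseteq> range h"
      using real by (metis Reals_cases rangeI subsetI)
    ultimately show ?thesis by blast
  next
    case False
    then obtain x where x: "Im (h x) \<noteq> 0"
      using complex_is_Real_iff by blast
    have "z \<in> range h" for z
    proof -
      define b where "b = Im z / Im (h x)"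
      define a where "a = Re z - b * Re (h x)"
      have "h (of_real a + of_real b * x) = of_real a + of_real b * h x"
        by (simp add: add mult real)
      also have "\<dots> = z"
        using x by (simp add: complex_eq_iff a_def b_def)
      finally show ?thesis by (metis rangeI)
    qed
    then show ?thesis by blast
  qed
  ultimately show ?thesis using add mult real norm by blast
qed

section \<open>Normed spaces over \<open>\<real>\<close> or \<open>\<complex>\<close>\<close>

text \<open>
  Dual spaces and injective tensor products are proper subspaces of function types, and the
  scalar field is a parameter, so a normed space is a linear subspace (the carrier) of an ambient
  vector space together with a scalar multiplication and a norm.  Only the values of the norm on
  the carrier matter.
\<close>

record ('k, 'a) nspace =
  ns_carrier :: "'a set"
  ns_scale :: "'k \<Rightarrow> 'a \<Rightarrow> 'a"
  ns_norm :: "'a \<Rightarrow> real"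

text \<open>The value \<open>0\<close> off the carrier is there because \<^locale>\<open>Metric_space\<close> wants a
  distance that is nonnegative and symmetric on the whole type.\<close>

definition ns_dist :: "('k, 'a::ab_group_add) nspace \<Rightarrow> 'a \<Rightarrow> 'a \<Rightarrow> real" where
  "ns_dist X x y = (if x \<in> ns_carrier X \<and> y \<in> ns_carrier X then ns_norm X (x - y) else 0)"

locale normed_space =
  fixes X :: "('k::real_or_complex, 'a::ab_group_add) nspace"
  assumes vector_space_scale: "vector_space (ns_scale X)"
    and subspace_carrier: "module.subspace (ns_scale X) (ns_carrier X)"
    and norm_eq_zero: "x \<in> ns_carrier X \<Longrightarrow> ns_norm X x = 0 \<longleftrightarrow> x = 0"
    and norm_triangle: "x \<in> ns_carrier X \<Longrightarrow> y \<in> ns_carrier X \<Longrightarrow>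
                          ns_norm X (x + y) \<le> ns_norm X x + ns_norm X y"
    and norm_scale: "x \<in> ns_carrier X \<Longrightarrow> ns_norm X (ns_scale X c x) = norm c * ns_norm X x"

locale banach_space = normed_space +
  assumes complete: "Metric_space.mcomplete (ns_carrier X) (ns_dist X)"

definition ns_cball :: "('k, 'a) nspace \<Rightarrow> 'a set" where
  "ns_cball X = {x \<in> ns_carrier X. ns_norm X x \<le> 1}"

definition ns_diam :: "('k, 'a::ab_group_add) nspace \<Rightarrow> 'a set \<Rightarrow> ennreal" where
  "ns_diam X S = (SUP (x, y) \<in> S \<times> S. ennreal (ns_norm X (x - y)))"

section \<open>Bounded operators, duals, adjoints\<close>

definition bounded_linear_op ::
  "('k, 'a::ab_group_add) nspace \<Rightarrow> ('k, 'b::ab_group_add) nspace \<Rightarrow> ('a \<Rightarrow> 'b) \<Rightarrow> bool" where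
  "bounded_linear_op X Y A \<longleftrightarrow>
     (\<forall>x\<in>ns_carrier X. A x \<in> ns_carrier Y) \<and>
     (\<forall>x\<in>ns_carrier X. \<forall>y\<in>ns_carrier X. A (x + y) = A x + A y) \<and>
     (\<forall>c. \<forall>x\<in>ns_carrier X. A (ns_scale X c x) = ns_scale Y c (A x)) \<and>
     (\<exists>C. \<forall>x\<in>ns_carrier X. ns_norm Y (A x) \<le> C * ns_norm X x)"

text \<open>
  The space of bounded operators with the operator norm.  Operators are represented by
  functions that vanish off the carrier, which makes the representation unique and keeps it
  closed under the pointwise operations.
\<close>

definition operator_space ::
  "('k, 'a::ab_group_add) nspace \<Rightarrow> ('k, 'b::ab_group_add) nspace \<Rightarrow> ('k, 'a \<Rightarrow> 'b) nspace" where
  "operator_space X Y =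
     \<lparr>ns_carrier = {u. bounded_linear_op X Y u \<and> (\<forall>x. x \<notin> ns_carrier X \<longrightarrow> u x = 0)},
      ns_scale = (\<lambda>c u x. ns_scale Y c (u x)),
      ns_norm = (\<lambda>u. SUP x\<in>ns_cball X. ns_norm Y (u x))\<rparr>"

definition scalar_space :: "('k::real_or_complex, 'k) nspace" where
  "scalar_space = \<lparr>ns_carrier = UNIV, ns_scale = (*), ns_norm = norm\<rparr>"

definition dual_space ::
  "('k::real_or_complex, 'a::ab_group_add) nspace \<Rightarrow> ('k, 'a \<Rightarrow> 'k) nspace" where
  "dual_space X = operator_space X scalar_space"

text \<open>The topology of pointwise convergence on the carrier of \<open>X\<close>; the coordinates
  outside the carrier are constantly \<open>0\<close> on the dual.\<close>

definition weak_star_topology ::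
  "('k::real_or_complex, 'a::ab_group_add) nspace \<Rightarrow> ('a \<Rightarrow> 'k) topology" where
  "weak_star_topology X =
     subtopology (product_topology (\<lambda>_. euclidean) UNIV) (ns_carrier (dual_space X))"

definition adjoint_op ::
  "('k, 'a) nspace \<Rightarrow> ('a \<Rightarrow> 'b) \<Rightarrow> ('b \<Rightarrow> 'k::zero) \<Rightarrow> 'a \<Rightarrow> 'k" where
  "adjoint_op X A g = (\<lambda>x. if x \<in> ns_carrier X then g (A x) else 0)"

section \<open>Summable Szlenk index\<close>

definition szlenk_deriv ::
  "('k::real_or_complex, 'a::ab_group_add) nspace \<Rightarrow> real \<Rightarrow> ('a \<Rightarrow> 'k) set \<Rightarrow> ('a \<Rightarrow> 'k) set" where
  "szlenk_deriv X \<epsilon> K =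
     (if \<epsilon> \<le> 0 then K
      else {f \<in> K. \<forall>V. openin (weak_star_topology X) V \<and> f \<in> V \<longrightarrow>
                     ennreal \<epsilon> < ns_diam (dual_space X) (V \<inter> K)})"

text \<open>\<open>foldr\<close> applies the derivation of the last entry of the list first.\<close>

definition has_M_summable_szlenk_index ::
  "('k::real_or_complex, 'a::ab_group_add) nspace \<Rightarrow> real \<Rightarrow> ('a \<Rightarrow> 'k) set \<Rightarrow> bool" where
  "has_M_summable_szlenk_index X M K \<longleftrightarrow>
     (\<forall>\<epsilon>s. foldr (szlenk_deriv X) \<epsilon>s K \<noteq> {} \<longrightarrow> sum_list \<epsilon>s \<le> M)"

definition has_summable_szlenk_index ::
  "('k::real_or_complex, 'a::ab_group_add) nspace \<Rightarrow> ('a \<Rightarrow> 'k) set \<Rightarrow> bool" where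
  "has_summable_szlenk_index X K \<longleftrightarrow> (\<exists>M\<ge>0. has_M_summable_szlenk_index X M K)"

definition op_has_summable_szlenk_index ::
  "('k::real_or_complex, 'a::ab_group_add) nspace \<Rightarrow> ('k, 'b::ab_group_add) nspace \<Rightarrow>
    ('a \<Rightarrow> 'b) \<Rightarrow> bool" where
  "op_has_summable_szlenk_index X Y A \<longleftrightarrow>
     has_summable_szlenk_index X (adjoint_op X A ` ns_cball (dual_space Y))"

section \<open>Injective tensor products\<close>

definition elementary_tensor ::
  "('k::real_or_complex, 'a::ab_group_add) nspace \<Rightarrow> ('k, 'b::ab_group_add) nspace \<Rightarrow>
    'a \<Rightarrow> 'b \<Rightarrow> ('b \<Rightarrow> 'k) \<Rightarrow> 'a" where
  "elementary_tensor X Y x y =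
     (\<lambda>g. if g \<in> ns_carrier (dual_space Y) then ns_scale X (g y) x else 0)"

definition injective_tensor ::
  "('k::real_or_complex, 'a::ab_group_add) nspace \<Rightarrow> ('k, 'b::ab_group_add) nspace \<Rightarrow>
    ('k, ('b \<Rightarrow> 'k) \<Rightarrow> 'a) nspace" where
  "injective_tensor X Y =
     (let L = operator_space (dual_space Y) X in
      L\<lparr>ns_carrier :=
          Metric_space.mtopology (ns_carrier L) (ns_dist L) closure_of
            module.span (ns_scale L)
              {elementary_tensor X Y x y | x y. x \<in> ns_carrier X \<and> y \<in> ns_carrier Y}\<rparr>)"

text \<open>\<open>(A0 \<otimes> A1) u = A0 u A1\<^sup>*\<close>, an operator from the dual of \<open>Y1\<close> to \<open>Y0\<close>.\<close>

definition tensor_op ::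
  "('k::real_or_complex, 'a1::ab_group_add) nspace \<Rightarrow> ('k, 'b1::ab_group_add) nspace \<Rightarrow>
    ('a0 \<Rightarrow> 'b0::ab_group_add) \<Rightarrow> ('a1 \<Rightarrow> 'b1) \<Rightarrow> (('a1 \<Rightarrow> 'k) \<Rightarrow> 'a0) \<Rightarrow> ('b1 \<Rightarrow> 'k) \<Rightarrow> 'b0" where
  "tensor_op X1 Y1 A0 A1 u =
     (\<lambda>g. if g \<in> ns_carrier (dual_space Y1) then A0 (u (adjoint_op X1 A1 g)) else 0)"

section \<open>Basic facts\<close>

context normed_space
begin

interpretation V: vector_space "ns_scale X" by (rule vector_space_scale)

lemma carrier_zero: "0 \<in> ns_carrier X"
  and carrier_add: "x \<in> ns_carrier X \<Longrightarrow> y \<in> ns_carrier X \<Longrightarrow> x + y \<in> ns_carrier X"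
  and carrier_scale: "x \<in> ns_carrier X \<Longrightarrow> ns_scale X c x \<in> ns_carrier X"
  and carrier_diff: "x \<in> ns_carrier X \<Longrightarrow> y \<in> ns_carrier X \<Longrightarrow> x - y \<in> ns_carrier X"
  using subspace_carrier
  by (simp_all add: V.subspace_0 V.subspace_add V.subspace_scale V.subspace_diff)

lemma norm_zero: "ns_norm X 0 = 0"
  using norm_eq_zero carrier_zero by simp

lemma norm_minus: "x \<in> ns_carrier X \<Longrightarrow> ns_norm X (- x) = ns_norm X x"
  using norm_scale[of x "-1"] by simp

lemma norm_nonneg: "x \<in> ns_carrier X \<Longrightarrow> 0 \<le> ns_norm X x"
  using norm_triangle[of x "- x"] carrier_diff[of 0 x] carrier_zero
  by (simp add: norm_minus norm_zero)

lemma Metric_space_ns_dist: "Metric_space (ns_carrier X) (ns_dist X)"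
proof
  fix x y z
  show "0 \<le> ns_dist X x y"
    by (simp add: ns_dist_def norm_nonneg carrier_diff)
  show "ns_dist X x y = ns_dist X y x"
    using norm_minus[of "x - y"] by (auto simp: ns_dist_def carrier_diff)
  assume "x \<in> ns_carrier X" "y \<in> ns_carrier X"
  then show "ns_dist X x y = 0 \<longleftrightarrow> x = y"
    by (simp add: ns_dist_def norm_eq_zero carrier_diff)
  assume "z \<in> ns_carrier X"
  then show "ns_dist X x z \<le> ns_dist X x y + ns_dist X y z"
    using \<open>x \<in> ns_carrier X\<close> \<open>y \<in> ns_carrier X\<close> norm_triangle[of "x - y" "y - z"]
    by (simp add: ns_dist_def carrier_diff)
qed

end

lemma normed_space_scalar_space: "normed_space (scalar_space :: ('k::real_or_complex, 'k) nspace)"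
proof -
  interpret vector_space "(*) :: 'k \<Rightarrow> 'k \<Rightarrow> 'k"
    by standard (simp_all add: algebra_simps)
  show ?thesis
    by standard (simp_all add: scalar_space_def algebra_simps subspace_UNIV norm_triangle_ineq norm_mult)
qed

lemma normed_space_operator_space:
  fixes X :: "('k::real_or_complex, 'a::ab_group_add) nspace"
    and Y :: "('k, 'b::ab_group_add) nspace"
  assumes "normed_space X" "normed_space Y"
  shows "normed_space (operator_space X Y)"
proof -
  interpret X: normed_space X by fact
  interpret Y: normed_space Y by fact
  interpret VX: vector_space "ns_scale X" by (rule X.vector_space_scale)
  interpret VY: vector_space "ns_scale Y" by (rule Y.vector_space_scale)
  let ?L = "operator_space X Y"
  interpret VL: vector_space "ns_scale ?L"
    by standard (auto simp: operator_space_def fun_eq_iff VY.scale_right_distrib VY.scale_left_distrib)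
  have zero_ball: "0 \<in> ns_cball X"
    by (simp add: ns_cball_def X.carrier_zero X.norm_zero)
  have memD: "u x \<in> ns_carrier Y" if "u \<in> ns_carrier ?L" for u x
    using that Y.carrier_zero by (cases "x \<in> ns_carrier X")
      (auto simp: operator_space_def bounded_linear_op_def)
  have bound: "\<exists>C. \<forall>x\<in>ns_carrier X. ns_norm Y (u x) \<le> C * ns_norm X x" if "u \<in> ns_carrier ?L" for u
    using that by (simp add: operator_space_def bounded_linear_op_def)
  have bdd: "bdd_above ((\<lambda>x. ns_norm Y (u x)) ` ns_cball X)" if u: "u \<in> ns_carrier ?L" for u
  proof -
    obtain C where C: "\<And>x. x \<in> ns_carrier X \<Longrightarrow> ns_norm Y (u x) \<le> C * ns_norm X x"
      using bound[OF u] by blast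
    have "ns_norm Y (u x) \<le> \<bar>C\<bar>" if "x \<in> ns_cball X" for x
    proof -
      have x: "x \<in> ns_carrier X" "ns_norm X x \<le> 1" using that by (auto simp: ns_cball_def)
      have "ns_norm Y (u x) \<le> C * ns_norm X x" by (rule C[OF x(1)])
      also have "\<dots> \<le> \<bar>C\<bar> * 1"
        by (rule mult_mono) (use x X.norm_nonneg in auto)
      finally show ?thesis by simp
    qed
    then show ?thesis by (auto simp: bdd_above_def)
  qed
  have norm_def: "ns_norm ?L u = (SUP x\<in>ns_cball X. ns_norm Y (u x))" for u
    by (simp add: operator_space_def)
  have upper: "ns_norm Y (u x) \<le> ns_norm ?L u" if "u \<in> ns_carrier ?L" "x \<in> ns_cball X" for u x
    unfolding norm_def by (rule cSUP_upper[OF that(2) bdd[OF that(1)]])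
  show ?thesis
  proof
    show "VL.subspace (ns_carrier ?L)"
    proof (rule VL.subspaceI)
      show "0 \<in> ns_carrier ?L"
        by (auto simp: operator_space_def bounded_linear_op_def Y.carrier_zero Y.norm_zero intro: exI[of _ 0])
    next
      fix u v assume u: "u \<in> ns_carrier ?L" and v: "v \<in> ns_carrier ?L"
      obtain C where C: "\<And>x. x \<in> ns_carrier X \<Longrightarrow> ns_norm Y (u x) \<le> C * ns_norm X x"
        using bound[OF u] by blast
      obtain D where D: "\<And>x. x \<in> ns_carrier X \<Longrightarrow> ns_norm Y (v x) \<le> D * ns_norm X x"
        using bound[OF v] by blast
      have "ns_norm Y (u x + v x) \<le> (C + D) * ns_norm X x" if "x \<in> ns_carrier X" for x
        using Y.norm_triangle[OF memD[OF u, of x] memD[OF v, of x]] C[OF that] D[OF that]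
        by (simp add: algebra_simps)
      then have "\<exists>E. \<forall>x\<in>ns_carrier X. ns_norm Y (u x + v x) \<le> E * ns_norm X x"
        by blast
      then show "u + v \<in> ns_carrier ?L"
        using u v by (auto simp: operator_space_def bounded_linear_op_def Y.carrier_add
            VY.scale_right_distrib add_ac)
    next
      fix c u assume u: "u \<in> ns_carrier ?L"
      obtain C where C: "\<And>x. x \<in> ns_carrier X \<Longrightarrow> ns_norm Y (u x) \<le> C * ns_norm X x"
        using bound[OF u] by blast
      have "ns_norm Y (ns_scale Y c (u x)) \<le> (norm c * C) * ns_norm X x" if "x \<in> ns_carrier X" for x
        using mult_left_mono[OF C[OF that], of "norm c"] memD[OF u]
        by (simp add: Y.norm_scale algebra_simps)
      then have "\<exists>E. \<forall>x\<in>ns_carrier X. ns_norm Y (ns_scale Y c (u x)) \<le> E * ns_norm X x"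
        by blast
      then show "ns_scale ?L c u \<in> ns_carrier ?L"
        using u by (auto simp: operator_space_def bounded_linear_op_def Y.carrier_scale
            VY.scale_right_distrib VY.scale_left_commute)
    qed
  next
    fix u assume u: "u \<in> ns_carrier ?L"
    show "ns_norm ?L u = 0 \<longleftrightarrow> u = 0"
    proof
      assume 0: "ns_norm ?L u = 0"
      have "u x = 0" for x
      proof (cases "x \<in> ns_carrier X \<and> x \<noteq> 0")
        case True
        then have x: "x \<in> ns_carrier X" by simp
        have pos: "ns_norm X x > 0"
          using True X.norm_nonneg[OF x] X.norm_eq_zero[OF x] by linarith
        define c :: 'k where "c = of_real (1 / ns_norm X x)"
        have c: "norm c = 1 / ns_norm X x" "c \<noteq> 0" using pos by (auto simp: c_def norm_divide)
        have "ns_scale X c x \<in> ns_cball X"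
          using x pos by (simp add: ns_cball_def X.carrier_scale X.norm_scale c)
        from upper[OF u this] 0 have "ns_norm Y (u (ns_scale X c x)) = 0"
          using Y.norm_nonneg[OF memD[OF u]] by (simp add: order_antisym)
        then have "u (ns_scale X c x) = 0" using Y.norm_eq_zero[OF memD[OF u]] by simp
        moreover have "u (ns_scale X c x) = ns_scale Y c (u x)"
          using u x by (auto simp: operator_space_def bounded_linear_op_def)
        ultimately show ?thesis using c by simp
      next
        case False
        have "u (ns_scale X 0 0) = ns_scale Y 0 (u 0)"
          using u X.carrier_zero unfolding operator_space_def bounded_linear_op_def by fastforce
        then have "u 0 = 0" by simp
        with False u show ?thesis by (auto simp: operator_space_def)
      qed
      then show "u = 0" by auto
    next
      assume "u = 0"
      moreover have "ns_cball X \<noteq> {}" using zero_ball by blast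
      ultimately show "ns_norm ?L u = 0" by (simp add: norm_def Y.norm_zero)
    qed
    {
      fix v assume v: "v \<in> ns_carrier ?L"
      show "ns_norm ?L (u + v) \<le> ns_norm ?L u + ns_norm ?L v"
        unfolding norm_def[of "u + v"]
      proof (rule cSUP_least)
        fix x assume x: "x \<in> ns_cball X"
        show "ns_norm Y ((u + v) x) \<le> ns_norm ?L u + ns_norm ?L v"
          using Y.norm_triangle[OF memD[OF u, of x] memD[OF v, of x]] upper[OF u x] upper[OF v x]
          by simp
      qed (use zero_ball in auto)
    }
    fix c :: 'k
    have "ns_norm ?L (ns_scale ?L c u) = (SUP x\<in>ns_cball X. norm c * ns_norm Y (u x))"
      using memD[OF u] by (simp add: operator_space_def Y.norm_scale)
    also have "\<dots> = norm c * ns_norm ?L u"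
    proof (rule antisym)
      show "(SUP x\<in>ns_cball X. norm c * ns_norm Y (u x)) \<le> norm c * ns_norm ?L u"
        by (rule cSUP_least) (use zero_ball upper[OF u] in \<open>auto intro: mult_left_mono\<close>)
      have bdd': "bdd_above ((\<lambda>x. norm c * ns_norm Y (u x)) ` ns_cball X)"
        using upper[OF u]
        by (intro bdd_aboveI[of _ "norm c * ns_norm ?L u"]) (auto intro: mult_left_mono)
      show "norm c * ns_norm ?L u \<le> (SUP x\<in>ns_cball X. norm c * ns_norm Y (u x))"
      proof (cases "c = 0")
        case True
        have "ns_cball X \<noteq> {}" using zero_ball by blast
        with True show ?thesis by simp
      next
        case False
        have "ns_norm ?L u \<le> (SUP x\<in>ns_cball X. norm c * ns_norm Y (u x)) / norm c"
          unfolding norm_def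
        proof (rule cSUP_least)
          fix x assume "x \<in> ns_cball X"
          from cSUP_upper[OF this bdd'] False
          show "ns_norm Y (u x) \<le> (SUP x\<in>ns_cball X. norm c * ns_norm Y (u x)) / norm c"
            by (simp add: field_simps)
        qed (use zero_ball in auto)
        with False show ?thesis by (simp add: field_simps)
      qed
    qed
    finally show "ns_norm ?L (ns_scale ?L c u) = norm c * ns_norm ?L u" .
  qed
qed

lemma banach_space_UNIV:
  "banach_space \<lparr>ns_carrier = (UNIV :: 'a::banach set), ns_scale = scaleR, ns_norm = norm\<rparr>"
  (is "banach_space ?X")
proof -
  have V: "vector_space (scaleR :: real \<Rightarrow> 'a \<Rightarrow> 'a)"
    by standard (simp_all add: scaleR_add_right scaleR_add_left)
  then have "module.subspace (scaleR :: real \<Rightarrow> 'a \<Rightarrow> 'a) UNIV"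
    by (simp add: module.subspace_def module_iff_vector_space)
  with V interpret normed_space ?X
    by unfold_locales (simp_all add: norm_triangle_ineq scaleR_add_right scaleR_add_left)
  have "ns_dist ?X = dist" by (auto simp: ns_dist_def dist_norm fun_eq_iff)
  then have "Metric_space.mcomplete (ns_carrier ?X) (ns_dist ?X)"
    using complete_UNIV by (simp add: mcomplete_iff_complete)
  then show ?thesis by unfold_locales
qed

end

theory Submission
  imports Defs
begin

text \<open>
  Write \<open>K0\<close>, \<open>K1\<close> and \<open>K\<close> for the adjoint images of the dual balls under \<open>A0\<close>, \<open>A1\<close> and
  \<open>A0 \<otimes> A1\<close>.  If an iterated derivation of \<open>K\<close> is nonempty, there is a weakly null tree in the ball
  of \<open>X0 \<otimes> X1\<close> such that on the sum of every branch some element of \<open>K\<close> is at least about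
  \<open>\<Sum>\<epsilon>i / 4\<close>.  By the definition of the injective norm and the Hahn--Banach theorem, the same holds with
  a functional \<open>f \<otimes> g\<close>, where \<open>f \<in> K0\<close> and \<open>g \<in> K1\<close>; so no convex hull has to be derived.  After
  passing to a subtree on which these functionals satisfy uniform lower bounds at each level, weak-star
  cluster points taken from the leaves to the root lie in iterated derivations of \<open>K0\<close> and \<open>K1\<close>, the
  numbers being divided between the two factors up to a constant.  Conversely, \<open>f \<mapsto> f \<otimes> g\<close> for a
  fixed nonzero \<open>g \<in> K1\<close> embeds \<open>K0\<close> into \<open>K\<close> weak-star continuously and with a lower norm bound.
\<close>

section \<open>Scalars\<close>

text \<open>Domination by some \<open>f \<otimes> g\<close> is available at one vector at a time. It
  is used only at the sum of a branch, so the pair depends on the branch, and its values at the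
  single nodes need not follow the numbers \<epsilon>i and may be negative; only their total is
  controlled. This is why branches are coloured by lists of rounded values and why positive parts
  occur in \<open>splittings\<close>. The final bound is 32 R (M0 + M1), where R bounds the norms in
  K0 and K1. A factor 2 comes from comparing with the limit functional instead of two functionals
  with each other, a second 2 from replacing a norming vector by a weakly small one in the ball. The
  factor 8 R comes from the products: oscillations of at most d / (8 R) in both factors move the
  pairing by at most d / 4, too little to bridge a jump above d / 2. Weak neighbourhoods of 0 in the
  ball need not have a countable base, so trees are indexed by a filter instead of sequences. A
  frequent property split into finitely many cases is frequent in one of them; pigeonhole and
  compactness arguments rest on this.\<close>

definition scalar_emb :: "'k::real_or_complex \<Rightarrow> complex" where
  "scalar_emb = (SOME h. inj h \<and> (range h = \<real> \<or> range h = UNIV)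
     \<and> (\<forall>x y. h (x + y) = h x + h y) \<and> (\<forall>x y. h (x * y) = h x * h y)
     \<and> (\<forall>r. h (of_real r) = of_real r) \<and> (\<forall>x. cmod (h x) = norm x))"

lemma
  shows inj_scalar_emb: "inj (scalar_emb :: 'k::real_or_complex \<Rightarrow> complex)"
    and range_scalar_emb:
      "range (scalar_emb :: 'k \<Rightarrow> complex) = \<real> \<or> range (scalar_emb :: 'k \<Rightarrow> complex) = UNIV"
    and scalar_emb_add: "scalar_emb (x + y :: 'k) = scalar_emb x + scalar_emb y"
    and scalar_emb_mult: "scalar_emb (x * y :: 'k) = scalar_emb x * scalar_emb y"
    and scalar_emb_of_real: "scalar_emb (of_real r :: 'k) = of_real r"
    and norm_scalar_emb: "cmod (scalar_emb (x :: 'k)) = norm x"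
  using someI_ex[OF real_or_complex_cases[where 'k='k], folded scalar_emb_def] by blast+

definition re :: "'k::real_or_complex \<Rightarrow> real" where
  "re x = Re (scalar_emb x)"

lemma re_add: "re (x + y) = re x + re y"
  by (simp add: re_def scalar_emb_add)

lemma re_of_real_mult: "re (of_real r * x) = r * re x"
  by (simp add: re_def scalar_emb_mult scalar_emb_of_real)

lemma re_of_real [simp]: "re (of_real r) = r"
  by (simp add: re_def scalar_emb_of_real)

lemma re_zero [simp]: "re 0 = 0"
  using re_of_real[of 0] by simp

lemma re_diff: "re (x - y) = re x - re y"
  using re_add[of "x - y" y] by simp

lemma abs_re_le: "\<bar>re x\<bar> \<le> norm x"
  using abs_Re_le_cmod[of "scalar_emb x"] by (simp add: re_def norm_scalar_emb)

lemma re_le: "re x \<le> norm x"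
  using abs_re_le[of x] by simp

lemma continuous_on_re [continuous_intros]:
  assumes "continuous_on S f" shows "continuous_on S (\<lambda>x. re (f x))"
proof -
  have "1-lipschitz_on UNIV (re :: 'b \<Rightarrow> real)"
    by (intro lipschitz_onI) (use abs_re_le in \<open>auto simp: dist_norm re_diff[symmetric]\<close>)
  then have "continuous_on UNIV (re :: 'b \<Rightarrow> real)"
    by (rule lipschitz_on_continuous_on)
  then show ?thesis
    using assms by (rule continuous_on_compose2) auto
qed

lemma unimodular_rotation: "\<exists>c::'k::real_or_complex. norm c = 1 \<and> c * x = of_real (norm x)"
proof (cases "x = 0")
  case True
  then show ?thesis by (intro exI[of _ 1]) simp
next
  case False
  then show ?thesis
    by (intro exI[of _ "of_real (norm x) / x"]) (simp add: norm_divide)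
qed

text \<open>The two possible images of the embedding, seen from inside the field. In the second case
  \<open>i\<close> is the preimage of the imaginary unit and - \<open>re (i * x)\<close> is the
  imaginary part of \<open>x\<close>. This is what recovers a functional from its real part.\<close>

lemma scalar_from_re:
  "(\<forall>x::'k::real_or_complex. x = of_real (re x)) \<or>
   (\<exists>i::'k. i * i = -1 \<and> (\<forall>x. x = of_real (re x) - i * of_real (re (i * x))))"
proof (cases "range (scalar_emb :: 'k \<Rightarrow> complex) = \<real>")
  case True
  have "x = of_real (re x)" for x :: 'k
  proof (rule injD[OF inj_scalar_emb])
    have "scalar_emb x \<in> \<real>" using True by blast
    then show "scalar_emb x = scalar_emb (of_real (re x) :: 'k)"
      by (simp add: scalar_emb_of_real re_def)
  qed
  then show ?thesis by blast
next
  case False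
  then obtain i :: 'k where i: "scalar_emb i = \<i>"
    using range_scalar_emb by (metis rangeE UNIV_I)
  have zero: "scalar_emb (0::'k) = 0"
    using scalar_emb_of_real[of 0] by simp
  have minus: "scalar_emb (- x) = - scalar_emb x" for x :: 'k
    using scalar_emb_add[of x "- x"] zero by (simp add: eq_neg_iff_add_eq_0 add.commute)
  have diff: "scalar_emb (x - y) = scalar_emb x - scalar_emb y" for x y :: 'k
    using scalar_emb_add[of x "- y"] by (simp add: minus)
  have one: "scalar_emb (1::'k) = 1"
    using scalar_emb_of_real[of 1] by simp
  have "i * i = -1"
    by (rule injD[OF inj_scalar_emb]) (simp add: scalar_emb_mult minus i one)
  moreover have "x = of_real (re x) - i * of_real (re (i * x))" for x :: 'k
    by (rule injD[OF inj_scalar_emb])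
       (simp add: diff scalar_emb_add scalar_emb_mult scalar_emb_of_real re_def i complex_eq_iff)
  ultimately show ?thesis by blast
qed

text \<open>Local compactness is pulled back along the isometric embedding, whose image is closed in
  the complex plane in both cases.\<close>

lemma compact_cball_scalar: "compact (cball (0::'k::real_or_complex) r)"
proof -
  let ?h = "scalar_emb :: 'k \<Rightarrow> complex"
  have dist: "dist (?h x) (?h y) = dist x y" for x y
    using scalar_emb_add[of "x - y" y] norm_scalar_emb[of "x - y"] by (simp add: dist_norm)
  define g where "g = inv_into UNIV ?h"
  have g: "g (?h x) = x" for x
    unfolding g_def by (simp add: inj_scalar_emb)
  have "closed (range ?h)"
    using range_scalar_emb[where 'k='k] closed_complex_Reals by (metis closed_UNIV)
  then have "compact (range ?h \<inter> cball 0 r)"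
    by (rule closed_Int_compact) simp
  moreover have "1-lipschitz_on (range ?h \<inter> cball 0 r) g"
    by (intro lipschitz_onI) (auto simp: g dist)
  then have "continuous_on (range ?h \<inter> cball 0 r) g"
    by (rule lipschitz_on_continuous_on)
  ultimately have "compact (g ` (range ?h \<inter> cball 0 r))"
    by (rule compact_continuous_image[rotated])
  also have "g ` (range ?h \<inter> cball 0 r) = cball 0 r"
    by (force simp: g norm_scalar_emb image_iff)
  finally show ?thesis .
qed

section \<open>The Hahn--Banach theorem\<close>

text \<open>A minimal sublinear functional below the norm is real-linear, so Zorn's lemma on sublinear
  functionals replaces the extension of functionals from subspaces.\<close>

definition sublinear_below_norm :: "('k::real_or_complex, 'a::ab_group_add) nspace \<Rightarrow> ('a \<Rightarrow> real) set" where
  "sublinear_below_norm X = {p. (\<forall>x. x \<notin> ns_carrier X \<longrightarrow> p x = 0) \<and>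
     (\<forall>x\<in>ns_carrier X. p x \<le> ns_norm X x) \<and>
     (\<forall>x\<in>ns_carrier X. \<forall>y\<in>ns_carrier X. p (x + y) \<le> p x + p y) \<and>
     (\<forall>r\<ge>0. \<forall>x\<in>ns_carrier X. p (ns_scale X (of_real r) x) = r * p x)}"

context normed_space
begin

interpretation V: vector_space "ns_scale X" by (rule vector_space_scale)

lemma carrier_minus: "x \<in> ns_carrier X \<Longrightarrow> - x \<in> ns_carrier X"
  using carrier_diff[OF carrier_zero, of x] by simp

lemma sublinear_zero: "p \<in> sublinear_below_norm X \<Longrightarrow> p 0 = 0"
  unfolding sublinear_below_norm_def using carrier_zero V.scale_zero_left
  by (metis (mono_tags, lifting) mem_Collect_eq mult_zero_left of_real_0 order_refl)

text \<open>The witness is q x = inf over t \<ge> 0 of p (x + t y) - t p y. Taking t = 0 gives q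
  \<le> p, and t = 1 gives the last inequality. The infimum is finite because subadditivity bounds
  every term below by - p (- x).\<close>

lemma sublinear_shift:
  assumes p: "p \<in> sublinear_below_norm X" and y: "y \<in> ns_carrier X"
  shows "\<exists>q\<in>sublinear_below_norm X. q \<le> p \<and> (\<forall>x\<in>ns_carrier X. q x \<le> p (x + y) - p y)"
proof -
  let ?ty = "\<lambda>t. ns_scale X (of_real t) y"
  define F where "F x t = p (x + ?ty t) - t * p y" for x t
  define q where "q x = (if x \<in> ns_carrier X then INF t\<in>{0..}. F x t else 0)" for x
  have ty: "?ty t \<in> ns_carrier X" for t using y by (rule carrier_scale)
  have off: "x \<notin> ns_carrier X \<Longrightarrow> p x = 0" and le: "x \<in> ns_carrier X \<Longrightarrow> p x \<le> ns_norm X x"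
    and sub: "x \<in> ns_carrier X \<Longrightarrow> z \<in> ns_carrier X \<Longrightarrow> p (x + z) \<le> p x + p z"
    and hom: "r \<ge> 0 \<Longrightarrow> x \<in> ns_carrier X \<Longrightarrow> p (ns_scale X (of_real r) x) = r * p x" for x z r
    using p unfolding sublinear_below_norm_def by blast+
  have low: "- p (- x) \<le> F x t" if "x \<in> ns_carrier X" "t \<ge> 0" for x t
    using sub[of "x + ?ty t" "- x"] hom[OF that(2) y] that ty
    by (simp add: F_def carrier_add carrier_minus)
  have bdd: "bdd_below (F x ` {0..})" if "x \<in> ns_carrier X" for x
    using low[OF that] by (intro bdd_belowI[of _ "- p (- x)"]) auto
  have qF: "q x \<le> F x t" if "x \<in> ns_carrier X" "t \<ge> 0" for x t
    using cINF_lower[OF bdd[OF that(1)], of t] that by (simp add: q_def)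
  have qI: "c \<le> q x" if "x \<in> ns_carrier X" "\<And>t. t \<ge> 0 \<Longrightarrow> c \<le> F x t" for x c
    using that by (auto simp: q_def intro!: cINF_greatest)
  have qp: "q x \<le> p x" for x
    using qF[of x 0] off[of x] by (cases "x \<in> ns_carrier X") (auto simp: F_def q_def)
  have "q \<in> sublinear_below_norm X"
    unfolding sublinear_below_norm_def
  proof (safe)
    fix x assume x: "x \<in> ns_carrier X"
    show "q x \<le> ns_norm X x" using qp[of x] le[OF x] by simp
    {
      fix z assume z: "z \<in> ns_carrier X"
      have 1: "q (x + z) \<le> F x s + F z t" if "s \<ge> 0" "t \<ge> 0" for s t
      proof -
        have "q (x + z) \<le> F (x + z) (s + t)"
          by (rule qF) (use x z that carrier_add in auto)
        also have "\<dots> \<le> F x s + F z t"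
          using sub[of "x + ?ty s" "z + ?ty t"] x z ty
          by (simp add: F_def carrier_add V.scale_left_distrib algebra_simps)
        finally show ?thesis .
      qed
      have "q (x + z) - F x s \<le> q z" if "s \<ge> 0" for s
        by (rule qI) (use z 1[OF that] in \<open>auto simp: algebra_simps\<close>)
      then have "q (x + z) - q z \<le> q x"
        by (intro qI) (use x in \<open>auto simp: algebra_simps\<close>)
      then show "q (x + z) \<le> q x + q z" by simp
    }
    fix r :: real assume r: "r \<ge> 0"
    let ?rx = "ns_scale X (of_real r) x"
    have rx: "?rx \<in> ns_carrier X" using x by (rule carrier_scale)
    show "q ?rx = r * q x"
    proof (cases "r = 0")
      case True
      have q0: "q 0 = 0"
        using qp[of 0] sublinear_zero[OF p] qI[OF carrier_zero, of 0] hom y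
        by (simp add: F_def)
      show ?thesis using True q0 by simp
    next
      case False
      with r have r: "r > 0" by simp
      have FF: "F ?rx (r * t) = r * F x t" if "t \<ge> 0" for t
        using hom[of r "x + ?ty t"] r x ty
        by (simp add: F_def V.scale_right_distrib carrier_add algebra_simps)
      have "q ?rx / r \<le> q x"
      proof (rule qI[OF x])
        fix t :: real assume "t \<ge> 0"
        then show "q ?rx / r \<le> F x t"
          using FF[of t] qF[OF rx, of "r * t"] r by (simp add: divide_le_eq mult.commute)
      qed
      moreover have "r * q x \<le> q ?rx"
      proof (rule qI[OF rx])
        fix t :: real assume "t \<ge> 0"
        then show "r * q x \<le> F ?rx t"
          using FF[of "t / r"] qF[OF x, of "t / r"] r by simp
      qed
      ultimately show ?thesis using r by (simp add: field_simps)
    qed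
  qed (simp add: q_def)
  moreover have "q x \<le> p (x + y) - p y" if "x \<in> ns_carrier X" for x
    using qF[OF that, of 1] by (simp add: F_def)
  ultimately show ?thesis using qp by (auto simp: le_fun_def)
qed

text \<open>Zorn's lemma downwards, with pointwise infima of chains. Members of a chain lie above
  minus the norm on the carrier, and the prescribed value 0 keeps them bounded off it. Comparability
  is used for subadditivity: values of two members at two points are replaced by values of the
  smaller one.\<close>

lemma sublinear_minimal:
  assumes q: "q \<in> sublinear_below_norm X"
  shows "\<exists>m\<in>sublinear_below_norm X. m \<le> q \<and> (\<forall>p\<in>sublinear_below_norm X. p \<le> m \<longrightarrow> p = m)"
proof -
  let ?A = "{p \<in> sublinear_below_norm X. p \<le> q}"
  have "\<exists>m\<in>?A. \<forall>a\<in>?A. a \<le> m \<longrightarrow> a = m"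
  proof (rule predicate_Zorn)
    show "partial_order_on ?A (relation_of (\<lambda>a b. b \<le> a) ?A)"
      by (rule partial_order_on_relation_ofI) auto
    fix C assume C: "C \<in> Chains (relation_of (\<lambda>a b. b \<le> a) ?A)"
    then have CA: "C \<subseteq> ?A" and tot: "\<And>a b. a \<in> C \<Longrightarrow> b \<in> C \<Longrightarrow> a \<le> b \<or> b \<le> a"
      by (auto simp: Chains_def relation_of_def)
    show "\<exists>u\<in>?A. \<forall>a\<in>C. u \<le> a"
    proof (cases "C = {}")
      case True
      with q show ?thesis by auto
    next
      case False
      have off: "x \<notin> ns_carrier X \<Longrightarrow> p x = 0" and le: "x \<in> ns_carrier X \<Longrightarrow> p x \<le> ns_norm X x"
        and sub: "x \<in> ns_carrier X \<Longrightarrow> z \<in> ns_carrier X \<Longrightarrow> p (x + z) \<le> p x + p z"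
        and hom: "r \<ge> 0 \<Longrightarrow> x \<in> ns_carrier X \<Longrightarrow> p (ns_scale X (of_real r) x) = r * p x"
        if "p \<in> C" for p x z r
        using that CA unfolding sublinear_below_norm_def by blast+
      have low: "- ns_norm X x \<le> p x" if p: "p \<in> C" and x: "x \<in> ns_carrier X" for p x
      proof -
        have "p 0 = 0" using p CA sublinear_zero by blast
        moreover have "p (- x + x) \<le> p (- x) + p x" "p (- x) \<le> ns_norm X (- x)"
          using sub[OF p, of "-x" x] le[OF p, of "-x"] x carrier_minus by auto
        ultimately show ?thesis using norm_minus[OF x] by simp
      qed
      define u where "u x = (if x \<in> ns_carrier X then INF p\<in>C. p x else 0)" for x
      have bdd: "bdd_below ((\<lambda>p. p x) ` C)" if "x \<in> ns_carrier X" for x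
        using low that by (intro bdd_belowI[of _ "- ns_norm X x"]) auto
      have up: "u x \<le> p x" if "p \<in> C" for p x
        using cINF_lower[OF bdd that] off[OF that] by (auto simp: u_def)
      have uI: "c \<le> u x" if "x \<in> ns_carrier X" "\<And>p. p \<in> C \<Longrightarrow> c \<le> p x" for x c
        using that False by (auto simp: u_def intro!: cINF_greatest)
      obtain p0 where p0: "p0 \<in> C" using False by blast
      have "u \<in> sublinear_below_norm X"
        unfolding sublinear_below_norm_def
      proof (safe)
        fix x assume x: "x \<in> ns_carrier X"
        show "u x \<le> ns_norm X x" using up[OF p0, of x] le[OF p0 x] by simp
        {
          fix z assume z: "z \<in> ns_carrier X"
          have 1: "u (x + z) \<le> a x + b z" if "a \<in> C" "b \<in> C" for a b
          proof -
            have *: "u (x + z) \<le> d x + d z" if "d \<in> C" for d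
              using up[OF that, of "x + z"] sub[OF that x z] by simp
            from tot[OF that] show ?thesis
            proof
              assume "a \<le> b"
              then show ?thesis using *[OF that(1)] le_funD[of a b z] by simp
            next
              assume "b \<le> a"
              then show ?thesis using *[OF that(2)] le_funD[of b a x] by simp
            qed
          qed
          have "u (x + z) - a x \<le> u z" if "a \<in> C" for a
            by (rule uI) (use z 1[OF that] in \<open>auto simp: algebra_simps\<close>)
          then have "u (x + z) - u z \<le> u x"
            by (intro uI) (use x in \<open>auto simp: algebra_simps\<close>)
          then show "u (x + z) \<le> u x + u z" by simp
        }
        fix r :: real assume r: "r \<ge> 0"
        let ?rx = "ns_scale X (of_real r) x"
        have rx: "?rx \<in> ns_carrier X" using x by (rule carrier_scale)
        have pr: "p ?rx = r * p x" if "p \<in> C" for p using hom[OF that r x] .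
        show "u ?rx = r * u x"
        proof (cases "r = 0")
          case True
          then have "p 0 = 0" if "p \<in> C" for p using pr[OF that] by simp
          then have "u 0 = 0"
            using up[OF p0, of 0] p0 uI[OF carrier_zero, of 0] by fastforce
          then show ?thesis using True by simp
        next
          case F: False
          with r have r: "r > 0" by simp
          have "u ?rx / r \<le> u x"
          proof (rule uI[OF x])
            fix p assume p: "p \<in> C"
            show "u ?rx / r \<le> p x"
              using up[OF p, of ?rx] pr[OF p] r by (simp add: divide_le_eq mult.commute)
          qed
          moreover have "r * u x \<le> u ?rx"
          proof (rule uI[OF rx])
            fix p assume p: "p \<in> C"
            show "r * u x \<le> p ?rx"
              using up[OF p, of x] pr[OF p] r by simp
          qed
          ultimately show ?thesis using r by (simp add: field_simps)
        qed
      qed (simp add: u_def)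
      moreover have "u \<le> q"
        using up[OF p0] p0 CA by (auto simp: le_fun_def intro: order_trans)
      ultimately show ?thesis using up by (auto simp: le_fun_def)
    qed
  qed
  then show ?thesis by (auto intro: order_trans)
qed

text \<open>The norm is shifted at \<open>y\<close> before minimising: the resulting q has q (- y)
  \<le> - \<open>ns_norm X y\<close>, and a linear functional below q must then attain the norm at
  \<open>y\<close>.\<close>

lemma real_linear_norming:
  assumes y: "y \<in> ns_carrier X"
  shows "\<exists>p. (\<forall>x\<in>ns_carrier X. p x \<le> ns_norm X x) \<and> p y = ns_norm X y \<and>
     (\<forall>x\<in>ns_carrier X. \<forall>z\<in>ns_carrier X. p (x + z) = p x + p z) \<and>
     (\<forall>r. \<forall>x\<in>ns_carrier X. p (ns_scale X (of_real r) x) = r * p x)"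
proof -
  define n where "n x = (if x \<in> ns_carrier X then ns_norm X x else 0)" for x
  have "n \<in> sublinear_below_norm X"
    by (auto simp: sublinear_below_norm_def n_def carrier_add carrier_scale norm_triangle norm_scale)
  from sublinear_shift[OF this y] obtain q where q: "q \<in> sublinear_below_norm X"
    and qle: "\<And>x. x \<in> ns_carrier X \<Longrightarrow> q x \<le> n (x + y) - n y" by blast
  obtain m where m: "m \<in> sublinear_below_norm X" and mq: "m \<le> q"
    and min: "\<And>p. p \<in> sublinear_below_norm X \<Longrightarrow> p \<le> m \<Longrightarrow> p = m"
    using sublinear_minimal[OF q] by blast
  have le: "x \<in> ns_carrier X \<Longrightarrow> m x \<le> ns_norm X x"
    and sub: "x \<in> ns_carrier X \<Longrightarrow> z \<in> ns_carrier X \<Longrightarrow> m (x + z) \<le> m x + m z"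
    and hom: "r \<ge> 0 \<Longrightarrow> x \<in> ns_carrier X \<Longrightarrow> m (ns_scale X (of_real r) x) = r * m x" for x z r
    using m unfolding sublinear_below_norm_def by blast+
  \<comment> \<open>The shift of \<open>m\<close> at \<open>z\<close> lies below \<open>m\<close>,
    hence equals it by minimality; its last property then reads as superadditivity of
    \<open>m\<close>.\<close>
  have add: "m (x + z) = m x + m z" if "x \<in> ns_carrier X" "z \<in> ns_carrier X" for x z
    using sublinear_shift[OF m that(2)] min sub[OF that] that by fastforce
  have neg: "m (- x) = - m x" if "x \<in> ns_carrier X" for x
    using add[OF that carrier_minus[OF that]] sublinear_zero[OF m] by simp
  have "m (ns_scale X (of_real r) x) = r * m x" if x: "x \<in> ns_carrier X" for r x
  proof (cases "r \<ge> 0")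
    case True
    then show ?thesis using hom x by blast
  next
    case False
    then have "m (ns_scale X (of_real (- r)) x) = - r * m x" using hom[of "- r" x] x by simp
    then show ?thesis using neg[OF carrier_scale[OF x]] by simp
  qed
  moreover have "m y = ns_norm X y"
  proof -
    have "m (- y) \<le> n (- y + y) - n y"
      using le_funD[OF mq, of "- y"] qle[OF carrier_minus[OF y]] by (rule order_trans)
    then have "ns_norm X y \<le> m y"
      using neg[OF y] y carrier_zero by (simp add: n_def norm_zero)
    then show ?thesis using le[OF y] by simp
  qed
  ultimately show ?thesis using le add by (intro exI[of _ m]) blast
qed

end

section \<open>Operator spaces and duals\<close>

lemma operator_space_iff:
  "u \<in> ns_carrier (operator_space X Y) \<longleftrightarrow>
     bounded_linear_op X Y u \<and> (\<forall>x. x \<notin> ns_carrier X \<longrightarrow> u x = 0)"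
  by (simp add: operator_space_def)

lemma operator_spaceD:
  assumes "u \<in> ns_carrier (operator_space X Y)"
  shows "x \<in> ns_carrier X \<Longrightarrow> u x \<in> ns_carrier Y"
    and "x \<in> ns_carrier X \<Longrightarrow> z \<in> ns_carrier X \<Longrightarrow> u (x + z) = u x + u z"
    and "x \<in> ns_carrier X \<Longrightarrow> u (ns_scale X c x) = ns_scale Y c (u x)"
    and "x \<notin> ns_carrier X \<Longrightarrow> u x = 0"
  using assms unfolding operator_space_iff bounded_linear_op_def by blast+

lemma ns_scale_operator_space: "ns_scale (operator_space X Y) c u = (\<lambda>x. ns_scale Y c (u x))"
  by (simp add: operator_space_def)

lemma zero_in_cball: "normed_space X \<Longrightarrow> 0 \<in> ns_cball X"
  by (simp add: ns_cball_def normed_space.carrier_zero normed_space.norm_zero)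

lemma operator_norm_least:
  assumes "normed_space X" "\<And>x. x \<in> ns_cball X \<Longrightarrow> ns_norm Y (u x) \<le> C"
  shows "ns_norm (operator_space X Y) u \<le> C"
proof -
  have "ns_cball X \<noteq> {}" using zero_in_cball[OF assms(1)] by blast
  then show ?thesis
    using assms(2) by (auto simp: operator_space_def intro!: cSUP_least)
qed

lemma operator_norm_bound:
  fixes X :: "('k::real_or_complex, 'a::ab_group_add) nspace"
    and Y :: "('k, 'b::ab_group_add) nspace"
  assumes "normed_space X" "normed_space Y"
    and u: "u \<in> ns_carrier (operator_space X Y)" and x: "x \<in> ns_carrier X"
  shows "ns_norm Y (u x) \<le> ns_norm (operator_space X Y) u * ns_norm X x"
proof -
  interpret X: normed_space X by fact
  interpret Y: normed_space Y by fact
  interpret VY: vector_space "ns_scale Y" by (rule Y.vector_space_scale)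
  let ?N = "ns_norm (operator_space X Y) u"
  obtain C where C: "\<And>x. x \<in> ns_carrier X \<Longrightarrow> ns_norm Y (u x) \<le> C * ns_norm X x"
    using u unfolding operator_space_iff bounded_linear_op_def by blast
  have "ns_norm Y (u z) \<le> \<bar>C\<bar>" if "z \<in> ns_cball X" for z
  proof -
    have z: "z \<in> ns_carrier X" "ns_norm X z \<le> 1" using that by (auto simp: ns_cball_def)
    have "C * ns_norm X z \<le> \<bar>C\<bar> * 1"
      by (rule mult_mono) (use z X.norm_nonneg in auto)
    with C[OF z(1)] show ?thesis by simp
  qed
  then have bdd: "bdd_above ((\<lambda>z. ns_norm Y (u z)) ` ns_cball X)"
    by (auto simp: bdd_above_def)
  have upper: "ns_norm Y (u z) \<le> ?N" if "z \<in> ns_cball X" for z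
    using cSUP_upper[OF that bdd] by (simp add: operator_space_def)
  show ?thesis
  proof (cases "x = 0")
    case True
    have "u (ns_scale X 0 x) = ns_scale Y 0 (u x)" using operator_spaceD(3)[OF u x] .
    then have "u 0 = 0" using True X.norm_scale
      by (metis VY.scale_zero_left X.carrier_scale X.norm_eq_zero mult_zero_left norm_zero x)
    then show ?thesis using True by (simp add: X.norm_zero Y.norm_zero)
  next
    case False
    then have pos: "ns_norm X x > 0"
      using X.norm_nonneg[OF x] X.norm_eq_zero[OF x] by linarith
    let ?c = "of_real (1 / ns_norm X x) :: 'k"
    have c: "norm ?c = 1 / ns_norm X x" using pos by (simp add: norm_divide)
    have "ns_scale X ?c x \<in> ns_cball X"
      using x pos c by (simp add: ns_cball_def X.carrier_scale X.norm_scale)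
    from upper[OF this] have "norm ?c * ns_norm Y (u x) \<le> ?N"
      using operator_spaceD(1,3)[OF u x] by (simp add: Y.norm_scale)
    then have "1 / ns_norm X x * ns_norm Y (u x) \<le> ?N" by (simp only: c)
    then show ?thesis using pos by (simp add: field_simps)
  qed
qed

lemma normed_space_dual: "normed_space X \<Longrightarrow> normed_space (dual_space X)"
  unfolding dual_space_def by (intro normed_space_operator_space normed_space_scalar_space)

lemma dual_spaceD:
  assumes "f \<in> ns_carrier (dual_space X)"
  shows "x \<in> ns_carrier X \<Longrightarrow> z \<in> ns_carrier X \<Longrightarrow> f (x + z) = f x + f z"
    and "x \<in> ns_carrier X \<Longrightarrow> f (ns_scale X c x) = c * f x"
    and "x \<notin> ns_carrier X \<Longrightarrow> f x = 0"
  using operator_spaceD(2-4)[OF assms[unfolded dual_space_def]] by (simp_all add: scalar_space_def)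

lemma dual_space_diff:
  assumes "normed_space X" "f \<in> ns_carrier (dual_space X)" "x \<in> ns_carrier X" "z \<in> ns_carrier X"
  shows "f (x - z) = f x - f z"
  using dual_spaceD(1)[OF assms(2), of "x - z" z] assms normed_space.carrier_diff[OF assms(1)] by simp

lemma ns_scale_dual: "ns_scale (dual_space X) c f = (\<lambda>x. c * f x)"
  by (simp add: dual_space_def operator_space_def scalar_space_def)

lemma dual_norm_bound:
  assumes "normed_space X" "f \<in> ns_carrier (dual_space X)" "x \<in> ns_carrier X"
  shows "norm (f x) \<le> ns_norm (dual_space X) f * ns_norm X x"
  using operator_norm_bound[OF assms(1) normed_space_scalar_space assms(2)[unfolded dual_space_def] assms(3)]
  by (simp add: dual_space_def scalar_space_def)

lemma dual_norm_least:
  assumes "normed_space X" "\<And>x. x \<in> ns_cball X \<Longrightarrow> norm (f x) \<le> C"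
  shows "ns_norm (dual_space X) f \<le> C"
  unfolding dual_space_def by (rule operator_norm_least) (use assms in \<open>auto simp: scalar_space_def\<close>)

lemma dual_norm_exceeded:
  assumes "normed_space X" "f \<in> ns_carrier (dual_space X)" "r < ns_norm (dual_space X) f"
  shows "\<exists>x\<in>ns_cball X. r < norm (f x)"
  using dual_norm_least[OF assms(1), of f r] assms(3) by force

lemma dual_spaceI:
  assumes "normed_space X"
    and "\<And>x z. x \<in> ns_carrier X \<Longrightarrow> z \<in> ns_carrier X \<Longrightarrow> f (x + z) = f x + f z"
    and "\<And>c x. x \<in> ns_carrier X \<Longrightarrow> f (ns_scale X c x) = c * f x"
    and "\<And>x. x \<notin> ns_carrier X \<Longrightarrow> f x = 0"
    and bd: "\<And>x. x \<in> ns_carrier X \<Longrightarrow> norm (f x) \<le> C * ns_norm X x" and "0 \<le> C"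
  shows "f \<in> ns_carrier (dual_space X)" "ns_norm (dual_space X) f \<le> C"
proof -
  have "\<exists>C. \<forall>x\<in>ns_carrier X. norm (f x) \<le> C * ns_norm X x" using bd by blast
  then show "f \<in> ns_carrier (dual_space X)"
    using assms(2-4) unfolding dual_space_def operator_space_iff bounded_linear_op_def
    by (simp add: scalar_space_def)
  have "norm (f x) \<le> C" if "x \<in> ns_cball X" for x
  proof -
    have "x \<in> ns_carrier X" "ns_norm X x \<le> 1" using that by (auto simp: ns_cball_def)
    with bd[of x] mult_left_mono[of "ns_norm X x" 1 C] \<open>0 \<le> C\<close> show ?thesis by simp
  qed
  then show "ns_norm (dual_space X) f \<le> C" by (rule dual_norm_least[OF assms(1)])
qed

text \<open>Each condition on the right involves at most three coordinates and is closed, whereas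
  the operator norm is a supremum. In this form the ball is visibly closed for pointwise
  convergence.\<close>

lemma dual_ball_iff:
  assumes "normed_space X"
  shows "f \<in> ns_cball (dual_space X) \<longleftrightarrow>
    (\<forall>x. x \<notin> ns_carrier X \<longrightarrow> f x = 0) \<and> (\<forall>x\<in>ns_carrier X. norm (f x) \<le> ns_norm X x) \<and>
    (\<forall>x\<in>ns_carrier X. \<forall>z\<in>ns_carrier X. f (x + z) = f x + f z) \<and>
    (\<forall>c. \<forall>x\<in>ns_carrier X. f (ns_scale X c x) = c * f x)" (is "_ \<longleftrightarrow> ?R")
proof
  assume "f \<in> ns_cball (dual_space X)"
  then have f: "f \<in> ns_carrier (dual_space X)" "ns_norm (dual_space X) f \<le> 1"
    by (auto simp: ns_cball_def)
  have "norm (f x) \<le> ns_norm X x" if x: "x \<in> ns_carrier X" for x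
    using dual_norm_bound[OF assms f(1) x] mult_right_mono[OF f(2) normed_space.norm_nonneg[OF assms x]]
    by simp
  with dual_spaceD[OF f(1)] show ?R by blast
next
  assume ?R
  then show "f \<in> ns_cball (dual_space X)"
    using dual_spaceI[OF assms, of f 1] by (auto simp: ns_cball_def)
qed

theorem Hahn_Banach_norming:
  fixes X :: "('k::real_or_complex, 'a::ab_group_add) nspace"
  assumes "normed_space X" and y: "y \<in> ns_carrier X"
  shows "\<exists>f\<in>ns_cball (dual_space X). re (f y) = ns_norm X y"
proof -
  interpret normed_space X by fact
  interpret V: vector_space "ns_scale X" by (rule vector_space_scale)
  obtain p where ple: "\<And>x. x \<in> ns_carrier X \<Longrightarrow> p x \<le> ns_norm X x" and py: "p y = ns_norm X y"
    and padd: "\<And>x z. x \<in> ns_carrier X \<Longrightarrow> z \<in> ns_carrier X \<Longrightarrow> p (x + z) = p x + p z"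
    and phom: "\<And>r x. x \<in> ns_carrier X \<Longrightarrow> p (ns_scale X (of_real r) x) = r * p x"
    using real_linear_norming[OF y] by blast
  have "\<exists>f::'a \<Rightarrow> 'k. (\<forall>x\<in>ns_carrier X. re (f x) = p x) \<and>
    (\<forall>x\<in>ns_carrier X. \<forall>z\<in>ns_carrier X. f (x + z) = f x + f z) \<and>
    (\<forall>c. \<forall>x\<in>ns_carrier X. f (ns_scale X c x) = c * f x)"
    using scalar_from_re[where 'k='k]
  proof
    assume real: "\<forall>x::'k. x = of_real (re x)"
    have "of_real (p (ns_scale X c x)) = c * of_real (p x)" if "x \<in> ns_carrier X" for c x
      using phom[OF that, of "re c"] real by (metis of_real_mult)
    then show ?thesis
      by (intro exI[of _ "\<lambda>x. of_real (p x)"]) (auto simp: padd)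
  next
    assume "\<exists>i::'k. i * i = -1 \<and> (\<forall>x. x = of_real (re x) - i * of_real (re (i * x)))"
    then obtain i :: 'k where ii: "i * i = -1"
      and dec: "\<And>x. x = of_real (re x) - i * of_real (re (i * x))" by blast
    have "i \<noteq> 0" using ii by auto
    \<comment> \<open>The decomposition at 1 reads 1 = 1 - i \<open>re i\<close>.\<close>
    then have re_i: "re i = 0"
      using dec[of 1] re_of_real[of 1, where 'a='k] by simp
    \<comment> \<open>The usual complexification of a real-linear functional; homogeneity has to be
      checked only for real scalars and for \<open>i\<close>.\<close>
    define f where "f x = of_real (p x) - i * of_real (p (ns_scale X i x))" for x
    have add: "f (x + z) = f x + f z" if "x \<in> ns_carrier X" "z \<in> ns_carrier X" for x z
      using that by (simp add: f_def padd V.scale_right_distrib carrier_scale algebra_simps)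
    have hom_real: "f (ns_scale X (of_real r) x) = of_real r * f x" if "x \<in> ns_carrier X" for r x
    proof -
      have "ns_scale X i (ns_scale X (of_real r) x) = ns_scale X (of_real r) (ns_scale X i x)"
        by (simp add: mult.commute)
      then show ?thesis
        using that by (simp add: f_def phom carrier_scale algebra_simps del: V.scale_scale)
    qed
    have pminus: "p (- x) = - p x" if "x \<in> ns_carrier X" for x
      using phom[OF that, of "-1"] by simp
    have hom_i: "f (ns_scale X i x) = i * f x" if "x \<in> ns_carrier X" for x
    proof -
      have "i * (i * a) = - a" for a using ii by (simp add: mult.assoc[symmetric])
      then show ?thesis
        using that by (simp add: f_def ii pminus right_diff_distrib)
    qed
    have "f (ns_scale X c x) = c * f x" if x: "x \<in> ns_carrier X" for c x
    proof -
      let ?a = "of_real (re c) :: 'k" and ?b = "of_real (- re (i * c)) :: 'k"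
      have c: "c = ?a + ?b * i" using dec[of c] by (simp add: mult.commute)
      have "f (ns_scale X (?a + ?b * i) x) = f (ns_scale X ?a x + ns_scale X ?b (ns_scale X i x))"
        by (simp only: V.scale_left_distrib V.scale_scale)
      also have "\<dots> = ?a * f x + ?b * (i * f x)"
        by (simp only: add hom_real hom_i x carrier_scale)
      also have "\<dots> = (?a + ?b * i) * f x" by (simp only: distrib_right mult.assoc)
      finally show ?thesis using c by metis
    qed
    moreover have "re (f x) = p x" for x
      using re_of_real_mult[of "p (ns_scale X i x)" i]
      by (simp add: f_def re_diff re_i mult.commute)
    ultimately show ?thesis using add by (intro exI[of _ f]) blast
  qed
  then obtain f :: "'a \<Rightarrow> 'k" where f: "\<And>x. x \<in> ns_carrier X \<Longrightarrow> re (f x) = p x"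
      "\<And>x z. x \<in> ns_carrier X \<Longrightarrow> z \<in> ns_carrier X \<Longrightarrow> f (x + z) = f x + f z"
      "\<And>c x. x \<in> ns_carrier X \<Longrightarrow> f (ns_scale X c x) = c * f x"
    by blast
  have bound: "norm (f x) \<le> ns_norm X x" if x: "x \<in> ns_carrier X" for x
  proof -
    obtain c :: 'k where c: "norm c = 1" "c * f x = of_real (norm (f x))"
      using unimodular_rotation by blast
    \<comment> \<open>Rotating \<open>x\<close> by a unimodular scalar makes the value of
      \<open>f\<close> real, so the bound for the real part \<open>p\<close> becomes a bound for the
      modulus.\<close>
    have "norm (f x) = p (ns_scale X c x)"
      using f(1)[OF carrier_scale[OF x, of c]] f(3)[OF x, of c] c by simp
    then show ?thesis using ple[OF carrier_scale[OF x, of c]] c x by (simp add: norm_scale)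
  qed
  let ?f = "\<lambda>x. if x \<in> ns_carrier X then f x else 0"
  have "?f \<in> ns_cball (dual_space X)"
    unfolding dual_ball_iff[OF assms(1)] using f bound by (auto simp: carrier_add carrier_scale)
  moreover have "re (?f y) = ns_norm X y" using f(1)[OF y] y py by simp
  ultimately show ?thesis by (intro bexI[of _ ?f])
qed

text \<open>Tychonoff's theorem over the whole type: a coordinate off the carrier gets the ball of
  radius 0.\<close>

theorem Banach_Alaoglu:
  fixes X :: "('k::real_or_complex, 'a::ab_group_add) nspace"
  assumes "normed_space X"
  shows "compact (ns_cball (dual_space X))"
proof -
  let ?B = "\<lambda>x. cball (0::'k) (if x \<in> ns_carrier X then ns_norm X x else 0)"
  have "compactin (product_topology (\<lambda>_. euclidean) UNIV) (PiE UNIV ?B)"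
    unfolding compactin_PiE by (auto intro: compact_cball_scalar)
  then have P: "compact (PiE UNIV ?B)"
    by (simp add: euclidean_product_topology)
  have cont: "continuous_on UNIV (\<lambda>f::'a \<Rightarrow> 'k. f x)" for x
    by (rule continuous_on_product_coordinates)
  have "closed {f. (\<forall>x. x \<notin> ns_carrier X \<longrightarrow> f x = 0) \<and>
    (\<forall>x. x\<in>ns_carrier X \<longrightarrow> norm (f x) \<le> ns_norm X x) \<and>
    (\<forall>x. x\<in>ns_carrier X \<longrightarrow> (\<forall>z. z\<in>ns_carrier X \<longrightarrow> f (x + z) = f x + f z)) \<and>
    (\<forall>c x. x\<in>ns_carrier X \<longrightarrow> f (ns_scale X c x) = c * f x)}" (is "closed ?S")
    by (intro closed_Collect_conj closed_Collect_all closed_Collect_imp open_Collect_const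
        closed_Collect_eq closed_Collect_le continuous_intros cont)
  moreover have "ns_cball (dual_space X) = ?S \<inter> PiE UNIV ?B"
    by (auto simp: set_eq_iff dual_ball_iff[OF assms] PiE_def Pi_def)
  ultimately show ?thesis using P by (simp add: closed_Int_compact)
qed

section \<open>Adjoint images of dual balls as bounded weak-star compact sets\<close>

lemma bounded_linear_op_norm:
  assumes "bounded_linear_op X Y A" "normed_space X"
  shows "\<exists>C\<ge>0. \<forall>x\<in>ns_carrier X. ns_norm Y (A x) \<le> C * ns_norm X x"
proof -
  obtain C where C: "\<And>x. x \<in> ns_carrier X \<Longrightarrow> ns_norm Y (A x) \<le> C * ns_norm X x"
    using assms unfolding bounded_linear_op_def by blast
  have "ns_norm Y (A x) \<le> \<bar>C\<bar> * ns_norm X x" if x: "x \<in> ns_carrier X" for x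
    using C[OF x] mult_right_mono[OF abs_ge_self[of C] normed_space.norm_nonneg[OF assms(2) x]]
    by linarith
  then show ?thesis by (intro exI[of _ "\<bar>C\<bar>"]) auto
qed

lemma adjoint_op_dual:
  fixes X :: "('k::real_or_complex, 'a::ab_group_add) nspace"
    and Y :: "('k, 'b::ab_group_add) nspace"
  assumes X: "normed_space X" and Y: "normed_space Y" and A: "bounded_linear_op X Y A"
    and C: "\<And>x. x \<in> ns_carrier X \<Longrightarrow> ns_norm Y (A x) \<le> C * ns_norm X x" "C \<ge> 0"
    and g: "g \<in> ns_carrier (dual_space Y)"
  shows "adjoint_op X A g \<in> ns_carrier (dual_space X)"
    and "ns_norm (dual_space X) (adjoint_op X A g) \<le> ns_norm (dual_space Y) g * C"
proof -
  interpret X: normed_space X by fact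
  have A': "\<And>x. x \<in> ns_carrier X \<Longrightarrow> A x \<in> ns_carrier Y"
      "\<And>x z. x \<in> ns_carrier X \<Longrightarrow> z \<in> ns_carrier X \<Longrightarrow> A (x + z) = A x + A z"
      "\<And>c x. x \<in> ns_carrier X \<Longrightarrow> A (ns_scale X c x) = ns_scale Y c (A x)"
    using A unfolding bounded_linear_op_def by blast+
  let ?N = "ns_norm (dual_space Y) g"
  have N: "?N \<ge> 0" using normed_space.norm_nonneg[OF normed_space_dual[OF Y] g] .
  have bd: "norm (g (A x)) \<le> ?N * C * ns_norm X x" if x: "x \<in> ns_carrier X" for x
    using dual_norm_bound[OF Y g A'(1)[OF x]] mult_left_mono[OF C(1)[OF x] N] by (simp add: mult.assoc)
  have "adjoint_op X A g \<in> ns_carrier (dual_space X) \<and>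
      ns_norm (dual_space X) (adjoint_op X A g) \<le> ?N * C"
    using N C(2) bd
    by (intro conjI dual_spaceI[OF X, where C = "?N * C"]; simp add: adjoint_op_def A' X.carrier_add X.carrier_scale dual_spaceD[OF g])
  then show "adjoint_op X A g \<in> ns_carrier (dual_space X)"
    and "ns_norm (dual_space X) (adjoint_op X A g) \<le> ns_norm (dual_space Y) g * C" by auto
qed

lemma continuous_on_adjoint_op:
  "continuous_on S (adjoint_op X A :: ('b \<Rightarrow> 'k::real_or_complex) \<Rightarrow> 'a \<Rightarrow> 'k)"
proof (rule continuous_on_coordinatewise_then_product)
  fix x
  show "continuous_on S (\<lambda>g. (adjoint_op X A g :: 'a \<Rightarrow> 'k) x)"
    by (cases "x \<in> ns_carrier X")
       (auto simp: adjoint_op_def intro: continuous_on_subset[OF continuous_on_product_coordinates])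
qed

lemma adjoint_ball:
  fixes X :: "('k::real_or_complex, 'a::ab_group_add) nspace"
    and Y :: "('k, 'b::ab_group_add) nspace"
  assumes "normed_space X" "normed_space Y" "bounded_linear_op X Y A"
  defines "K \<equiv> adjoint_op X A ` ns_cball (dual_space Y)"
  shows "compact K" "K \<subseteq> ns_carrier (dual_space X)"
    and "\<exists>R>0. \<forall>f\<in>K. ns_norm (dual_space X) f \<le> R"
proof -
  show "compact K"
    unfolding K_def by (intro compact_continuous_image continuous_on_adjoint_op Banach_Alaoglu assms)
  obtain C where C: "C \<ge> 0" "\<And>x. x \<in> ns_carrier X \<Longrightarrow> ns_norm Y (A x) \<le> C * ns_norm X x"
    using bounded_linear_op_norm[OF assms(3,1)] by blast
  have adj: "adjoint_op X A g \<in> ns_carrier (dual_space X)"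
      "ns_norm (dual_space X) (adjoint_op X A g) \<le> ns_norm (dual_space Y) g * C"
    if "g \<in> ns_carrier (dual_space Y)" for g
    using adjoint_op_dual[OF assms(1-3), of C g] C that by blast+
  show "K \<subseteq> ns_carrier (dual_space X)"
    using adj(1) by (auto simp: K_def ns_cball_def)
  \<comment> \<open>The added 1 makes the bound positive even for the zero operator, so that it may
    later stand in a denominator.\<close>
  have "ns_norm (dual_space X) f \<le> C + 1" if f: "f \<in> K" for f
  proof -
    obtain g where g: "f = adjoint_op X A g" "g \<in> ns_carrier (dual_space Y)" "ns_norm (dual_space Y) g \<le> 1"
      using f by (auto simp: K_def ns_cball_def)
    from adj(2)[OF g(2)] mult_right_mono[OF g(3) C(1)] show ?thesis using g(1) by simp
  qed
  then show "\<exists>R>0. \<forall>f\<in>K. ns_norm (dual_space X) f \<le> R"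
    using C(1) by (intro exI[of _ "C + 1"]) auto
qed

section \<open>Injective tensor products\<close>

abbreviation tensor_ops ::
  "('k::real_or_complex, 'a::ab_group_add) nspace \<Rightarrow> ('k, 'b::ab_group_add) nspace \<Rightarrow>
    ('k, ('b \<Rightarrow> 'k) \<Rightarrow> 'a) nspace" where
  "tensor_ops X Y \<equiv> operator_space (dual_space Y) X"

abbreviation elementary_tensors ::
  "('k::real_or_complex, 'a::ab_group_add) nspace \<Rightarrow> ('k, 'b::ab_group_add) nspace \<Rightarrow>
    (('b \<Rightarrow> 'k) \<Rightarrow> 'a) set" where
  "elementary_tensors X Y \<equiv>
     {elementary_tensor X Y x y | x y. x \<in> ns_carrier X \<and> y \<in> ns_carrier Y}"

lemma ns_norm_injective_tensor: "ns_norm (injective_tensor X Y) = ns_norm (tensor_ops X Y)"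
  and ns_scale_injective_tensor: "ns_scale (injective_tensor X Y) = ns_scale (tensor_ops X Y)"
  by (simp_all add: injective_tensor_def Let_def)

context
  fixes X :: "('k::real_or_complex, 'a::ab_group_add) nspace"
    and Y :: "('k, 'b::ab_group_add) nspace"
  assumes X: "normed_space X" and Y: "normed_space Y"
begin

interpretation X: normed_space X by (rule X)
interpretation Y: normed_space Y by (rule Y)
interpretation D: normed_space "dual_space Y" by (rule normed_space_dual[OF Y])
interpretation L: normed_space "tensor_ops X Y"
  by (rule normed_space_operator_space[OF normed_space_dual[OF Y] X])
interpretation VX: vector_space "ns_scale X" by (rule X.vector_space_scale)
interpretation VL: vector_space "ns_scale (tensor_ops X Y)" by (rule L.vector_space_scale)
interpretation M: Metric_space "ns_carrier (tensor_ops X Y)" "ns_dist (tensor_ops X Y)"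
  by (rule L.Metric_space_ns_dist)

lemma elementary_tensor:
  assumes x: "x \<in> ns_carrier X" and y: "y \<in> ns_carrier Y"
  shows "elementary_tensor X Y x y \<in> ns_carrier (tensor_ops X Y)"
    and "ns_norm (tensor_ops X Y) (elementary_tensor X Y x y) \<le> ns_norm X x * ns_norm Y y"
proof -
  have nx: "ns_norm X x \<ge> 0" and ny: "ns_norm Y y \<ge> 0" using X.norm_nonneg[OF x] Y.norm_nonneg[OF y] .
  have bd: "ns_norm X (elementary_tensor X Y x y g) \<le> (ns_norm X x * ns_norm Y y) * ns_norm (dual_space Y) g"
    if g: "g \<in> ns_carrier (dual_space Y)" for g
    using g mult_right_mono[OF dual_norm_bound[OF Y g y] nx]
    by (simp add: elementary_tensor_def X.norm_scale x mult_ac)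
  then show "elementary_tensor X Y x y \<in> ns_carrier (tensor_ops X Y)"
    unfolding operator_space_iff bounded_linear_op_def
    by (auto simp: elementary_tensor_def X.carrier_scale x D.carrier_add
        D.carrier_scale[unfolded ns_scale_dual] VX.scale_left_distrib ns_scale_dual)
  show "ns_norm (tensor_ops X Y) (elementary_tensor X Y x y) \<le> ns_norm X x * ns_norm Y y"
  proof (rule operator_norm_least[OF normed_space_dual[OF Y]])
    fix g assume "g \<in> ns_cball (dual_space Y)"
    then have "g \<in> ns_carrier (dual_space Y)" "ns_norm (dual_space Y) g \<le> 1"
      by (auto simp: ns_cball_def)
    with bd[of g] mult_left_mono[of "ns_norm (dual_space Y) g" 1 "ns_norm X x * ns_norm Y y"] nx ny
    show "ns_norm X (elementary_tensor X Y x y g) \<le> ns_norm X x * ns_norm Y y" by simp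
  qed
qed

lemma span_elementary_tensors:
  "module.span (ns_scale (tensor_ops X Y)) (elementary_tensors X Y) \<subseteq> ns_carrier (tensor_ops X Y)"
  by (rule VL.span_minimal) (auto intro: elementary_tensor L.subspace_carrier)

lemma injective_tensor_iff:
  "u \<in> ns_carrier (injective_tensor X Y) \<longleftrightarrow> u \<in> ns_carrier (tensor_ops X Y) \<and>
     (\<forall>r>0. \<exists>v\<in>module.span (ns_scale (tensor_ops X Y)) (elementary_tensors X Y).
        ns_norm (tensor_ops X Y) (u - v) < r)"
proof -
  have "v \<in> M.mball u r \<longleftrightarrow> ns_norm (tensor_ops X Y) (u - v) < r"
    if "u \<in> ns_carrier (tensor_ops X Y)"
      "v \<in> module.span (ns_scale (tensor_ops X Y)) (elementary_tensors X Y)" for v r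
    using that span_elementary_tensors by (auto simp: M.mball_def ns_dist_def)
  then show ?thesis
    by (auto simp: injective_tensor_def Let_def M.metric_closure_of)
qed

lemma elementary_tensor_injective:
  assumes "x \<in> ns_carrier X" "y \<in> ns_carrier Y"
  shows "elementary_tensor X Y x y \<in> ns_carrier (injective_tensor X Y)"
  unfolding injective_tensor_iff
proof (intro conjI allI impI)
  fix r :: real assume "r > 0"
  then show "\<exists>v\<in>module.span (ns_scale (tensor_ops X Y)) (elementary_tensors X Y).
        ns_norm (tensor_ops X Y) (elementary_tensor X Y x y - v) < r"
    using assms
    by (intro bexI[of _ "elementary_tensor X Y x y"]) (auto simp: L.norm_zero intro!: VL.span_base)
qed (use elementary_tensor assms in blast)

lemma normed_space_injective_tensor: "normed_space (injective_tensor X Y)"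
proof (rule normed_space.intro)
  let ?S = "module.span (ns_scale (tensor_ops X Y)) (elementary_tensors X Y)"
  show "vector_space (ns_scale (injective_tensor X Y))"
    unfolding ns_scale_injective_tensor by (rule VL.vector_space_axioms)
  show "module.subspace (ns_scale (injective_tensor X Y)) (ns_carrier (injective_tensor X Y))"
    unfolding ns_scale_injective_tensor
  proof (rule VL.subspaceI)
    show "0 \<in> ns_carrier (injective_tensor X Y)"
      unfolding injective_tensor_iff using L.carrier_zero L.norm_zero VL.span_zero
      by (auto intro!: bexI[of _ 0])
  next
    fix u v assume u: "u \<in> ns_carrier (injective_tensor X Y)" and v: "v \<in> ns_carrier (injective_tensor X Y)"
    then have uL: "u \<in> ns_carrier (tensor_ops X Y)" and vL: "v \<in> ns_carrier (tensor_ops X Y)"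
      by (auto simp: injective_tensor_iff)
    show "u + v \<in> ns_carrier (injective_tensor X Y)"
      unfolding injective_tensor_iff
    proof (intro conjI allI impI)
      fix r :: real assume "r > 0"
      then have "r / 2 > 0" by simp
      with u v obtain a b where a: "a \<in> ?S" "ns_norm (tensor_ops X Y) (u - a) < r / 2"
        and b: "b \<in> ?S" "ns_norm (tensor_ops X Y) (v - b) < r / 2"
        unfolding injective_tensor_iff by meson
      have "a \<in> ns_carrier (tensor_ops X Y)" "b \<in> ns_carrier (tensor_ops X Y)"
        using a b span_elementary_tensors by auto
      then have "ns_norm (tensor_ops X Y) ((u - a) + (v - b)) < r"
        using L.norm_triangle[of "u - a" "v - b"] a b uL vL by (simp add: L.carrier_diff)
      then show "\<exists>w\<in>?S. ns_norm (tensor_ops X Y) (u + v - w) < r"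
        using a b by (intro bexI[of _ "a + b"]) (auto simp: algebra_simps intro: VL.span_add)
    qed (use uL vL L.carrier_add in blast)
  next
    fix c u assume u: "u \<in> ns_carrier (injective_tensor X Y)"
    then have uL: "u \<in> ns_carrier (tensor_ops X Y)"
      by (auto simp: injective_tensor_iff)
    show "ns_scale (tensor_ops X Y) c u \<in> ns_carrier (injective_tensor X Y)"
      unfolding injective_tensor_iff
    proof (intro conjI allI impI)
      fix r :: real assume "r > 0"
      then have "r / (norm c + 1) > 0" by (simp add: add_nonneg_pos)
      with u obtain a where a: "a \<in> ?S" "ns_norm (tensor_ops X Y) (u - a) < r / (norm c + 1)"
        unfolding injective_tensor_iff by meson
      have d: "u - a \<in> ns_carrier (tensor_ops X Y)"
        using a span_elementary_tensors uL L.carrier_diff by blast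
      have "norm c * ns_norm (tensor_ops X Y) (u - a) \<le> (norm c + 1) * ns_norm (tensor_ops X Y) (u - a)"
        using L.norm_nonneg[OF d] by (intro mult_right_mono) auto
      also have "\<dots> < r" using a(2) by (simp add: pos_less_divide_eq add_nonneg_pos mult.commute)
      finally have "ns_norm (tensor_ops X Y) (ns_scale (tensor_ops X Y) c (u - a)) < r"
        using L.norm_scale[OF d] by simp
      then show "\<exists>w\<in>?S. ns_norm (tensor_ops X Y) (ns_scale (tensor_ops X Y) c u - w) < r"
        using a by (intro bexI[of _ "ns_scale (tensor_ops X Y) c a"])
          (auto simp: VL.scale_right_diff_distrib intro: VL.span_scale)
    qed (use uL L.carrier_scale in blast)
  qed
qed (auto simp: injective_tensor_iff ns_norm_injective_tensor ns_scale_injective_tensor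
    L.norm_eq_zero L.norm_triangle L.norm_scale)

text \<open>The functional \<open>f \<otimes> g\<close>. The value 0 off the tensor product is the
  normal form required of elements of a dual space.\<close>

definition tensor_functional :: "('a \<Rightarrow> 'k) \<Rightarrow> ('b \<Rightarrow> 'k) \<Rightarrow> (('b \<Rightarrow> 'k) \<Rightarrow> 'a) \<Rightarrow> 'k" where
  "tensor_functional f g u = (if u \<in> ns_carrier (injective_tensor X Y) then f (u g) else 0)"

lemma tensor_pairing_bound:
  assumes u: "u \<in> ns_carrier (tensor_ops X Y)"
    and f: "f \<in> ns_carrier (dual_space X)" and g: "g \<in> ns_carrier (dual_space Y)"
  shows "norm (f (u g)) \<le> ns_norm (dual_space X) f * ns_norm (dual_space Y) g * ns_norm (tensor_ops X Y) u"
proof -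
  have "norm (f (u g)) \<le> ns_norm (dual_space X) f * ns_norm X (u g)"
    by (rule dual_norm_bound[OF X f operator_spaceD(1)[OF u g]])
  also have "\<dots> \<le> ns_norm (dual_space X) f * (ns_norm (tensor_ops X Y) u * ns_norm (dual_space Y) g)"
    using operator_norm_bound[OF D.normed_space_axioms X u g]
      normed_space.norm_nonneg[OF normed_space_dual[OF X] f] by (rule mult_left_mono)
  finally show ?thesis by (simp add: mult_ac)
qed

lemma tensor_functional_dual:
  assumes f: "f \<in> ns_carrier (dual_space X)" and g: "g \<in> ns_carrier (dual_space Y)"
  shows "tensor_functional f g \<in> ns_carrier (dual_space (injective_tensor X Y))"
    and "ns_norm (dual_space (injective_tensor X Y)) (tensor_functional f g)
           \<le> ns_norm (dual_space X) f * ns_norm (dual_space Y) g"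
proof -
  interpret I: normed_space "injective_tensor X Y" by (rule normed_space_injective_tensor)
  have mem: "u g \<in> ns_carrier X" if "u \<in> ns_carrier (injective_tensor X Y)" for u
    using that g operator_spaceD(1) unfolding injective_tensor_iff by blast
  have bd: "norm (tensor_functional f g u) \<le>
      ns_norm (dual_space X) f * ns_norm (dual_space Y) g * ns_norm (injective_tensor X Y) u"
    if "u \<in> ns_carrier (injective_tensor X Y)" for u
    using that tensor_pairing_bound[OF _ f g, of u]
    by (simp add: tensor_functional_def injective_tensor_iff ns_norm_injective_tensor)
  have nn: "0 \<le> ns_norm (dual_space X) f * ns_norm (dual_space Y) g"
    using normed_space.norm_nonneg[OF normed_space_dual[OF X] f] D.norm_nonneg[OF g] by simp
  have "tensor_functional f g (u + v) = tensor_functional f g u + tensor_functional f g v"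
    if "u \<in> ns_carrier (injective_tensor X Y)" "v \<in> ns_carrier (injective_tensor X Y)" for u v
    using that I.carrier_add[OF that] dual_spaceD(1)[OF f mem mem]
    by (simp add: tensor_functional_def)
  moreover have "tensor_functional f g (ns_scale (injective_tensor X Y) c u) = c * tensor_functional f g u"
    if "u \<in> ns_carrier (injective_tensor X Y)" for c u
    using that I.carrier_scale[OF that, of c] dual_spaceD(2)[OF f mem[OF that]]
    by (simp add: tensor_functional_def ns_scale_injective_tensor ns_scale_operator_space)
  moreover have "tensor_functional f g u = 0" if "u \<notin> ns_carrier (injective_tensor X Y)" for u
    using that by (simp add: tensor_functional_def)
  ultimately show "tensor_functional f g \<in> ns_carrier (dual_space (injective_tensor X Y))"
    and "ns_norm (dual_space (injective_tensor X Y)) (tensor_functional f g)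
           \<le> ns_norm (dual_space X) f * ns_norm (dual_space Y) g"
    using dual_spaceI[OF I.normed_space_axioms _ _ _ bd nn] by blast+
qed

text \<open>Only on bounded sets is the pairing jointly continuous: there it is a uniform limit of the
  pairings with finite sums of elementary tensors.\<close>

lemma continuous_on_tensor_pairing:
  assumes u: "u \<in> ns_carrier (injective_tensor X Y)"
    and K0: "K0 \<subseteq> ns_carrier (dual_space X)" "\<And>f. f \<in> K0 \<Longrightarrow> ns_norm (dual_space X) f \<le> R"
    and K1: "K1 \<subseteq> ns_carrier (dual_space Y)" "\<And>g. g \<in> K1 \<Longrightarrow> ns_norm (dual_space Y) g \<le> R"
  shows "continuous_on (K0 \<times> K1) (\<lambda>p. fst p (u (snd p)))"
proof -
  let ?c = "\<lambda>v. continuous_on (K0 \<times> K1) (\<lambda>p. fst p (v (snd p)))"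
  let ?S = "{v \<in> ns_carrier (tensor_ops X Y). ?c v}"
  let ?span = "module.span (ns_scale (tensor_ops X Y)) (elementary_tensors X Y)"
  have coord: "continuous_on (K0 \<times> K1) (\<lambda>p. fst p x)" "continuous_on (K0 \<times> K1) (\<lambda>p. snd p y)" for x y
    by (rule continuous_on_product_then_coordinatewise, intro continuous_intros)+
  have "?span \<subseteq> ?S"
  proof (rule VL.span_minimal)
    show "elementary_tensors X Y \<subseteq> ?S"
    proof clarify
      fix x y assume x: "x \<in> ns_carrier X" and y: "y \<in> ns_carrier Y"
      have "?c (elementary_tensor X Y x y) \<longleftrightarrow> continuous_on (K0 \<times> K1) (\<lambda>p. snd p y * fst p x)"
        using K0 K1 x by (intro continuous_on_cong refl) (auto simp: elementary_tensor_def dual_spaceD)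
      then show "elementary_tensor X Y x y \<in> ns_carrier (tensor_ops X Y) \<and> ?c (elementary_tensor X Y x y)"
        using coord elementary_tensor[OF x y] by (auto intro: continuous_intros)
    qed
    show "VL.subspace ?S"
    proof (rule VL.subspaceI)
      have "?c 0 \<longleftrightarrow> continuous_on (K0 \<times> K1) (\<lambda>p. fst p (0::'a))"
        by simp
      then show "0 \<in> ?S" using coord L.carrier_zero by simp
    next
      fix v w assume v: "v \<in> ?S" and w: "w \<in> ?S"
      have "?c (v + w) \<longleftrightarrow> continuous_on (K0 \<times> K1) (\<lambda>p. fst p (v (snd p)) + fst p (w (snd p)))"
        using K0 K1 v w by (intro continuous_on_cong refl)
          (auto intro!: dual_spaceD(1) dest: operator_spaceD(1))
      then show "v + w \<in> ?S" using v w L.carrier_add by (auto intro: continuous_intros)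
    next
      fix c v assume v: "v \<in> ?S"
      have "?c (ns_scale (tensor_ops X Y) c v) \<longleftrightarrow> continuous_on (K0 \<times> K1) (\<lambda>p. c * fst p (v (snd p)))"
        using K0 K1 v by (intro continuous_on_cong refl)
          (auto simp: ns_scale_operator_space intro!: dual_spaceD(2) dest: operator_spaceD(1))
      then show "ns_scale (tensor_ops X Y) c v \<in> ?S"
        using v L.carrier_scale by (auto intro: continuous_intros)
    qed
  qed
  then have cont: "?c v" if "v \<in> ?span" for v using that by blast
  have uL: "u \<in> ns_carrier (tensor_ops X Y)"
    and apx: "\<And>r. r > 0 \<Longrightarrow> \<exists>v\<in>?span. ns_norm (tensor_ops X Y) (u - v) < r"
    using u unfolding injective_tensor_iff by blast+
  have "\<forall>n. \<exists>v. v \<in> ?span \<and> ns_norm (tensor_ops X Y) (u - v) < inverse (real (Suc n))"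
  proof
    fix n
    have "inverse (real (Suc n)) > 0" by simp
    from apx[OF this] show "\<exists>v. v \<in> ?span \<and> ns_norm (tensor_ops X Y) (u - v) < inverse (real (Suc n))"
      by blast
  qed
  from choice[OF this] obtain v where v: "\<And>n. v n \<in> ?span"
      "\<And>n. ns_norm (tensor_ops X Y) (u - v n) < inverse (real (Suc n))"
    by blast
  have "uniform_limit (K0 \<times> K1) (\<lambda>n p. fst p (v n (snd p))) (\<lambda>p. fst p (u (snd p))) sequentially"
  proof (rule uniform_limitI)
    fix e :: real assume e: "e > 0"
    have "(\<lambda>n. R * R * inverse (real (Suc n))) \<longlonglongrightarrow> R * R * 0"
      by (intro tendsto_intros LIMSEQ_inverse_real_of_nat)
    then have "\<forall>\<^sub>F n in sequentially. R * R * inverse (real (Suc n)) < e"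
      using e by (auto dest: order_tendstoD)
    then show "\<forall>\<^sub>F n in sequentially. \<forall>p\<in>K0 \<times> K1. dist (fst p (v n (snd p))) (fst p (u (snd p))) < e"
    proof (rule eventually_mono, clarsimp)
      fix n f g assume n: "R * R * inverse (1 + real n) < e" and f: "f \<in> K0" and g: "g \<in> K1"
      have fD: "f \<in> ns_carrier (dual_space X)" and gD: "g \<in> ns_carrier (dual_space Y)"
        using f g K0 K1 by auto
      have vL: "v n \<in> ns_carrier (tensor_ops X Y)" using v(1) span_elementary_tensors by blast
      have d: "u - v n \<in> ns_carrier (tensor_ops X Y)" using uL vL L.carrier_diff by blast
      have nf: "0 \<le> ns_norm (dual_space X) f" "0 \<le> ns_norm (dual_space Y) g"
        using normed_space.norm_nonneg[OF normed_space_dual[OF X] fD] D.norm_nonneg[OF gD] by auto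
      have "dist (f (v n g)) (f (u g)) = norm (f ((u - v n) g))"
        using dual_space_diff[OF X fD operator_spaceD(1)[OF uL gD] operator_spaceD(1)[OF vL gD]]
        by (simp add: dist_norm norm_minus_commute)
      also have "\<dots> \<le> ns_norm (dual_space X) f * ns_norm (dual_space Y) g * ns_norm (tensor_ops X Y) (u - v n)"
        by (rule tensor_pairing_bound[OF d fD gD])
      also have "\<dots> \<le> R * R * inverse (real (Suc n))"
        using K0(2)[OF f] K1(2)[OF g] nf v(2)[of n] L.norm_nonneg[OF d]
        by (intro mult_mono) auto
      finally show "dist (f (v n g)) (f (u g)) < e" using n by simp
    qed
  qed
  then show ?thesis
    by (rule uniform_limit_theorem[rotated]) (use cont v(1) in auto)
qed

end

section \<open>Tensor products of operators\<close>

context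
  fixes X0 :: "('k::real_or_complex, 'x0::ab_group_add) nspace"
    and X1 :: "('k, 'x1::ab_group_add) nspace"
    and Y0 :: "('k, 'y0::ab_group_add) nspace"
    and Y1 :: "('k, 'y1::ab_group_add) nspace"
    and A0 :: "'x0 \<Rightarrow> 'y0" and A1 :: "'x1 \<Rightarrow> 'y1"
  assumes X0: "normed_space X0" and X1: "normed_space X1"
    and Y0: "normed_space Y0" and Y1: "normed_space Y1"
    and A0: "bounded_linear_op X0 Y0 A0" and A1: "bounded_linear_op X1 Y1 A1"
begin

lemma tensor_op_bounded_tensor_ops:
  "bounded_linear_op (tensor_ops X0 X1) (tensor_ops Y0 Y1) (tensor_op X1 Y1 A0 A1)"
proof -
  interpret DX: normed_space "dual_space X1" by (rule normed_space_dual[OF X1])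
  interpret DY: normed_space "dual_space Y1" by (rule normed_space_dual[OF Y1])
  interpret LX: normed_space "tensor_ops X0 X1"
    by (rule normed_space_operator_space[OF normed_space_dual[OF X1] X0])
  obtain C0 where C0: "C0 \<ge> 0" "\<And>x. x \<in> ns_carrier X0 \<Longrightarrow> ns_norm Y0 (A0 x) \<le> C0 * ns_norm X0 x"
    using bounded_linear_op_norm[OF A0 X0] by blast
  obtain C1 where C1: "C1 \<ge> 0" "\<And>x. x \<in> ns_carrier X1 \<Longrightarrow> ns_norm Y1 (A1 x) \<le> C1 * ns_norm X1 x"
    using bounded_linear_op_norm[OF A1 X1] by blast
  have adj: "adjoint_op X1 A1 g \<in> ns_carrier (dual_space X1)"
      "ns_norm (dual_space X1) (adjoint_op X1 A1 g) \<le> ns_norm (dual_space Y1) g * C1"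
    if "g \<in> ns_carrier (dual_space Y1)" for g
    using adjoint_op_dual[OF X1 Y1 A1, of C1 g] C1 that by blast+
  have A0': "\<And>x. x \<in> ns_carrier X0 \<Longrightarrow> A0 x \<in> ns_carrier Y0"
      "\<And>x z. x \<in> ns_carrier X0 \<Longrightarrow> z \<in> ns_carrier X0 \<Longrightarrow> A0 (x + z) = A0 x + A0 z"
      "\<And>c x. x \<in> ns_carrier X0 \<Longrightarrow> A0 (ns_scale X0 c x) = ns_scale Y0 c (A0 x)"
    using A0 unfolding bounded_linear_op_def by blast+
  have adj_add: "adjoint_op X1 A1 (g + h) = adjoint_op X1 A1 g + adjoint_op X1 A1 h" for g h
    by (auto simp: adjoint_op_def fun_eq_iff)
  have adj_scale: "adjoint_op X1 A1 (ns_scale (dual_space Y1) c g) =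
      ns_scale (dual_space X1) c (adjoint_op X1 A1 g)" for c g
    by (auto simp: adjoint_op_def fun_eq_iff ns_scale_dual)
  let ?T = "tensor_op X1 Y1 A0 A1"
  have bd: "ns_norm Y0 (?T u g) \<le> C0 * C1 * ns_norm (tensor_ops X0 X1) u * ns_norm (dual_space Y1) g"
    if u: "u \<in> ns_carrier (tensor_ops X0 X1)" and g: "g \<in> ns_carrier (dual_space Y1)" for u g
  proof -
    have "ns_norm Y0 (?T u g) \<le> C0 * ns_norm X0 (u (adjoint_op X1 A1 g))"
      using C0(2)[OF operator_spaceD(1)[OF u adj(1)[OF g]]] g by (simp add: tensor_op_def)
    also have "\<dots> \<le> C0 * (ns_norm (tensor_ops X0 X1) u * ns_norm (dual_space X1) (adjoint_op X1 A1 g))"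
      using operator_norm_bound[OF DX.normed_space_axioms X0 u adj(1)[OF g]] C0(1) by (rule mult_left_mono)
    also have "\<dots> \<le> C0 * (ns_norm (tensor_ops X0 X1) u * (ns_norm (dual_space Y1) g * C1))"
      using adj(2)[OF g] C0(1) LX.norm_nonneg[OF u] by (intro mult_left_mono) auto
    finally show ?thesis by (simp add: mult_ac)
  qed
  have "?T u \<in> ns_carrier (tensor_ops Y0 Y1)" if u: "u \<in> ns_carrier (tensor_ops X0 X1)" for u
    unfolding operator_space_iff bounded_linear_op_def
  proof (intro conjI)
    show "\<forall>g\<in>ns_carrier (dual_space Y1). ?T u g \<in> ns_carrier Y0"
      using A0'(1) operator_spaceD(1)[OF u] adj(1) by (simp add: tensor_op_def)
    show "\<forall>g\<in>ns_carrier (dual_space Y1). \<forall>h\<in>ns_carrier (dual_space Y1). ?T u (g + h) = ?T u g + ?T u h"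
      by (simp add: tensor_op_def DY.carrier_add adj_add operator_spaceD(1,2)[OF u] adj(1) A0'(2))
    show "\<forall>c. \<forall>g\<in>ns_carrier (dual_space Y1). ?T u (ns_scale (dual_space Y1) c g) = ns_scale Y0 c (?T u g)"
      by (simp add: tensor_op_def DY.carrier_scale adj_scale operator_spaceD(1,3)[OF u] adj(1) A0'(3))
    show "\<exists>C. \<forall>g\<in>ns_carrier (dual_space Y1). ns_norm Y0 (?T u g) \<le> C * ns_norm (dual_space Y1) g"
      using bd[OF u] by blast
    show "\<forall>g. g \<notin> ns_carrier (dual_space Y1) \<longrightarrow> ?T u g = 0"
      by (simp add: tensor_op_def)
  qed
  moreover have "?T (u + v) = ?T u + ?T v"
    if u: "u \<in> ns_carrier (tensor_ops X0 X1)" and v: "v \<in> ns_carrier (tensor_ops X0 X1)" for u v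
    using operator_spaceD(1)[OF u adj(1)] operator_spaceD(1)[OF v adj(1)]
    by (auto simp: tensor_op_def fun_eq_iff A0'(2))
  moreover have "?T (ns_scale (tensor_ops X0 X1) c u) = ns_scale (tensor_ops Y0 Y1) c (?T u)"
    if u: "u \<in> ns_carrier (tensor_ops X0 X1)" for c u
  proof -
    interpret VY: vector_space "ns_scale Y0" by (rule normed_space.vector_space_scale[OF Y0])
    show ?thesis using operator_spaceD(1)[OF u adj(1)]
      by (auto simp: tensor_op_def fun_eq_iff ns_scale_operator_space A0'(3))
  qed
  moreover have "ns_norm (tensor_ops Y0 Y1) (?T u) \<le> C0 * C1 * ns_norm (tensor_ops X0 X1) u"
    if u: "u \<in> ns_carrier (tensor_ops X0 X1)" for u
  proof (rule operator_norm_least[OF DY.normed_space_axioms])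
    fix g assume "g \<in> ns_cball (dual_space Y1)"
    then have g: "g \<in> ns_carrier (dual_space Y1)" "ns_norm (dual_space Y1) g \<le> 1"
      by (auto simp: ns_cball_def)
    have "C0 * C1 * ns_norm (tensor_ops X0 X1) u * ns_norm (dual_space Y1) g
        \<le> C0 * C1 * ns_norm (tensor_ops X0 X1) u * 1"
      using g(2) C0(1) C1(1) LX.norm_nonneg[OF u] by (intro mult_left_mono) auto
    with bd[OF u g(1)] show "ns_norm Y0 (?T u g) \<le> C0 * C1 * ns_norm (tensor_ops X0 X1) u" by simp
  qed
  ultimately show ?thesis
    unfolding bounded_linear_op_def by blast
qed

lemma tensor_op_elementary:
  assumes x: "x \<in> ns_carrier X0" and y: "y \<in> ns_carrier X1"
  shows "tensor_op X1 Y1 A0 A1 (elementary_tensor X0 X1 x y) = elementary_tensor Y0 Y1 (A0 x) (A1 y)"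
proof
  fix g
  obtain C1 where C1: "C1 \<ge> 0" "\<And>x. x \<in> ns_carrier X1 \<Longrightarrow> ns_norm Y1 (A1 x) \<le> C1 * ns_norm X1 x"
    using bounded_linear_op_norm[OF A1 X1] by blast
  have "adjoint_op X1 A1 g \<in> ns_carrier (dual_space X1)" if "g \<in> ns_carrier (dual_space Y1)"
    using adjoint_op_dual(1)[OF X1 Y1 A1, of C1 g] C1 that by blast
  then show "tensor_op X1 Y1 A0 A1 (elementary_tensor X0 X1 x y) g = elementary_tensor Y0 Y1 (A0 x) (A1 y) g"
    using x y A0 by (auto simp: tensor_op_def elementary_tensor_def adjoint_op_def bounded_linear_op_def)
qed

text \<open>The estimate is inherited from the ambient operator spaces. The new point is that
  closures are respected: elementary tensors, hence their span, go into the span, and boundedness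
  carries approximations over.\<close>

lemma tensor_op_bounded:
  "bounded_linear_op (injective_tensor X0 X1) (injective_tensor Y0 Y1) (tensor_op X1 Y1 A0 A1)"
proof -
  interpret LX: normed_space "tensor_ops X0 X1"
    by (rule normed_space_operator_space[OF normed_space_dual[OF X1] X0])
  interpret LY: normed_space "tensor_ops Y0 Y1"
    by (rule normed_space_operator_space[OF normed_space_dual[OF Y1] Y0])
  interpret VX: vector_space "ns_scale (tensor_ops X0 X1)" by (rule LX.vector_space_scale)
  interpret VY: vector_space "ns_scale (tensor_ops Y0 Y1)" by (rule LY.vector_space_scale)
  let ?T = "tensor_op X1 Y1 A0 A1"
  note T = tensor_op_bounded_tensor_ops[unfolded bounded_linear_op_def]
  obtain C where C: "C \<ge> 0" "\<And>u. u \<in> ns_carrier (tensor_ops X0 X1) \<Longrightarrow>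
      ns_norm (tensor_ops Y0 Y1) (?T u) \<le> C * ns_norm (tensor_ops X0 X1) u"
    using bounded_linear_op_norm[OF tensor_op_bounded_tensor_ops LX.normed_space_axioms] by blast
  let ?SX = "VX.span (elementary_tensors X0 X1)" and ?SY = "VY.span (elementary_tensors Y0 Y1)"
  have "?SX \<subseteq> {v \<in> ns_carrier (tensor_ops X0 X1). ?T v \<in> ?SY}"
  proof (rule VX.span_minimal)
    show "elementary_tensors X0 X1 \<subseteq> {v \<in> ns_carrier (tensor_ops X0 X1). ?T v \<in> ?SY}"
    proof clarify
      fix x y assume x: "x \<in> ns_carrier X0" and y: "y \<in> ns_carrier X1"
      have "A0 x \<in> ns_carrier Y0" "A1 y \<in> ns_carrier Y1"
        using A0 A1 x y unfolding bounded_linear_op_def by blast+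
      then show "elementary_tensor X0 X1 x y \<in> ns_carrier (tensor_ops X0 X1) \<and>
          ?T (elementary_tensor X0 X1 x y) \<in> ?SY"
        using elementary_tensor(1)[OF X0 X1 x y] by (auto simp: tensor_op_elementary[OF x y] intro!: VY.span_base)
    qed
    have "?T (0 + 0) = ?T 0 + ?T 0" using T LX.carrier_zero by blast
    then have "?T 0 = 0" by simp
    then show "VX.subspace {v \<in> ns_carrier (tensor_ops X0 X1). ?T v \<in> ?SY}"
      using T LX.carrier_zero LX.carrier_add LX.carrier_scale VY.span_zero VY.span_add VY.span_scale
      by (intro VX.subspaceI) auto
  qed
  then have span: "v \<in> ns_carrier (tensor_ops X0 X1)" "?T v \<in> ?SY" if "v \<in> ?SX" for v
    using that by auto
  have diff: "?T (u - v) = ?T u - ?T v"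
    if "u \<in> ns_carrier (tensor_ops X0 X1)" "v \<in> ns_carrier (tensor_ops X0 X1)" for u v
  proof -
    have "?T ((u - v) + v) = ?T (u - v) + ?T v" using T that LX.carrier_diff by blast
    then show ?thesis by simp
  qed
  have "?T u \<in> ns_carrier (injective_tensor Y0 Y1)" if u: "u \<in> ns_carrier (injective_tensor X0 X1)" for u
    unfolding injective_tensor_iff[OF Y0 Y1]
  proof (intro conjI allI impI)
    have uL: "u \<in> ns_carrier (tensor_ops X0 X1)" using u injective_tensor_iff[OF X0 X1] by blast
    then show "?T u \<in> ns_carrier (tensor_ops Y0 Y1)" using T by blast
    fix r :: real assume "r > 0"
    then have "r / (C + 1) > 0" using C(1) by simp
    then obtain v where v: "v \<in> ?SX" "ns_norm (tensor_ops X0 X1) (u - v) < r / (C + 1)"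
      using u injective_tensor_iff[OF X0 X1] by meson
    have d: "u - v \<in> ns_carrier (tensor_ops X0 X1)" using uL span(1)[OF v(1)] LX.carrier_diff by blast
    have "ns_norm (tensor_ops Y0 Y1) (?T u - ?T v) \<le> C * ns_norm (tensor_ops X0 X1) (u - v)"
      using C(2)[OF d] diff[OF uL span(1)[OF v(1)]] by simp
    also have "\<dots> \<le> (C + 1) * ns_norm (tensor_ops X0 X1) (u - v)"
      using LX.norm_nonneg[OF d] by (intro mult_right_mono) auto
    also have "\<dots> < r" using v(2) C(1) by (simp add: pos_less_divide_eq mult.commute)
    finally show "\<exists>w\<in>?SY. ns_norm (tensor_ops Y0 Y1) (?T u - w) < r"
      using span(2)[OF v(1)] by blast
  qed
  then show ?thesis
    using T injective_tensor_iff[OF X0 X1]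
    unfolding bounded_linear_op_def ns_scale_injective_tensor ns_norm_injective_tensor by blast
qed

end

section \<open>Szlenk derivations\<close>

lemma szlenk_deriv_nonpos: "\<epsilon> \<le> 0 \<Longrightarrow> szlenk_deriv X \<epsilon> K = K"
  by (simp add: szlenk_deriv_def)

lemma szlenk_deriv_subset: "szlenk_deriv X \<epsilon> K \<subseteq> K"
  by (auto simp: szlenk_deriv_def)

lemma foldr_szlenk_deriv_subset: "foldr (szlenk_deriv X) \<epsilon>s K \<subseteq> K"
  by (induction \<epsilon>s) (use szlenk_deriv_subset in fastforce)+

text \<open>As \<open>K\<close> lies in the dual, weak-star open sets and open sets of the whole
  function space have the same traces on \<open>K\<close>; a strict lower bound for a supremum is
  witnessed by one pair.\<close>

lemma szlenk_deriv_iff: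
  fixes X :: "('k::real_or_complex, 'a::ab_group_add) nspace"
  assumes X: "normed_space X" and K: "K \<subseteq> ns_carrier (dual_space X)" and \<epsilon>: "\<epsilon> > 0"
  shows "f \<in> szlenk_deriv X \<epsilon> K \<longleftrightarrow> f \<in> K \<and>
    (\<forall>U. open U \<and> f \<in> U \<longrightarrow> (\<exists>g\<in>U \<inter> K. \<exists>h\<in>U \<inter> K. \<epsilon> < ns_norm (dual_space X) (g - h)))"
proof -
  have diam: "ennreal \<epsilon> < ns_diam (dual_space X) S \<longleftrightarrow>
      (\<exists>g\<in>S. \<exists>h\<in>S. \<epsilon> < ns_norm (dual_space X) (g - h))" for S
    using \<epsilon> by (auto simp: ns_diam_def less_SUP_iff ennreal_less_iff)
  have opn: "openin (weak_star_topology X) V \<longleftrightarrow> (\<exists>U. open U \<and> V = U \<inter> ns_carrier (dual_space X))" for V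
    by (auto simp: weak_star_topology_def euclidean_product_topology openin_subtopology)
  have int: "(U \<inter> ns_carrier (dual_space X)) \<inter> K = U \<inter> K" for U using K by blast
  have "(\<forall>V. openin (weak_star_topology X) V \<and> f \<in> V \<longrightarrow> P (V \<inter> K)) \<longleftrightarrow>
      (\<forall>U. open U \<and> f \<in> U \<longrightarrow> P (U \<inter> K))" if "f \<in> K" for P
  proof -
    have "f \<in> ns_carrier (dual_space X)" using that K by blast
    then show ?thesis unfolding opn by (metis Int_iff int)
  qed
  note this[of "\<lambda>S. ennreal \<epsilon> < ns_diam (dual_space X) S"]
  then show ?thesis
    using \<epsilon> unfolding szlenk_deriv_def diam by auto
qed

text \<open>The points removed are covered by the open sets whose trace on \<open>K\<close> has
  diameter at most \<epsilon>. The closed set \<open>T\<close> is what later cuts compact sets of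
  pairs down to compact sets.\<close>

lemma szlenk_deriv_closed_Int:
  assumes "normed_space X" "K \<subseteq> ns_carrier (dual_space X)"
  shows "\<exists>T. closed T \<and> szlenk_deriv X \<epsilon> K = K \<inter> T"
proof (cases "\<epsilon> \<le> 0")
  case True
  then show ?thesis by (intro exI[of _ UNIV]) (simp add: szlenk_deriv_nonpos)
next
  case False
  then have \<epsilon>: "\<epsilon> > 0" by simp
  define \<U> where "\<U> = {U. open U \<and> \<not> (\<exists>g\<in>U \<inter> K. \<exists>h\<in>U \<inter> K. \<epsilon> < ns_norm (dual_space X) (g - h))}"
  have "szlenk_deriv X \<epsilon> K = K \<inter> - \<Union>\<U>"
    using szlenk_deriv_iff[OF assms \<epsilon>] by (auto simp: \<U>_def)
  moreover have "closed (- \<Union>\<U>)" by (auto simp: \<U>_def closed_def)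
  ultimately show ?thesis by blast
qed

lemma foldr_szlenk_deriv_closed_Int:
  assumes "normed_space X" "K \<subseteq> ns_carrier (dual_space X)"
  shows "\<exists>T. closed T \<and> foldr (szlenk_deriv X) \<epsilon>s K = K \<inter> T"
proof (induction \<epsilon>s)
  case Nil
  show ?case by (intro exI[of _ UNIV]) simp
next
  case (Cons \<epsilon> \<epsilon>s)
  then obtain T where T: "closed T" "foldr (szlenk_deriv X) \<epsilon>s K = K \<inter> T" by blast
  have "K \<inter> T \<subseteq> ns_carrier (dual_space X)" using assms(2) by blast
  from szlenk_deriv_closed_Int[OF assms(1) this]
  obtain T' where T': "closed T'" "szlenk_deriv X \<epsilon> (K \<inter> T) = K \<inter> T \<inter> T'" by blast
  with T show ?case by (intro exI[of _ "T \<inter> T'"]) auto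
qed

text \<open>The preimage of a neighbourhood of \<open>J f\<close> is a neighbourhood of
  \<open>f\<close> and contains a pair more than \<epsilon> apart; the lower estimate keeps its
  image more than c \<epsilon> apart. Since c > 0, nonpositive entries stay nonpositive and act
  trivially on both sides.\<close>

lemma szlenk_deriv_transfer:
  assumes X: "normed_space X" and Z: "normed_space Z"
    and K: "K \<subseteq> ns_carrier (dual_space X)" and K': "K' \<subseteq> ns_carrier (dual_space Z)"
    and cont: "continuous_on K J" and sub: "J ` K \<subseteq> K'" and c: "c > 0"
    and lower: "\<And>f g. f \<in> K \<Longrightarrow> g \<in> K \<Longrightarrow>
      c * ns_norm (dual_space X) (f - g) \<le> ns_norm (dual_space Z) (J f - J g)"
  shows "J ` foldr (szlenk_deriv X) \<epsilon>s K \<subseteq> foldr (szlenk_deriv Z) (map ((*) c) \<epsilon>s) K'"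
proof (induction \<epsilon>s)
  case Nil
  show ?case using sub by simp
next
  case (Cons \<epsilon> \<epsilon>s)
  define L where "L = foldr (szlenk_deriv X) \<epsilon>s K"
  define L' where "L' = foldr (szlenk_deriv Z) (map ((*) c) \<epsilon>s) K'"
  have LK: "L \<subseteq> K" and LK': "L' \<subseteq> K'"
    by (auto simp: L_def L'_def dest: subsetD[OF foldr_szlenk_deriv_subset])
  have LX: "L \<subseteq> ns_carrier (dual_space X)" and LX': "L' \<subseteq> ns_carrier (dual_space Z)"
    using LK LK' K K' by auto
  have JL: "J ` L \<subseteq> L'" using Cons by (simp add: L_def L'_def)
  have "J f \<in> szlenk_deriv Z (c * \<epsilon>) L'" if f: "f \<in> szlenk_deriv X \<epsilon> L" for f
  proof (cases "\<epsilon> \<le> 0")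
    case True
    then have "c * \<epsilon> \<le> 0" using c by (simp add: mult_nonneg_nonpos)
    then show ?thesis using f JL True by (auto simp: szlenk_deriv_nonpos)
  next
    case False
    then have \<epsilon>: "\<epsilon> > 0" and c\<epsilon>: "c * \<epsilon> > 0" using c by auto
    have fL: "f \<in> L" using f szlenk_deriv_subset by blast
    show ?thesis
      unfolding szlenk_deriv_iff[OF Z LX' c\<epsilon>]
    proof (intro conjI allI impI)
      show "J f \<in> L'" using fL JL by blast
      fix U assume U: "open U \<and> J f \<in> U"
      have "continuous_on L J" using cont LK by (rule continuous_on_subset)
      then obtain V where V: "open V" "V \<inter> L = J -` U \<inter> L"
        using U continuous_on_open_invariant by metis
      then have "f \<in> V" using U fL by auto
      then obtain g h where g: "g \<in> V \<inter> L" and h: "h \<in> V \<inter> L"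
        and gh: "\<epsilon> < ns_norm (dual_space X) (g - h)"
        using f V(1) unfolding szlenk_deriv_iff[OF X LX \<epsilon>] by blast
      have "c * \<epsilon> < c * ns_norm (dual_space X) (g - h)" using gh c by simp
      also have "\<dots> \<le> ns_norm (dual_space Z) (J g - J h)" using lower g h LK by blast
      finally show "\<exists>g\<in>U \<inter> L'. \<exists>h\<in>U \<inter> L'. c * \<epsilon> < ns_norm (dual_space Z) (g - h)"
        using g h V(2) JL by blast
    qed
  qed
  then show ?case by (auto simp: L_def L'_def)
qed

lemma has_summable_szlenk_index_transfer:
  assumes X: "normed_space X" and Z: "normed_space Z"
    and K: "K \<subseteq> ns_carrier (dual_space X)" and K': "K' \<subseteq> ns_carrier (dual_space Z)"
    and cont: "continuous_on K J" and sub: "J ` K \<subseteq> K'" and c: "c > 0"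
    and lower: "\<And>f g. f \<in> K \<Longrightarrow> g \<in> K \<Longrightarrow>
      c * ns_norm (dual_space X) (f - g) \<le> ns_norm (dual_space Z) (J f - J g)"
    and summable: "has_summable_szlenk_index Z K'"
  shows "has_summable_szlenk_index X K"
proof -
  obtain M where M: "M \<ge> 0" and sum: "\<And>\<epsilon>s. foldr (szlenk_deriv Z) \<epsilon>s K' \<noteq> {} \<Longrightarrow> sum_list \<epsilon>s \<le> M"
    using summable by (auto simp: has_summable_szlenk_index_def has_M_summable_szlenk_index_def)
  have "sum_list \<epsilon>s \<le> M / c" if "foldr (szlenk_deriv X) \<epsilon>s K \<noteq> {}" for \<epsilon>s
  proof -
    have "foldr (szlenk_deriv Z) (map ((*) c) \<epsilon>s) K' \<noteq> {}"
      using szlenk_deriv_transfer[OF X Z K K' cont sub c lower, of \<epsilon>s] that by blast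
    from sum[OF this] show ?thesis
      using c by (simp add: sum_list_const_mult[of c "\<lambda>x. x", simplified] field_simps)
  qed
  then show ?thesis
    using M c by (auto simp: has_summable_szlenk_index_def has_M_summable_szlenk_index_def
        intro!: exI[of _ "M / c"])
qed

section \<open>Weakly null trees\<close>

text \<open>The traces on the unit ball of the weak neighbourhoods of 0. A property is frequent when
  every such trace contains a vector with it.\<close>

definition weak_ball_filter :: "('k::real_or_complex, 'a::ab_group_add) nspace \<Rightarrow> 'a filter" where
  "weak_ball_filter X =
     inf (INF \<phi>\<in>ns_carrier (dual_space X). filtercomap \<phi> (nhds 0)) (principal (ns_cball X))"

lemma eventually_weak_ball_filter_cball: "\<forall>\<^sub>F x in weak_ball_filter X. x \<in> ns_cball X"
  unfolding weak_ball_filter_def eventually_inf_principal by simp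

lemma eventually_weak_ball_filter_small:
  fixes X :: "('k::real_or_complex, 'a::ab_group_add) nspace"
  assumes "\<phi> \<in> ns_carrier (dual_space X)" "\<theta> > 0"
  shows "\<forall>\<^sub>F x in weak_ball_filter X. norm (\<phi> x) < \<theta>"
proof -
  have "\<forall>\<^sub>F y in nhds 0. norm (y :: 'k) < \<theta>"
    using assms(2) by (auto simp: eventually_nhds_metric intro!: exI[of _ \<theta>])
  then have "\<forall>\<^sub>F x in filtercomap \<phi> (nhds 0). norm (\<phi> x) < \<theta>"
    by (rule eventually_filtercomapI)
  then have "\<forall>\<^sub>F x in INF \<phi>\<in>ns_carrier (dual_space X). filtercomap \<phi> (nhds 0). norm (\<phi> x) < \<theta>"
    by (rule eventually_INF1[OF assms(1)])
  then show ?thesis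
    unfolding weak_ball_filter_def eventually_inf_principal by (rule eventually_mono) simp
qed

text \<open>A basic weak neighbourhood constrains finitely many functionals, and their tolerances
  can be replaced by the smallest one.\<close>

lemma frequently_weak_ball_filterI:
  assumes "\<And>F \<theta>. finite F \<Longrightarrow> F \<subseteq> ns_carrier (dual_space X) \<Longrightarrow> \<theta> > 0 \<Longrightarrow>
    \<exists>x\<in>ns_cball X. (\<forall>\<phi>\<in>F. norm (\<phi> x) < \<theta>) \<and> P x"
  shows "\<exists>\<^sub>F x in weak_ball_filter X. P x"
  unfolding frequently_def
proof
  assume "\<forall>\<^sub>F x in weak_ball_filter X. \<not> P x"
  then have "\<forall>\<^sub>F x in INF \<phi>\<in>ns_carrier (dual_space X). filtercomap \<phi> (nhds 0). x \<in> ns_cball X \<longrightarrow> \<not> P x"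
    by (simp add: weak_ball_filter_def eventually_inf_principal)
  from iffD1[OF eventually_INF this] obtain F where F: "F \<subseteq> ns_carrier (dual_space X)" "finite F"
    "\<forall>\<^sub>F x in INF \<phi>\<in>F. filtercomap \<phi> (nhds 0). x \<in> ns_cball X \<longrightarrow> \<not> P x"
    by blast
  from iffD1[OF eventually_INF_finite[OF F(2)] F(3)]
  obtain Q where Q: "\<And>\<phi>. \<phi> \<in> F \<Longrightarrow> eventually (Q \<phi>) (filtercomap \<phi> (nhds 0))"
    and QP: "\<And>x. (\<And>\<phi>. \<phi> \<in> F \<Longrightarrow> Q \<phi> x) \<Longrightarrow> x \<in> ns_cball X \<longrightarrow> \<not> P x"
    by blast
  have "\<exists>\<theta>>0. \<forall>x. norm (\<phi> x) < \<theta> \<longrightarrow> Q \<phi> x" if "\<phi> \<in> F" for \<phi>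
    using Q[OF that] by (fastforce simp: eventually_filtercomap eventually_nhds_metric)
  then obtain \<theta> where \<theta>: "\<And>\<phi>. \<phi> \<in> F \<Longrightarrow> \<theta> \<phi> > 0" "\<And>\<phi> x. \<phi> \<in> F \<Longrightarrow> norm (\<phi> x) < \<theta> \<phi> \<Longrightarrow> Q \<phi> x"
    by metis
  \<comment> \<open>The inserted 1 provides a minimum when \<open>F\<close> is empty.\<close>
  let ?t = "Min (insert 1 (\<theta> ` F))"
  have "?t > 0" using F(2) \<theta>(1) by (subst Min_gr_iff) auto
  from assms[OF F(2,1) this] obtain x where x: "x \<in> ns_cball X" "\<forall>\<phi>\<in>F. norm (\<phi> x) < ?t" "P x"
    by blast
  have "Q \<phi> x" if "\<phi> \<in> F" for \<phi>
  proof (rule \<theta>(2)[OF that])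
    have "?t \<le> \<theta> \<phi>" using F(2) that by (intro Min_le) auto
    then show "norm (\<phi> x) < \<theta> \<phi>" using x(2) that by force
  qed
  with QP x show False by blast
qed

text \<open>\<open>frequently_branch W n P\<close> says that there is a tree of height \<open>n\<close> all of whose branches satisfy
  \<open>P\<close>, in which the successors of every node are frequent along \<open>W\<close>.\<close>

primrec frequently_branch :: "'a filter \<Rightarrow> nat \<Rightarrow> ('a list \<Rightarrow> bool) \<Rightarrow> bool" where
  "frequently_branch W 0 P = P []"
| "frequently_branch W (Suc n) P = (\<exists>\<^sub>F x in W. frequently_branch W n (\<lambda>xs. P (x # xs)))"

lemma frequently_branch_mono:
  assumes "\<forall>\<^sub>F x in W. x \<in> B"
    and "\<And>xs. length xs = n \<Longrightarrow> set xs \<subseteq> B \<Longrightarrow> P xs \<Longrightarrow> Q xs"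
    and "frequently_branch W n P"
  shows "frequently_branch W n Q"
  using assms(2,3)
proof (induction n arbitrary: P Q)
  case (Suc n)
  have "\<exists>\<^sub>F x in W. frequently_branch W n (\<lambda>xs. P (x # xs)) \<and> x \<in> B"
    using frequently_eventually_conj[OF Suc.prems(2)[simplified] assms(1)] by (simp add: conj_commute)
  then have "\<exists>\<^sub>F x in W. frequently_branch W n (\<lambda>xs. Q (x # xs))"
  proof (rule frequently_elim1)
    fix x assume x: "frequently_branch W n (\<lambda>xs. P (x # xs)) \<and> x \<in> B"
    show "frequently_branch W n (\<lambda>xs. Q (x # xs))"
      by (rule Suc.IH[where P = "\<lambda>xs. P (x # xs)"]) (use x Suc.prems(1) in auto)
  qed
  then show ?case by simp
qed simp

text \<open>Colours are settled from the leaves upwards: below each frequent child the induction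
  hypothesis selects a subtree of one colour, and one of the finitely many colours is selected for
  frequently many children.\<close>

lemma frequently_branch_pigeonhole:
  assumes "finite C" "frequently_branch W n (\<lambda>xs. \<exists>c\<in>C. P c xs)"
  shows "\<exists>c\<in>C. frequently_branch W n (P c)"
  using assms(2)
proof (induction n arbitrary: P)
  case (Suc n)
  have "\<exists>\<^sub>F x in W. \<exists>c\<in>C. frequently_branch W n (\<lambda>xs. P c (x # xs))"
    using Suc.prems by (auto elim!: frequently_elim1 intro!: Suc.IH)
  then show ?case using frequently_bex_finite[OF assms(1)] by simp
qed simp

text \<open>Otherwise every point of \<open>C\<close> has a neighbourhood in which, eventually, no
  point is related to \<open>x\<close>; finitely many of these cover \<open>C\<close> and contradict
  \<open>freq\<close>. The point related to \<open>x\<close> may vary with \<open>x\<close>.\<close>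

lemma frequently_cluster_point:
  assumes C: "compact C" and freq: "\<exists>\<^sub>F x in W. \<exists>p\<in>C. R x p"
  shows "\<exists>p\<in>C. \<forall>U. open U \<longrightarrow> p \<in> U \<longrightarrow> (\<exists>\<^sub>F x in W. \<exists>q\<in>C \<inter> U. R x q)"
proof (rule ccontr)
  assume "\<not> ?thesis"
  then have "\<forall>p\<in>C. \<exists>U. open U \<and> p \<in> U \<and> (\<forall>\<^sub>F x in W. \<forall>q\<in>C \<inter> U. \<not> R x q)"
    by (simp add: not_frequently)
  from bchoice[OF this] obtain U where U: "\<And>p. p \<in> C \<Longrightarrow> open (U p)" "\<And>p. p \<in> C \<Longrightarrow> p \<in> U p"
    "\<And>p. p \<in> C \<Longrightarrow> \<forall>\<^sub>F x in W. \<forall>q\<in>C \<inter> U p. \<not> R x q"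
    by blast
  obtain D where D: "D \<subseteq> C" "finite D" "C \<subseteq> (\<Union>p\<in>D. U p)"
    using compactE_image[OF C, of C U] U by blast
  have "\<forall>\<^sub>F x in W. \<forall>p\<in>D. \<forall>q\<in>C \<inter> U p. \<not> R x q"
    using D U(3) by (intro eventually_ball_finite) auto
  then have "\<forall>\<^sub>F x in W. \<not> (\<exists>p\<in>C. R x p)"
    by (rule eventually_mono) (use D(3) in blast)
  with freq show False by (simp add: frequently_def)
qed

text \<open>Finitely many functionals map the ball to a totally bounded set. Each vector is coloured
  by the tuple \<open>col\<close> of net points near its values, and \<open>Z\<close> has one vector
  of the ball for each colour that occurs.\<close>

lemma finite_weak_net:
  fixes X :: "('k::real_or_complex, 'a::ab_group_add) nspace"
  assumes X: "normed_space X" and F: "finite F" "F \<subseteq> ns_carrier (dual_space X)" and \<theta>: "\<theta> > 0"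
  shows "\<exists>Z. finite Z \<and> Z \<subseteq> ns_cball X \<and> (\<forall>z\<in>ns_cball X. \<exists>z'\<in>Z. \<forall>\<phi>\<in>F. norm (\<phi> z - \<phi> z') < \<theta>)"
proof -
  have "\<forall>\<phi>. \<exists>N. finite N \<and> cball (0::'k) (ns_norm (dual_space X) \<phi>) \<subseteq> (\<Union>y\<in>N. ball y (\<theta> / 2))"
  proof
    fix \<phi>
    have "compact (cball (0::'k) (ns_norm (dual_space X) \<phi>))" by (rule compact_cball_scalar)
    then show "\<exists>N. finite N \<and> cball (0::'k) (ns_norm (dual_space X) \<phi>) \<subseteq> (\<Union>y\<in>N. ball y (\<theta> / 2))"
      unfolding compact_eq_totally_bounded using \<theta> by (auto dest!: spec[of _ "\<theta> / 2"])
  qed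
  from choice[OF this] obtain N where N: "\<And>\<phi>. finite (N \<phi>)"
    "\<And>\<phi>. cball (0::'k) (ns_norm (dual_space X) \<phi>) \<subseteq> (\<Union>y\<in>N \<phi>. ball y (\<theta> / 2))"
    by blast
  define k where "k \<phi> z = (SOME y. y \<in> N \<phi> \<and> dist y (\<phi> z) < \<theta> / 2)" for \<phi> z
  have k: "k \<phi> z \<in> N \<phi> \<and> dist (k \<phi> z) (\<phi> z) < \<theta> / 2"
    if \<phi>F: "\<phi> \<in> F" and zB: "z \<in> ns_cball X" for \<phi> z
  proof -
    have z: "z \<in> ns_carrier X" "ns_norm X z \<le> 1" and \<phi>: "\<phi> \<in> ns_carrier (dual_space X)"
      using F \<phi>F zB by (auto simp: ns_cball_def)
    have "norm (\<phi> z) \<le> ns_norm (dual_space X) \<phi>"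
      using dual_norm_bound[OF X \<phi> z(1)]
        mult_left_mono[OF z(2) normed_space.norm_nonneg[OF normed_space_dual[OF X] \<phi>]] by simp
    then have "\<phi> z \<in> (\<Union>y\<in>N \<phi>. ball y (\<theta> / 2))" using subsetD[OF N(2)[of \<phi>]] by simp
    then have "\<exists>y. y \<in> N \<phi> \<and> dist y (\<phi> z) < \<theta> / 2" by auto
    then show ?thesis unfolding k_def by (rule someI_ex)
  qed
  define col where "col z = (\<lambda>\<phi>\<in>F. k \<phi> z)" for z
  have "col ` ns_cball X \<subseteq> PiE F N"
    using k by (auto simp: col_def)
  then have "finite (col ` ns_cball X)"
    using finite_PiE[of F N] F(1) N(1) finite_subset by blast
  then obtain Z where Z: "Z \<subseteq> ns_cball X" "finite Z" "col ` ns_cball X = col ` Z"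
    by (metis finite_subset_image subset_refl)
  have "\<exists>z'\<in>Z. \<forall>\<phi>\<in>F. norm (\<phi> z - \<phi> z') < \<theta>" if z: "z \<in> ns_cball X" for z
  proof -
    obtain z' where z': "z' \<in> Z" "col z = col z'" using Z(3) z by blast
    have "norm (\<phi> z - \<phi> z') < \<theta>" if \<phi>: "\<phi> \<in> F" for \<phi>
    proof -
      have "k \<phi> z = k \<phi> z'" using fun_cong[OF z'(2), of \<phi>] \<phi> by (simp add: col_def)
      then show ?thesis
        using k[OF \<phi> z] k[OF \<phi> subsetD[OF Z(1) z'(1)]] dist_triangle_half_r[of "k \<phi> z" "\<phi> z" \<theta> "\<phi> z'"]
        by (simp add: dist_norm)
    qed
    with z'(1) show ?thesis by blast
  qed
  with Z show ?thesis by blast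
qed

lemma open_pointwise_ball:
  fixes f :: "'a \<Rightarrow> 'k::real_normed_vector"
  assumes "finite Z" shows "open {g. \<forall>z\<in>Z. norm (g z - f z) < \<eta>}"
proof -
  have "open {g. norm (g z - f z) < \<eta>}" for z
    by (intro open_Collect_less continuous_intros continuous_on_product_coordinates)
  then have "open (\<Inter>z\<in>Z. {g. norm (g z - f z) < \<eta>})" using assms by blast
  moreover have "(\<Inter>z\<in>Z. {g. norm (g z - f z) < \<eta>}) = {g. \<forall>z\<in>Z. norm (g z - f z) < \<eta>}" by blast
  ultimately show ?thesis by simp
qed

text \<open>A functional of norm greater than \<open>\<epsilon> / 2\<close> that is small on a finite weak net \<open>Z0\<close> of the ball
  is at least about \<open>\<epsilon> / 4\<close> on some weakly small vector, half a difference \<open>z - z'\<close>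
  with \<open>z' \<in> Z0\<close>.\<close>

lemma szlenk_deriv_weakly_null:
  fixes X :: "('k::real_or_complex, 'a::ab_group_add) nspace"
  assumes X: "normed_space X" and L: "L \<subseteq> ns_carrier (dual_space X)"
    and f: "f \<in> szlenk_deriv X \<epsilon> L" and Z: "finite Z" and \<eta>: "\<eta> > 0"
  shows "\<exists>\<^sub>F x in weak_ball_filter X. \<exists>g\<in>L. (\<forall>z\<in>Z. norm (g z - f z) < \<eta>) \<and> \<epsilon> / 4 - \<eta> \<le> re (g x)"
proof (rule frequently_weak_ball_filterI)
  fix F \<theta> assume F: "finite F" "F \<subseteq> ns_carrier (dual_space X)" and \<theta>: "(\<theta>::real) > 0"
  interpret normed_space X by fact
  interpret V: vector_space "ns_scale X" by (rule vector_space_scale)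
  interpret D: normed_space "dual_space X" by (rule normed_space_dual[OF X])
  have fL: "f \<in> L" using f szlenk_deriv_subset by blast
  then have fD: "f \<in> ns_carrier (dual_space X)" using L by blast
  have zero: "\<phi> 0 = 0" if "\<phi> \<in> ns_carrier (dual_space X)" for \<phi>
    using dual_spaceD(2)[OF that carrier_zero, of 0] by simp
  show "\<exists>x\<in>ns_cball X. (\<forall>\<phi>\<in>F. norm (\<phi> x) < \<theta>) \<and>
    (\<exists>g\<in>L. (\<forall>z\<in>Z. norm (g z - f z) < \<eta>) \<and> \<epsilon> / 4 - \<eta> \<le> re (g x))"
  proof (cases "\<epsilon> \<le> 0")
    case True
    have "norm (\<phi> 0) < \<theta>" if "\<phi> \<in> F" for \<phi>
      using zero[of \<phi>] that F(2) \<theta> by auto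
    moreover have "\<epsilon> / 4 - \<eta> \<le> re (f 0)"
      using zero[OF fD] True \<eta> by simp
    ultimately show ?thesis
      using fL \<eta> zero_in_cball[OF X] by (intro bexI[of _ 0] conjI ballI bexI[of _ f]) auto
  next
    case False
    then have \<epsilon>: "\<epsilon> > 0" by simp
    define \<theta>' where "\<theta>' = min \<theta> \<eta>"
    have \<theta>': "\<theta>' > 0" using \<theta> \<eta> by (simp add: \<theta>'_def)
    \<comment> \<open>The net also serves \<open>f\<close>, so that \<open>f\<close> will be small
      at the vector found and \<open>g\<close> can be compared there with
      \<open>g - f\<close>.\<close>
    obtain Z0 where Z0: "finite Z0" "Z0 \<subseteq> ns_cball X"
      "\<And>z. z \<in> ns_cball X \<Longrightarrow> \<exists>z'\<in>Z0. \<forall>\<phi>\<in>insert f F. norm (\<phi> z - \<phi> z') < \<theta>'"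
      using finite_weak_net[OF X _ _ \<theta>', of "insert f F"] F fD by auto
    \<comment> \<open>Closeness to \<open>f\<close> on \<open>Z0\<close> makes \<open>g - f\<close>
      small at the representative \<open>z'\<close>, although it is large at
      \<open>z\<close>.\<close>
    define U where "U = {g. \<forall>z\<in>Z \<union> Z0. norm (g z - f z) < \<eta>}"
    have "open U" "f \<in> U" using Z Z0(1) \<eta> by (auto simp: U_def intro!: open_pointwise_ball)
    then obtain g h where g: "g \<in> U \<inter> L" and h: "h \<in> U \<inter> L"
      and gh: "\<epsilon> < ns_norm (dual_space X) (g - h)"
      using f szlenk_deriv_iff[OF X L \<epsilon>] by blast
    have "g - f \<in> ns_carrier (dual_space X)" "h - f \<in> ns_carrier (dual_space X)"
      "f - h \<in> ns_carrier (dual_space X)"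
      using g h L fD by (auto intro: D.carrier_diff)
    \<comment> \<open>Of two points more than \<epsilon> apart, one is more than \<epsilon> / 2 away
      from \<open>f\<close>: the first loss of a factor 2.\<close>
    then have "ns_norm (dual_space X) (g - h) \<le> ns_norm (dual_space X) (g - f) + ns_norm (dual_space X) (h - f)"
      using D.norm_triangle[of "g - f" "f - h"] D.norm_minus[of "h - f"] by simp
    then have "\<epsilon> / 2 < ns_norm (dual_space X) (g - f) \<or> \<epsilon> / 2 < ns_norm (dual_space X) (h - f)"
      using gh by linarith
    then obtain g where gU: "g \<in> U" and gL: "g \<in> L" and gf: "\<epsilon> / 2 < ns_norm (dual_space X) (g - f)"
      using g h by blast
    have gD: "g \<in> ns_carrier (dual_space X)" using gL L by blast
    then have dD: "g - f \<in> ns_carrier (dual_space X)" using fD D.carrier_diff by blast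
    obtain y where y: "y \<in> ns_cball X" "\<epsilon> / 2 < norm ((g - f) y)"
      using dual_norm_exceeded[OF X dD gf] by blast
    obtain c :: 'k where c: "norm c = 1" "c * (g - f) y = of_real (norm ((g - f) y))"
      using unimodular_rotation by blast
    define z where "z = ns_scale X c y"
    have yc: "y \<in> ns_carrier X" using y(1) by (auto simp: ns_cball_def)
    have z: "z \<in> ns_cball X"
      using y(1) c(1) by (simp add: z_def ns_cball_def carrier_scale norm_scale)
    have zbig: "\<epsilon> / 2 < re ((g - f) z)"
      using y(2) c(2) dual_spaceD(2)[OF dD yc, of c] by (simp add: z_def)
    obtain z' where z': "z' \<in> Z0" "\<And>\<phi>. \<phi> \<in> insert f F \<Longrightarrow> norm (\<phi> z - \<phi> z') < \<theta>'"
      using Z0(3)[OF z] by blast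
    have zc: "z \<in> ns_carrier X" "ns_norm X z \<le> 1" "z' \<in> ns_carrier X" "ns_norm X z' \<le> 1"
      using z z'(1) Z0(2) by (auto simp: ns_cball_def)
    \<comment> \<open>Subtracting \<open>z'\<close> makes the vector weakly small, halving returns
      it to the ball: the second loss of a factor 2.\<close>
    define x where "x = ns_scale X (of_real (1/2)) (z - z')"
    have "ns_norm X (z - z') \<le> 2"
      using norm_triangle[of z "- z'"] norm_minus[of z'] carrier_minus[of z'] zc by simp
    then have x: "x \<in> ns_cball X"
      using zc by (simp add: x_def ns_cball_def carrier_scale carrier_diff norm_scale norm_divide)
    have val: "\<phi> x = of_real (1/2) * (\<phi> z - \<phi> z')" if "\<phi> \<in> ns_carrier (dual_space X)" for \<phi>
      using dual_spaceD(2)[OF that carrier_diff[OF zc(1,3)], of "of_real (1/2)"]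
        dual_space_diff[OF X that zc(1,3)] by (simp add: x_def)
    have half: "norm (\<phi> x) < \<theta>' / 2" if "\<phi> \<in> insert f F" for \<phi>
    proof -
      have "\<phi> \<in> ns_carrier (dual_space X)" using that F fD by auto
      from val[OF this] have "norm (\<phi> x) = 1/2 * norm (\<phi> z - \<phi> z')"
        by (simp only: norm_mult norm_of_real abs_of_pos zero_less_divide_1_iff zero_less_numeral)
      with z'(2)[OF that] show ?thesis by simp
    qed
    have small: "norm (\<phi> x) < \<theta>" if "\<phi> \<in> F" for \<phi>
      using half[of \<phi>] that \<theta>' by (simp add: \<theta>'_def)
    have arith: "\<epsilon> / 4 - \<eta> \<le> r"
      if "r = (a - b) / 2 + d" "b < \<eta>" "- d \<le> \<eta> / 2" "\<epsilon> / 2 < a" for a b d r :: real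
      using that by (simp add: field_simps)
    have "re (g x) = re ((g - f) x) + re (f x)" by (simp add: re_diff)
    also have "re ((g - f) x) = (re ((g - f) z) - re ((g - f) z')) / 2"
      by (simp only: val[OF dD] re_of_real_mult re_diff)
    finally have "re (g x) = (re ((g - f) z) - re ((g - f) z')) / 2 + re (f x)" .
    moreover have "re ((g - f) z') < \<eta>"
      using re_le[of "(g - f) z'"] gU z'(1) by (force simp: U_def)
    moreover have "- re (f x) \<le> \<eta> / 2"
    proof -
      have "norm (f x) < \<theta>' / 2" "\<theta>' \<le> \<eta>" using half[of f] by (simp_all add: \<theta>'_def)
      then show ?thesis using abs_re_le[of "f x"] by linarith
    qed
    ultimately have "\<epsilon> / 4 - \<eta> \<le> re (g x)"
      using zbig by (rule arith)
    moreover have "\<forall>z\<in>Z. norm (g z - f z) < \<eta>" using gU by (simp add: U_def)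
    ultimately show ?thesis using x small gL by blast
  qed
qed

text \<open>The head of the list is the derivation applied last and therefore belongs to the root.
  The functional changes from level to level; inserting the vector just chosen into \<open>Z\<close>
  for the levels below, and halving \<eta>, preserves the lower bounds already obtained.\<close>

lemma szlenk_deriv_tree:
  fixes X :: "('k::real_or_complex, 'a::ab_group_add) nspace"
  assumes X: "normed_space X" and K: "K \<subseteq> ns_carrier (dual_space X)"
    and "f \<in> foldr (szlenk_deriv X) \<epsilon>s K" "finite Z" "\<eta> > 0"
  shows "frequently_branch (weak_ball_filter X) (length \<epsilon>s)
    (\<lambda>xs. \<exists>g\<in>K. (\<forall>z\<in>Z. norm (g z - f z) < \<eta>) \<and> (\<forall>i<length \<epsilon>s. \<epsilon>s ! i / 4 - \<eta> \<le> re (g (xs ! i))))"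
  using assms(3-)
proof (induction \<epsilon>s arbitrary: f Z \<eta>)
  case Nil
  then show ?case by (auto intro!: bexI[of _ f])
next
  case (Cons \<epsilon> \<epsilon>s)
  let ?L = "foldr (szlenk_deriv X) \<epsilon>s K"
  have L: "?L \<subseteq> ns_carrier (dual_space X)" using foldr_szlenk_deriv_subset K by blast
  have f: "f \<in> szlenk_deriv X \<epsilon> ?L" using Cons.prems(1) by simp
  have \<eta>: "\<eta> / 2 > 0" using Cons.prems(3) by simp
  have "\<exists>\<^sub>F x in weak_ball_filter X. frequently_branch (weak_ball_filter X) (length \<epsilon>s)
    (\<lambda>xs. \<exists>g\<in>K. (\<forall>z\<in>Z. norm (g z - f z) < \<eta>) \<and>
      (\<forall>i<length (\<epsilon> # \<epsilon>s). (\<epsilon> # \<epsilon>s) ! i / 4 - \<eta> \<le> re (g ((x # xs) ! i))))"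
    using szlenk_deriv_weakly_null[OF X L f Cons.prems(2) \<eta>]
  proof (rule frequently_elim1)
    fix x assume "\<exists>g\<in>?L. (\<forall>z\<in>Z. norm (g z - f z) < \<eta> / 2) \<and> \<epsilon> / 4 - \<eta> / 2 \<le> re (g x)"
    then obtain g where g: "g \<in> ?L" "\<And>z. z \<in> Z \<Longrightarrow> norm (g z - f z) < \<eta> / 2" "\<epsilon> / 4 - \<eta> / 2 \<le> re (g x)"
      by blast
    show "frequently_branch (weak_ball_filter X) (length \<epsilon>s)
      (\<lambda>xs. \<exists>g\<in>K. (\<forall>z\<in>Z. norm (g z - f z) < \<eta>) \<and>
        (\<forall>i<length (\<epsilon> # \<epsilon>s). (\<epsilon> # \<epsilon>s) ! i / 4 - \<eta> \<le> re (g ((x # xs) ! i))))"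
    proof (rule frequently_branch_mono[OF eventually_weak_ball_filter_cball _
          Cons.IH[OF g(1) _ \<eta>, of "insert x Z"]])
      fix xs assume "\<exists>h\<in>K. (\<forall>z\<in>insert x Z. norm (h z - g z) < \<eta> / 2) \<and>
        (\<forall>i<length \<epsilon>s. \<epsilon>s ! i / 4 - \<eta> / 2 \<le> re (h (xs ! i)))"
      then obtain h where h: "h \<in> K" "\<And>z. z \<in> insert x Z \<Longrightarrow> norm (h z - g z) < \<eta> / 2"
        "\<And>i. i < length \<epsilon>s \<Longrightarrow> \<epsilon>s ! i / 4 - \<eta> / 2 \<le> re (h (xs ! i))" by blast
      have "norm (h z - f z) < \<eta>" if "z \<in> Z" for z
        using h(2)[of z] g(2)[OF that] that norm_triangle_ineq[of "h z - g z" "g z - f z"] by simp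
      moreover have "\<epsilon> / 4 - \<eta> \<le> re (h x)"
        using h(2)[of x] g(3) abs_re_le[of "h x - g x"] by (simp add: re_diff)
      moreover have "\<epsilon>s ! i / 4 - \<eta> \<le> re (h (xs ! i))" if "i < length \<epsilon>s" for i
        using h(3)[OF that] Cons.prems(3) by linarith
      ultimately show "\<exists>g\<in>K. (\<forall>z\<in>Z. norm (g z - f z) < \<eta>) \<and>
        (\<forall>i<length (\<epsilon> # \<epsilon>s). (\<epsilon> # \<epsilon>s) ! i / 4 - \<eta> \<le> re (g ((x # xs) ! i)))"
        using h(1) by (intro bexI[of _ h] conjI allI impI) (auto simp: nth_Cons split: nat.split)
    qed (use Cons.prems in auto)
  qed
  then show ?case by simp
qed

section \<open>Derivations of products\<close>

text \<open>Each number is charged entirely to one factor. The other receives 0, for which the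
  derivation is the identity, and both lists keep the full length. Entries may be negative, hence
  the positive part.\<close>

primrec splittings :: "real \<Rightarrow> real list \<Rightarrow> (real list \<times> real list) set" where
  "splittings c [] = {([], [])}"
| "splittings c (d # ds) = (\<lambda>(a, b). (c * max d 0 # a, 0 # b)) ` splittings c ds \<union>
     (\<lambda>(a, b). (0 # a, c * max d 0 # b)) ` splittings c ds"

lemma finite_splittings: "finite (splittings c ds)"
  by (induction ds) auto

lemma sum_list_splittings:
  assumes "c \<ge> 0" "(a, b) \<in> splittings c ds"
  shows "c * sum_list ds \<le> sum_list a + sum_list b"
  using assms(2)
proof (induction ds arbitrary: a b)
  case (Cons d ds)
  have "c * d \<le> c * max d 0" using assms(1) by (intro mult_left_mono) auto
  with Cons show ?case by (fastforce simp: distrib_left)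
qed simp

context
  fixes X0 :: "('k::real_or_complex, 'a::ab_group_add) nspace"
    and X1 :: "('k, 'b::ab_group_add) nspace"
    and K0 :: "('a \<Rightarrow> 'k) set" and K1 :: "('b \<Rightarrow> 'k) set" and R :: real
  assumes X0: "normed_space X0" and X1: "normed_space X1"
    and K0: "K0 \<subseteq> ns_carrier (dual_space X0)"
    and K1: "K1 \<subseteq> ns_carrier (dual_space X1)"
    and R: "R > 0" "\<And>f. f \<in> K0 \<Longrightarrow> ns_norm (dual_space X0) f \<le> R"
      "\<And>g. g \<in> K1 \<Longrightarrow> ns_norm (dual_space X1) g \<le> R"
begin

text \<open>One factor is changed at a time, the other being bounded by \<open>R\<close> and the
  norm of \<open>u\<close> by 1.\<close>

lemma tensor_pairing_difference:
  assumes u: "u \<in> ns_cball (injective_tensor X0 X1)"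
    and f: "f \<in> K0" "f' \<in> K0" and g: "g \<in> K1" "g' \<in> K1"
  shows "norm (f' (u g') - f (u g)) \<le>
    R * ns_norm (dual_space X0) (f' - f) + R * ns_norm (dual_space X1) (g' - g)"
proof -
  interpret D0: normed_space "dual_space X0" by (rule normed_space_dual[OF X0])
  interpret D1: normed_space "dual_space X1" by (rule normed_space_dual[OF X1])
  have uL: "u \<in> ns_carrier (tensor_ops X0 X1)" and u1: "ns_norm (tensor_ops X0 X1) u \<le> 1"
    using u injective_tensor_iff[OF X0 X1] by (auto simp: ns_cball_def ns_norm_injective_tensor)
  have D: "f \<in> ns_carrier (dual_space X0)" "f' \<in> ns_carrier (dual_space X0)"
    "g \<in> ns_carrier (dual_space X1)" "g' \<in> ns_carrier (dual_space X1)" using f g K0 K1 by auto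
  have df: "f' - f \<in> ns_carrier (dual_space X0)" and dg: "g' - g \<in> ns_carrier (dual_space X1)"
    using D D0.carrier_diff D1.carrier_diff by auto
  have "u ((g' - g) + g) = u (g' - g) + u g"
    using operator_spaceD(2)[OF uL dg D(3)] .
  then have ug: "u (g' - g) = u g' - u g" by simp
  have "f (u g') - f (u g) = f (u (g' - g))"
    using dual_space_diff[OF X0 D(1) operator_spaceD(1)[OF uL D(4)] operator_spaceD(1)[OF uL D(3)]]
    by (simp add: ug)
  then have split: "f' (u g') - f (u g) = (f' - f) (u g') + f (u (g' - g))"
    by (simp add: algebra_simps)
  have bound: "norm (p (u q)) \<le> ns_norm (dual_space X0) p * ns_norm (dual_space X1) q"
    if "p \<in> ns_carrier (dual_space X0)" "q \<in> ns_carrier (dual_space X1)" for p q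
  proof -
    have "norm (p (u q)) \<le> ns_norm (dual_space X0) p * ns_norm (dual_space X1) q * ns_norm (tensor_ops X0 X1) u"
      by (rule tensor_pairing_bound[OF X0 X1 uL that])
    also have "\<dots> \<le> ns_norm (dual_space X0) p * ns_norm (dual_space X1) q * 1"
      using u1 D0.norm_nonneg[OF that(1)] D1.norm_nonneg[OF that(2)] by (intro mult_left_mono) auto
    finally show ?thesis by simp
  qed
  have "norm ((f' - f) (u g')) \<le> R * ns_norm (dual_space X0) (f' - f)"
    using bound[OF df D(4)] mult_left_mono[OF R(3)[OF g(2)] D0.norm_nonneg[OF df]]
    by (simp add: mult.commute)
  moreover have "norm (f (u (g' - g))) \<le> R * ns_norm (dual_space X1) (g' - g)"
    using bound[OF D(1) dg] mult_right_mono[OF R(2)[OF f(1)] D1.norm_nonneg[OF dg]]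
    by linarith
  ultimately show ?thesis
    unfolding split using norm_triangle_ineq[of "(f' - f) (u g')" "f (u (g' - g))"] by linarith
qed

text \<open>At a cluster point of the pairs attached to the children of a node, one of the two factors
  has to oscillate: the children are weakly null, so their values at the cluster point itself are
  small.\<close>

lemma product_tree_derivations:
  assumes "C \<subseteq> K0 \<times> K1" "compact C"
    and "frequently_branch (weak_ball_filter (injective_tensor X0 X1)) (length ds)
      (\<lambda>us. \<exists>p\<in>C. \<forall>i<length ds. ds ! i \<le> re (fst p ((us ! i) (snd p))))"
  shows "\<exists>(a, b) \<in> splittings (1 / (8 * R)) ds. \<exists>p\<in>C.
    fst p \<in> foldr (szlenk_deriv X0) a K0 \<and> snd p \<in> foldr (szlenk_deriv X1) b K1"
  using assms
proof (induction ds arbitrary: C)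
  case Nil
  then show ?case by force
next
  case (Cons d ds)
  let ?W = "weak_ball_filter (injective_tensor X0 X1)" and ?c = "1 / (8 * R)"
  let ?pair = "\<lambda>p u. re (fst p (u (snd p)))"
  let ?L0 = "\<lambda>a. foldr (szlenk_deriv X0) a K0" and ?L1 = "\<lambda>b. foldr (szlenk_deriv X1) b K1"
  interpret I: normed_space "injective_tensor X0 X1" by (rule normed_space_injective_tensor[OF X0 X1])
  have "\<exists>\<^sub>F u in ?W. frequently_branch ?W (length ds)
      (\<lambda>us. \<exists>p\<in>C. \<forall>i<length (d # ds). (d # ds) ! i \<le> ?pair p ((u # us) ! i))"
    using Cons.prems(3) by simp
  then have "\<exists>\<^sub>F u in ?W. u \<in> ns_cball (injective_tensor X0 X1) \<and> frequently_branch ?W (length ds)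
      (\<lambda>us. \<exists>p\<in>C. \<forall>i<length (d # ds). (d # ds) ! i \<le> ?pair p ((u # us) ! i))"
    using eventually_weak_ball_filter_cball frequently_eventually_conj by fast
  then have "\<exists>\<^sub>F u in ?W. \<exists>ab\<in>splittings ?c ds. \<exists>p\<in>C \<inter> ?L0 (fst ab) \<times> ?L1 (snd ab). d \<le> ?pair p u"
  proof (rule frequently_elim1, elim conjE)
    fix u assume u: "u \<in> ns_cball (injective_tensor X0 X1)"
      and br: "frequently_branch ?W (length ds)
        (\<lambda>us. \<exists>p\<in>C. \<forall>i<length (d # ds). (d # ds) ! i \<le> ?pair p ((u # us) ! i))"
    \<comment> \<open>The pairs that already meet the bound at \<open>u\<close>. They form a compact
      set because the pairing is continuous on bounded sets; the induction runs over all compact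
      \<open>C\<close> so that it can be applied to this one.\<close>
    define C' where "C' = C \<inter> (\<lambda>p. ?pair p u) -` {d..}"
    have "continuous_on (K0 \<times> K1) (\<lambda>p. fst p (u (snd p)))"
      by (rule continuous_on_tensor_pairing[OF X0 X1]) (use u K0 K1 R in \<open>auto simp: ns_cball_def\<close>)
    then have "continuous_on C (\<lambda>p. fst p (u (snd p)))"
      using Cons.prems(1) by (rule continuous_on_subset)
    then have "continuous_on C (\<lambda>p. ?pair p u)" by (rule continuous_on_re)
    then have "closedin (top_of_set C) C'"
      unfolding C'_def by (intro continuous_closedin_preimage) auto
    then have compact: "compact C'" using Cons.prems(2) closedin_compact by blast
    have sub: "C' \<subseteq> K0 \<times> K1" using Cons.prems(1) by (auto simp: C'_def)
    have "frequently_branch ?W (length ds) (\<lambda>us. \<exists>p\<in>C'. \<forall>i<length ds. ds ! i \<le> ?pair p (us ! i))"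
    proof (rule frequently_branch_mono[OF eventually_weak_ball_filter_cball _ br])
      fix us assume "\<exists>p\<in>C. \<forall>i<length (d # ds). (d # ds) ! i \<le> ?pair p ((u # us) ! i)"
      then obtain p where p: "p \<in> C" "\<forall>i<Suc (length ds). (d # ds) ! i \<le> ?pair p ((u # us) ! i)"
        by auto
      then have "d \<le> ?pair p u" "\<forall>i<length ds. ds ! i \<le> ?pair p (us ! i)"
        unfolding All_less_Suc2 by simp_all
      with p(1) show "\<exists>p\<in>C'. \<forall>i<length ds. ds ! i \<le> ?pair p (us ! i)"
        by (auto simp: C'_def)
    qed
    from Cons.IH[OF sub compact this]
    obtain ab p where ab: "ab \<in> splittings ?c ds"
        and p: "p \<in> C'" "fst p \<in> ?L0 (fst ab)" "snd p \<in> ?L1 (snd ab)"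
      by (auto simp: case_prod_beta)
    have "p \<in> C \<inter> ?L0 (fst ab) \<times> ?L1 (snd ab)" "d \<le> ?pair p u"
      using p by (auto simp: C'_def mem_Times_iff)
    with ab show "\<exists>ab\<in>splittings ?c ds. \<exists>p\<in>C \<inter> ?L0 (fst ab) \<times> ?L1 (snd ab). d \<le> ?pair p u" by blast
  qed
  \<comment> \<open>So far the splitting depends on \<open>u\<close>. One of the finitely many is
    frequent, and this fixes the two derived sets before a cluster point is taken.\<close>
  from frequently_bex_finite[OF finite_splittings this]
  obtain a b where ab: "(a, b) \<in> splittings ?c ds"
    and freq: "\<exists>\<^sub>F u in ?W. \<exists>p\<in>C \<inter> ?L0 a \<times> ?L1 b. d \<le> ?pair p u" by auto
  have L0: "?L0 a \<subseteq> K0" and L1: "?L1 b \<subseteq> K1" by (rule foldr_szlenk_deriv_subset)+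
  then have LD: "?L0 a \<subseteq> ns_carrier (dual_space X0)" "?L1 b \<subseteq> ns_carrier (dual_space X1)"
    using K0 K1 by auto
  obtain T0 T1 where T: "closed T0" "?L0 a = K0 \<inter> T0" "closed T1" "?L1 b = K1 \<inter> T1"
    using foldr_szlenk_deriv_closed_Int[OF X0 K0] foldr_szlenk_deriv_closed_Int[OF X1 K1] by metis
  have "compact (C \<inter> T0 \<times> T1)"
    using Cons.prems(2) T by (intro compact_Int_closed closed_Times)
  moreover have "C \<inter> T0 \<times> T1 = C \<inter> ?L0 a \<times> ?L1 b"
    using Cons.prems(1) T by auto
  ultimately have "compact (C \<inter> ?L0 a \<times> ?L1 b)" by simp
  from frequently_cluster_point[OF this freq]
  obtain p where pC: "p \<in> C" and p0: "fst p \<in> ?L0 a" and p1: "snd p \<in> ?L1 b"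
    and cluster: "\<And>U. open U \<Longrightarrow> p \<in> U \<Longrightarrow> \<exists>\<^sub>F u in ?W. \<exists>q\<in>(C \<inter> ?L0 a \<times> ?L1 b) \<inter> U. d \<le> ?pair q u"
    by auto
  \<comment> \<open>If both factors oscillated by at most d / (8 R) near \<open>p\<close>, the
    pairing would change there by at most d / 4. But it is at least d at nearby pairs
    \<open>q\<close> and below d / 2 in modulus at \<open>p\<close>.\<close>
  have "fst p \<in> szlenk_deriv X0 (?c * max d 0) (?L0 a) \<or> snd p \<in> szlenk_deriv X1 (?c * max d 0) (?L1 b)"
  proof (cases "d \<le> 0")
    case True
    then show ?thesis using p0 by (simp add: szlenk_deriv_nonpos max_def)
  next
    case False
    then have d: "d > 0" and m: "max d 0 = d" by auto
    have cd: "?c * d > 0" using d R(1) by simp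
    show ?thesis
    proof (rule ccontr)
      assume "\<not> ?thesis"
      then obtain U0 U1 where U0: "open U0" "fst p \<in> U0"
          "\<And>g h. g \<in> U0 \<inter> ?L0 a \<Longrightarrow> h \<in> U0 \<inter> ?L0 a \<Longrightarrow> ns_norm (dual_space X0) (g - h) \<le> ?c * d"
        and U1: "open U1" "snd p \<in> U1"
          "\<And>g h. g \<in> U1 \<inter> ?L1 b \<Longrightarrow> h \<in> U1 \<inter> ?L1 b \<Longrightarrow> ns_norm (dual_space X1) (g - h) \<le> ?c * d"
        unfolding m szlenk_deriv_iff[OF X0 LD(1) cd] szlenk_deriv_iff[OF X1 LD(2) cd]
        using p0 p1 by (auto simp: not_less)
      have pU: "open (U0 \<times> U1)" "p \<in> U0 \<times> U1"
        using U0 U1 by (auto intro: open_Times simp: mem_Times_iff)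
      have pD: "fst p \<in> ns_carrier (dual_space X0)" "snd p \<in> ns_carrier (dual_space X1)"
        using p0 p1 LD by auto
      have "\<forall>\<^sub>F u in ?W. u \<in> ns_cball (injective_tensor X0 X1) \<and>
          norm (tensor_functional X0 X1 (fst p) (snd p) u) < d / 2"
        \<comment> \<open>The pair \<open>p\<close> is fixed before \<open>u\<close> is chosen, so
          its functional is a single element of the dual and is eventually small; only
          \<open>q\<close> still varies with \<open>u\<close>.\<close>
        using d by (intro eventually_conj eventually_weak_ball_filter_cball
            eventually_weak_ball_filter_small tensor_functional_dual[OF X0 X1 pD]) auto
      from frequently_ex[OF frequently_eventually_conj[OF cluster[OF pU] this]]
      obtain u q where u: "u \<in> ns_cball (injective_tensor X0 X1)"
        and small: "norm (tensor_functional X0 X1 (fst p) (snd p) u) < d / 2"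
        and q: "q \<in> ?L0 a \<times> ?L1 b" "q \<in> U0 \<times> U1" and big: "d \<le> ?pair q u" by auto
      have "norm (fst p (u (snd p))) < d / 2"
        using small u by (simp add: tensor_functional_def[OF X0 X1] ns_cball_def)
      then have "d / 2 < norm (fst q (u (snd q)) - fst p (u (snd p)))"
        using big re_le[of "fst q (u (snd q))"]
          norm_triangle_ineq2[of "fst q (u (snd q))" "fst p (u (snd p))"] by linarith
      also have "\<dots> \<le> R * ns_norm (dual_space X0) (fst q - fst p) + R * ns_norm (dual_space X1) (snd q - snd p)"
        by (rule tensor_pairing_difference[OF u]) (use p0 p1 q L0 L1 in auto)
      also have "\<dots> \<le> R * (?c * d) + R * (?c * d)"
        using U0(2,3) U1(2,3) q p0 p1 R(1) by (intro add_mono mult_left_mono) auto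
      also have "\<dots> = d / 4" using R(1) by simp
      finally show False using d by simp
    qed
  qed
  then show ?case
  proof
    assume "fst p \<in> szlenk_deriv X0 (?c * max d 0) (?L0 a)"
    then have "fst p \<in> ?L0 (?c * max d 0 # a)" "snd p \<in> ?L1 (0 # b)"
      using p1 by (simp_all add: szlenk_deriv_nonpos)
    moreover have "(?c * max d 0 # a, 0 # b) \<in> splittings ?c (d # ds)"
      using ab by (force simp: image_iff)
    ultimately show ?thesis using pC by blast
  next
    assume "snd p \<in> szlenk_deriv X1 (?c * max d 0) (?L1 b)"
    then have "fst p \<in> ?L0 (0 # a)" "snd p \<in> ?L1 (?c * max d 0 # b)"
      using p0 by (simp_all add: szlenk_deriv_nonpos)
    moreover have "(0 # a, ?c * max d 0 # b) \<in> splittings ?c (d # ds)"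
      using ab by (force simp: image_iff)
    ultimately show ?thesis using pC by blast
  qed
qed

end

section \<open>Sums along branches and lower bounds for elementary functionals\<close>

lemma dual_sum_list:
  assumes "normed_space X" "f \<in> ns_carrier (dual_space X)" "set xs \<subseteq> ns_carrier X"
  shows "sum_list xs \<in> ns_carrier X" "f (sum_list xs) = sum_list (map f xs)"
proof -
  interpret normed_space X by fact
  have "sum_list xs \<in> ns_carrier X \<and> f (sum_list xs) = sum_list (map f xs)"
    using assms(3)
  proof (induction xs)
    case Nil
    then show ?case using dual_spaceD(1)[OF assms(2) carrier_zero carrier_zero] by (simp add: carrier_zero)
  next
    case (Cons x xs)
    then show ?case using dual_spaceD(1)[OF assms(2), of x "sum_list xs"] by (simp add: carrier_add)
  qed
  then show "sum_list xs \<in> ns_carrier X" "f (sum_list xs) = sum_list (map f xs)" by auto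
qed

lemma re_sum_list: "re (sum_list xs) = sum_list (map re xs)"
  by (induction xs) (auto simp: re_add)

lemma norm_pos_of_dual_nonzero:
  assumes "normed_space X" "f \<in> ns_carrier (dual_space X)" "x \<in> ns_carrier X" "f x \<noteq> 0"
  shows "ns_norm X x > 0"
proof (rule ccontr)
  assume "\<not> ?thesis"
  then have "ns_norm X x = 0" using normed_space.norm_nonneg[OF assms(1,3)] by simp
  then show False using dual_norm_bound[OF assms(1-3)] assms(4) by simp
qed

text \<open>The difference is tested on elementary tensors with one component fixed. At
  \<open>x\<close> and \<open>y\<close> the first difference has the value (f - f')(x) g(y), and the
  norm of the tensor is at most the product of the norms.\<close>

lemma tensor_functional_lower:
  fixes X :: "('k::real_or_complex, 'a::ab_group_add) nspace"
    and Y :: "('k, 'b::ab_group_add) nspace"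
  assumes X: "normed_space X" and Y: "normed_space Y"
  shows "f \<in> ns_carrier (dual_space X) \<Longrightarrow> f' \<in> ns_carrier (dual_space X) \<Longrightarrow>
      g \<in> ns_carrier (dual_space Y) \<Longrightarrow> y \<in> ns_carrier Y \<Longrightarrow> g y \<noteq> 0 \<Longrightarrow>
      norm (g y) / ns_norm Y y * ns_norm (dual_space X) (f - f') \<le>
        ns_norm (dual_space (injective_tensor X Y)) (tensor_functional X Y f g - tensor_functional X Y f' g)"
    and "f \<in> ns_carrier (dual_space X) \<Longrightarrow> g \<in> ns_carrier (dual_space Y) \<Longrightarrow>
      g' \<in> ns_carrier (dual_space Y) \<Longrightarrow> x \<in> ns_carrier X \<Longrightarrow> f x \<noteq> 0 \<Longrightarrow>
      norm (f x) / ns_norm X x * ns_norm (dual_space Y) (g - g') \<le>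
        ns_norm (dual_space (injective_tensor X Y)) (tensor_functional X Y f g - tensor_functional X Y f g')"
proof -
  interpret I: normed_space "injective_tensor X Y" by (rule normed_space_injective_tensor[OF X Y])
  interpret DI: normed_space "dual_space (injective_tensor X Y)" by (rule normed_space_dual[OF I.normed_space_axioms])
  let ?t = "tensor_functional X Y" and ?DI = "dual_space (injective_tensor X Y)"
  have elem: "?t f g (elementary_tensor X Y x y) = f x * g y"
    if "f \<in> ns_carrier (dual_space X)" "g \<in> ns_carrier (dual_space Y)" "x \<in> ns_carrier X" "y \<in> ns_carrier Y"
    for f g x y
    using that elementary_tensor_injective[OF X Y that(3,4)]
    by (simp add: tensor_functional_def[OF X Y] elementary_tensor_def dual_spaceD(2)[OF that(1,3)])
  have bound: "norm (\<Psi> (elementary_tensor X Y x y)) \<le> ns_norm ?DI \<Psi> * (ns_norm X x * ns_norm Y y)"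
    if \<Psi>: "\<Psi> \<in> ns_carrier ?DI" and xy: "x \<in> ns_carrier X" "y \<in> ns_carrier Y" for \<Psi> x y
    using dual_norm_bound[OF I.normed_space_axioms \<Psi> elementary_tensor_injective[OF X Y xy]]
      mult_left_mono[OF elementary_tensor(2)[OF X Y xy] DI.norm_nonneg[OF \<Psi>]]
    by (simp add: ns_norm_injective_tensor)
  {
    assume f: "f \<in> ns_carrier (dual_space X)" "f' \<in> ns_carrier (dual_space X)"
      and g: "g \<in> ns_carrier (dual_space Y)" and y: "y \<in> ns_carrier Y" and gy: "g y \<noteq> 0"
    let ?\<Psi> = "?t f g - ?t f' g"
    have \<Psi>: "?\<Psi> \<in> ns_carrier ?DI"
      using tensor_functional_dual(1)[OF X Y] f g DI.carrier_diff by blast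
    have pos: "ns_norm Y y > 0"
      by (rule norm_pos_of_dual_nonzero[OF Y g y gy])
    have "ns_norm (dual_space X) (f - f') \<le> ns_norm ?DI ?\<Psi> * ns_norm Y y / norm (g y)"
    proof (rule dual_norm_least[OF X])
      fix x assume "x \<in> ns_cball X"
      then have x: "x \<in> ns_carrier X" "ns_norm X x \<le> 1" by (auto simp: ns_cball_def)
      have "norm ((f - f') x) * norm (g y) = norm (?\<Psi> (elementary_tensor X Y x y))"
        using elem[OF f(1) g x(1) y] elem[OF f(2) g x(1) y]
        by (simp add: norm_mult[symmetric] left_diff_distrib)
      also have "\<dots> \<le> ns_norm ?DI ?\<Psi> * (ns_norm X x * ns_norm Y y)" by (rule bound[OF \<Psi> x(1) y])
      also have "\<dots> \<le> ns_norm ?DI ?\<Psi> * (1 * ns_norm Y y)"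
        using x(2) pos DI.norm_nonneg[OF \<Psi>] by (intro mult_left_mono mult_right_mono) auto
      finally show "norm ((f - f') x) \<le> ns_norm ?DI ?\<Psi> * ns_norm Y y / norm (g y)"
        using gy by (simp add: pos_le_divide_eq)
    qed
    then show "norm (g y) / ns_norm Y y * ns_norm (dual_space X) (f - f') \<le> ns_norm ?DI ?\<Psi>"
      using gy pos by (simp add: pos_le_divide_eq pos_divide_le_eq mult.commute)
  }
  {
    assume f: "f \<in> ns_carrier (dual_space X)" and g: "g \<in> ns_carrier (dual_space Y)" "g' \<in> ns_carrier (dual_space Y)"
      and x: "x \<in> ns_carrier X" and fx: "f x \<noteq> 0"
    let ?\<Psi> = "?t f g - ?t f g'"
    have \<Psi>: "?\<Psi> \<in> ns_carrier ?DI"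
      using tensor_functional_dual(1)[OF X Y] f g DI.carrier_diff by blast
    have pos: "ns_norm X x > 0"
      by (rule norm_pos_of_dual_nonzero[OF X f x fx])
    have "ns_norm (dual_space Y) (g - g') \<le> ns_norm ?DI ?\<Psi> * ns_norm X x / norm (f x)"
    proof (rule dual_norm_least[OF Y])
      fix y assume "y \<in> ns_cball Y"
      then have y: "y \<in> ns_carrier Y" "ns_norm Y y \<le> 1" by (auto simp: ns_cball_def)
      have "norm ((g - g') y) * norm (f x) = norm (?\<Psi> (elementary_tensor X Y x y))"
        using elem[OF f g(1) x y(1)] elem[OF f g(2) x y(1)]
        by (simp add: norm_mult[symmetric] algebra_simps)
      also have "\<dots> \<le> ns_norm ?DI ?\<Psi> * (ns_norm X x * ns_norm Y y)" by (rule bound[OF \<Psi> x y(1)])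
      also have "\<dots> \<le> ns_norm ?DI ?\<Psi> * (ns_norm X x * 1)"
        using y(2) pos DI.norm_nonneg[OF \<Psi>] by (intro mult_left_mono) auto
      finally show "norm ((g - g') y) \<le> ns_norm ?DI ?\<Psi> * ns_norm X x / norm (f x)"
        using fx by (simp add: pos_le_divide_eq)
    qed
    then show "norm (f x) / ns_norm X x * ns_norm (dual_space Y) (g - g') \<le> ns_norm ?DI ?\<Psi>"
      using fx pos by (simp add: pos_le_divide_eq pos_divide_le_eq mult.commute)
  }
qed

text \<open>A functional norming the nonzero vector \<open>A x\<close> cannot vanish there. This is
  how an operator different from zero supplies the fixed factor of the embedding.\<close>

lemma adjoint_op_nonvanishing:
  fixes X :: "('k::real_or_complex, 'a::ab_group_add) nspace"
    and Y :: "('k, 'b::ab_group_add) nspace"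
  assumes Y: "normed_space Y" and A: "bounded_linear_op X Y A"
    and x: "x \<in> ns_carrier X" "A x \<noteq> 0"
  shows "\<exists>g\<in>ns_cball (dual_space Y). adjoint_op X A g x \<noteq> 0"
proof -
  have Ax: "A x \<in> ns_carrier Y" using A x unfolding bounded_linear_op_def by blast
  obtain g where g: "g \<in> ns_cball (dual_space Y)" "re (g (A x)) = ns_norm Y (A x)"
    using Hahn_Banach_norming[OF Y Ax] by blast
  have "re (g (A x)) \<noteq> 0" using g(2) normed_space.norm_eq_zero[OF Y Ax] x(2) by simp
  then have "g (A x) \<noteq> 0" by auto
  with g(1) x(1) show ?thesis by (auto simp: adjoint_op_def)
qed

section \<open>Summability of the tensor product and of its factors\<close>

context
  fixes X0 :: "('k::real_or_complex, 'x0::ab_group_add) nspace"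
    and X1 :: "('k, 'x1::ab_group_add) nspace"
    and Y0 :: "('k, 'y0::ab_group_add) nspace"
    and Y1 :: "('k, 'y1::ab_group_add) nspace"
    and A0 :: "'x0 \<Rightarrow> 'y0" and A1 :: "'x1 \<Rightarrow> 'y1"
  assumes X0: "normed_space X0" and X1: "normed_space X1"
    and Y0: "normed_space Y0" and Y1: "normed_space Y1"
    and A0: "bounded_linear_op X0 Y0 A0" and A1: "bounded_linear_op X1 Y1 A1"
begin

abbreviation (input) "adjoint_ball0 \<equiv> adjoint_op X0 A0 ` ns_cball (dual_space Y0)"
abbreviation (input) "adjoint_ball1 \<equiv> adjoint_op X1 A1 ` ns_cball (dual_space Y1)"
abbreviation (input) "adjoint_ball_tensor \<equiv> adjoint_op (injective_tensor X0 X1) (tensor_op X1 Y1 A0 A1) `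
  ns_cball (dual_space (injective_tensor Y0 Y1))"

text \<open>The norm of the image of \<open>u\<close> is the supremum of the real parts of
  \<open>y0\<close> (\<open>?T u y1\<close>) over both dual balls. Hahn--Banach provides an exactly
  norming \<open>y0\<close>, while \<open>y1\<close> is only nearly optimal, which costs \<eta>. The
  pair depends on \<open>u\<close>.\<close>

lemma adjoint_tensor_op_dominated:
  assumes g: "g \<in> adjoint_ball_tensor" and u: "u \<in> ns_carrier (injective_tensor X0 X1)" and \<eta>: "\<eta> > 0"
  shows "\<exists>p\<in>adjoint_ball0 \<times> adjoint_ball1. re (g u) \<le> re (fst p (u (snd p))) + \<eta>"
proof -
  interpret L: normed_space "tensor_ops Y0 Y1"
    by (rule normed_space_operator_space[OF normed_space_dual[OF Y1] Y0])
  let ?T = "tensor_op X1 Y1 A0 A1"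
  have Tu: "?T u \<in> ns_carrier (injective_tensor Y0 Y1)"
    using tensor_op_bounded[OF X0 X1 Y0 Y1 A0 A1] u unfolding bounded_linear_op_def by blast
  then have TuL: "?T u \<in> ns_carrier (tensor_ops Y0 Y1)"
    using injective_tensor_iff[OF Y0 Y1] by blast
  obtain \<Phi> where \<Phi>: "\<Phi> \<in> ns_cball (dual_space (injective_tensor Y0 Y1))" "g u = \<Phi> (?T u)"
    using g u by (auto simp: adjoint_op_def)
  have "norm (g u) \<le> ns_norm (tensor_ops Y0 Y1) (?T u)"
    using \<Phi> Tu dual_ball_iff[OF normed_space_injective_tensor[OF Y0 Y1], of \<Phi>]
    by (simp add: ns_norm_injective_tensor)
  moreover obtain y1 where y1: "y1 \<in> ns_cball (dual_space Y1)"
    and big: "ns_norm (tensor_ops Y0 Y1) (?T u) - \<eta> < ns_norm Y0 (?T u y1)"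
  proof (rule ccontr)
    assume "\<not> thesis"
    then have "ns_norm Y0 (?T u y) \<le> ns_norm (tensor_ops Y0 Y1) (?T u) - \<eta>"
      if "y \<in> ns_cball (dual_space Y1)" for y
      using that \<open>\<And>y1. _ \<Longrightarrow> _ \<Longrightarrow> thesis\<close> by force
    from operator_norm_least[OF normed_space_dual[OF Y1] this] \<eta> show False by fastforce
  qed
  have y1D: "y1 \<in> ns_carrier (dual_space Y1)" using y1 by (auto simp: ns_cball_def)
  obtain y0 where y0: "y0 \<in> ns_cball (dual_space Y0)" "re (y0 (?T u y1)) = ns_norm Y0 (?T u y1)"
    using Hahn_Banach_norming[OF Y0 operator_spaceD(1)[OF TuL y1D]] by blast
  have "adjoint_op X1 A1 y1 \<in> ns_carrier (dual_space X1)"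
    using adjoint_ball(2)[OF X1 Y1 A1] y1 by blast
  moreover have "u \<in> ns_carrier (tensor_ops X0 X1)" using u injective_tensor_iff[OF X0 X1] by blast
  ultimately have "u (adjoint_op X1 A1 y1) \<in> ns_carrier X0" using operator_spaceD(1) by blast
  then have "adjoint_op X0 A0 y0 (u (adjoint_op X1 A1 y1)) = y0 (?T u y1)"
    using y1D by (simp add: adjoint_op_def[of X0] tensor_op_def)
  moreover have "re (g u) \<le> norm (g u)" by (rule re_le)
  ultimately have "re (g u) \<le> re (adjoint_op X0 A0 y0 (u (adjoint_op X1 A1 y1))) + \<eta>"
    using y0(2) big \<open>norm (g u) \<le> _\<close> by simp
  then show ?thesis
    using y0(1) y1 by (intro bexI[of _ "(adjoint_op X0 A0 y0, adjoint_op X1 A1 y1)"]) auto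
qed

text \<open>Rounding the values of the pairs on the branches down to multiples of \<open>\<eta>\<close> leaves finitely
  many colours, so a subtree carries the same lower bounds on all its branches.\<close>

lemma tensor_op_summable:
  assumes "op_has_summable_szlenk_index X0 Y0 A0" "op_has_summable_szlenk_index X1 Y1 A1"
  shows "op_has_summable_szlenk_index (injective_tensor X0 X1) (injective_tensor Y0 Y1)
    (tensor_op X1 Y1 A0 A1)"
proof -
  note I = normed_space_injective_tensor[OF X0 X1] and J = normed_space_injective_tensor[OF Y0 Y1]
  note K0 = adjoint_ball[OF X0 Y0 A0] and K1 = adjoint_ball[OF X1 Y1 A1]
    and K = adjoint_ball[OF I J tensor_op_bounded[OF X0 X1 Y0 Y1 A0 A1]]
  obtain M0 where M0: "M0 \<ge> 0" "has_M_summable_szlenk_index X0 M0 adjoint_ball0"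
    using assms(1) unfolding op_has_summable_szlenk_index_def has_summable_szlenk_index_def by blast
  obtain M1 where M1: "M1 \<ge> 0" "has_M_summable_szlenk_index X1 M1 adjoint_ball1"
    using assms(2) unfolding op_has_summable_szlenk_index_def has_summable_szlenk_index_def by blast
  obtain R0 where R0: "R0 > 0" "\<forall>f\<in>adjoint_ball0. ns_norm (dual_space X0) f \<le> R0" using K0(3) by blast
  obtain R1 where R1: "R1 > 0" "\<forall>g\<in>adjoint_ball1. ns_norm (dual_space X1) g \<le> R1" using K1(3) by blast
  define R where "R = max R0 R1"
  have R: "R > 0" "\<And>f. f \<in> adjoint_ball0 \<Longrightarrow> ns_norm (dual_space X0) f \<le> R"
    "\<And>g. g \<in> adjoint_ball1 \<Longrightarrow> ns_norm (dual_space X1) g \<le> R"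
    using R0 R1 by (auto simp: R_def le_max_iff_disj)
  let ?W = "weak_ball_filter (injective_tensor X0 X1)" and ?c = "1 / (8 * R)"
  have bound: "sum_list \<epsilon>s \<le> 32 * R * (M0 + M1)"
    if ne: "foldr (szlenk_deriv (injective_tensor X0 X1)) \<epsilon>s adjoint_ball_tensor \<noteq> {}" for \<epsilon>s
  proof -
    let ?N = "length \<epsilon>s"
    obtain f where f: "f \<in> foldr (szlenk_deriv (injective_tensor X0 X1)) \<epsilon>s adjoint_ball_tensor" using ne by blast
    \<comment> \<open>The error consists of \<eta> per node from the tree, \<eta> from domination
      and \<eta> per node from rounding.\<close>
    have step: "sum_list \<epsilon>s / 4 - (2 * ?N + 1) * \<eta> \<le> 8 * R * (M0 + M1)" if \<eta>: "\<eta> > 0" for \<eta> :: real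
    proof -
      have tree: "frequently_branch ?W ?N (\<lambda>us. \<exists>g\<in>adjoint_ball_tensor. \<forall>i<?N. \<epsilon>s ! i / 4 - \<eta> \<le> re (g (us ! i)))"
        using szlenk_deriv_tree[OF I K(2) f, of "{}" \<eta>] \<eta> by simp
      \<comment> \<open>On the ball the pairings are at most \<open>R * R\<close> in modulus. The
        ceiling is taken because the floor of a negative quotient can reach minus this
        ceiling.\<close>
      define m where "m = \<lceil>R * R / \<eta>\<rceil>"
      define G where "G = (\<lambda>k. \<eta> * of_int k) ` {-m..m}"
      \<comment> \<open>The colours. The lower bound for the total is built into the set of colours,
        so it survives the choice of a subtree.\<close>
      define D where "D = {\<delta>s. set \<delta>s \<subseteq> G \<and> length \<delta>s = ?N} \<inter>
        {\<delta>s. sum_list \<epsilon>s / 4 - (2 * ?N + 1) * \<eta> \<le> sum_list \<delta>s}"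
      have "finite D" unfolding D_def G_def by (intro finite_Int disjI1 finite_lists_length_eq) auto
      have "frequently_branch ?W ?N
        (\<lambda>us. \<exists>\<delta>s\<in>D. \<exists>p\<in>adjoint_ball0 \<times> adjoint_ball1. \<forall>i<length \<delta>s. \<delta>s ! i \<le> re (fst p ((us ! i) (snd p))))"
      proof (rule frequently_branch_mono[OF eventually_weak_ball_filter_cball _ tree])
        fix us assume len: "length us = ?N" and us: "set us \<subseteq> ns_cball (injective_tensor X0 X1)"
          and "\<exists>g\<in>adjoint_ball_tensor. \<forall>i<?N. \<epsilon>s ! i / 4 - \<eta> \<le> re (g (us ! i))"
        then obtain g where g: "g \<in> adjoint_ball_tensor" "\<And>i. i < ?N \<Longrightarrow> \<epsilon>s ! i / 4 - \<eta> \<le> re (g (us ! i))" by blast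
        have usI: "set us \<subseteq> ns_carrier (injective_tensor X0 X1)" using us by (auto simp: ns_cball_def)
        have gD: "g \<in> ns_carrier (dual_space (injective_tensor X0 X1))" using g(1) K(2) by blast
        have sumI: "sum_list us \<in> ns_carrier (injective_tensor X0 X1)"
          by (rule dual_sum_list[OF I gD usI])
        \<comment> \<open>Domination is used at the sum of the branch; linearity then distributes
          the bound over the nodes in an uncontrolled way, which the list of rounded values
          records.\<close>
        obtain p where p: "p \<in> adjoint_ball0 \<times> adjoint_ball1" "re (g (sum_list us)) \<le> re (fst p (sum_list us (snd p))) + \<eta>"
          using adjoint_tensor_op_dominated[OF g(1) sumI \<eta>] by blast
        have pD: "fst p \<in> ns_carrier (dual_space X0)" "snd p \<in> ns_carrier (dual_space X1)"
          using p(1) K0(2) K1(2) by auto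
        let ?\<phi> = "\<lambda>u. fst p (u (snd p))"
        have \<phi>: "tensor_functional X0 X1 (fst p) (snd p) u = ?\<phi> u"
          if "u \<in> ns_carrier (injective_tensor X0 X1)" for u
          using that by (simp add: tensor_functional_def[OF X0 X1])
        define \<delta>s where "\<delta>s = map (\<lambda>u. \<eta> * of_int \<lfloor>re (?\<phi> u) / \<eta>\<rfloor>) us"
        have rnd: "\<eta> * of_int \<lfloor>r / \<eta>\<rfloor> \<le> r" "r - \<eta> \<le> \<eta> * of_int \<lfloor>r / \<eta>\<rfloor>" for r
          using \<eta> floor_divide_lower[OF \<eta>, of r] floor_divide_upper[OF \<eta>, of r]
          by (simp_all add: algebra_simps)
        have "set \<delta>s \<subseteq> G"
        proof -
          have "\<lfloor>re (?\<phi> u) / \<eta>\<rfloor> \<in> {-m..m}" if "u \<in> set us" for u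
          proof -
            have u: "u \<in> ns_carrier (tensor_ops X0 X1)" "ns_norm (tensor_ops X0 X1) u \<le> 1"
              using us that injective_tensor_iff[OF X0 X1] by (auto simp: ns_cball_def ns_norm_injective_tensor)
            have "\<bar>re (?\<phi> u)\<bar> \<le> norm (?\<phi> u)" by (rule abs_re_le)
            also have "\<dots> \<le> ns_norm (dual_space X0) (fst p) * ns_norm (dual_space X1) (snd p) * ns_norm (tensor_ops X0 X1) u"
              by (rule tensor_pairing_bound[OF X0 X1 u(1) pD])
            also have "\<dots> \<le> R * R * 1"
              using R p(1) u normed_space.norm_nonneg[OF normed_space_dual[OF X0] pD(1)]
                normed_space.norm_nonneg[OF normed_space_dual[OF X1] pD(2)]
                normed_space.norm_nonneg[OF normed_space_operator_space[OF normed_space_dual[OF X1] X0] u(1)]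
              by (intro mult_mono) auto
            finally have "\<bar>re (?\<phi> u)\<bar> / \<eta> \<le> R * R / \<eta>"
              using \<eta> by (simp add: divide_right_mono)
            then have "\<bar>re (?\<phi> u) / \<eta>\<bar> \<le> R * R / \<eta>"
              using \<eta> by (simp only: abs_divide abs_of_pos)
            then have "- (R * R / \<eta>) \<le> re (?\<phi> u) / \<eta>" "re (?\<phi> u) / \<eta> \<le> R * R / \<eta>"
              by (simp_all only: abs_le_iff minus_le_iff)
            from this[THEN floor_mono]
            have "- \<lceil>R * R / \<eta>\<rceil> \<le> \<lfloor>re (?\<phi> u) / \<eta>\<rfloor>" "\<lfloor>re (?\<phi> u) / \<eta>\<rfloor> \<le> \<lfloor>R * R / \<eta>\<rfloor>"
              unfolding floor_minus by auto
            moreover have "\<lfloor>R * R / \<eta>\<rfloor> \<le> \<lceil>R * R / \<eta>\<rceil>" by (rule floor_le_ceiling)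
            ultimately show ?thesis unfolding m_def atLeastAtMost_iff by linarith
          qed
          then show ?thesis by (auto simp: \<delta>s_def G_def)
        qed
        moreover have "length \<delta>s = ?N" by (simp add: \<delta>s_def len)
        moreover have "sum_list \<epsilon>s / 4 - (2 * ?N + 1) * \<eta> \<le> sum_list \<delta>s"
        proof -
          have "sum_list \<epsilon>s / 4 - ?N * \<eta> = (\<Sum>i<?N. \<epsilon>s ! i / 4 - \<eta>)"
            by (simp add: sum_list_sum_nth atLeast0LessThan sum_subtractf sum_divide_distrib)
          also have "\<dots> \<le> (\<Sum>i<?N. re (g (us ! i)))" using g(2) by (intro sum_mono) auto
          also have "\<dots> = re (g (sum_list us))"
            unfolding dual_sum_list(2)[OF I gD usI] re_sum_list
            by (simp add: sum_list_sum_nth atLeast0LessThan len)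
          also have "\<dots> \<le> re (?\<phi> (sum_list us)) + \<eta>" by (rule p(2))
          also have "re (?\<phi> (sum_list us)) = (\<Sum>u\<leftarrow>us. re (?\<phi> u))"
          proof -
            have "?\<phi> (sum_list us) = (\<Sum>u\<leftarrow>us. tensor_functional X0 X1 (fst p) (snd p) u)"
              using dual_sum_list(2)[OF I tensor_functional_dual(1)[OF X0 X1 pD] usI] \<phi>[OF sumI] by simp
            also have "\<dots> = (\<Sum>u\<leftarrow>us. ?\<phi> u)"
              using usI by (intro arg_cong[of _ _ sum_list] map_cong) (auto intro!: \<phi>)
            finally show ?thesis by (simp add: re_sum_list o_def)
          qed
          also have "\<dots> \<le> (\<Sum>u\<leftarrow>us. \<eta> * of_int \<lfloor>re (?\<phi> u) / \<eta>\<rfloor> + \<eta>)"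
            using rnd(2) by (intro sum_list_mono) (simp add: diff_le_eq)
          also have "\<dots> = sum_list \<delta>s + ?N * \<eta>"
            by (simp add: \<delta>s_def sum_list_addf sum_list_triv len)
          finally show ?thesis by (simp add: algebra_simps)
        qed
        ultimately have "\<delta>s \<in> D" by (simp add: D_def)
        moreover have "\<forall>i<length \<delta>s. \<delta>s ! i \<le> re (fst p ((us ! i) (snd p)))"
          using rnd(1) by (simp add: \<delta>s_def)
        ultimately show "\<exists>\<delta>s\<in>D. \<exists>p\<in>adjoint_ball0 \<times> adjoint_ball1. \<forall>i<length \<delta>s. \<delta>s ! i \<le> re (fst p ((us ! i) (snd p)))"
          using p(1) by blast
      qed
      from frequently_branch_pigeonhole[OF \<open>finite D\<close> this]
      obtain \<delta>s where \<delta>s: "\<delta>s \<in> D" and br: "frequently_branch ?W ?N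
        (\<lambda>us. \<exists>p\<in>adjoint_ball0 \<times> adjoint_ball1. \<forall>i<length \<delta>s. \<delta>s ! i \<le> re (fst p ((us ! i) (snd p))))" by blast
      have len: "length \<delta>s = ?N" using \<delta>s by (simp add: D_def)
      have "\<exists>(a, b) \<in> splittings ?c \<delta>s. \<exists>p\<in>adjoint_ball0 \<times> adjoint_ball1.
          fst p \<in> foldr (szlenk_deriv X0) a adjoint_ball0 \<and> snd p \<in> foldr (szlenk_deriv X1) b adjoint_ball1"
        by (rule product_tree_derivations[OF X0 X1 K0(2) K1(2) R subset_refl])
           (use br len K0(1) K1(1) compact_Times in auto)
      then obtain a b where ab: "(a, b) \<in> splittings ?c \<delta>s"
        and "foldr (szlenk_deriv X0) a adjoint_ball0 \<noteq> {}" "foldr (szlenk_deriv X1) b adjoint_ball1 \<noteq> {}" by blast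
      then have "sum_list a + sum_list b \<le> M0 + M1"
        using M0(2) M1(2) unfolding has_M_summable_szlenk_index_def by (intro add_mono) auto
      moreover have "?c * sum_list \<delta>s \<le> sum_list a + sum_list b"
        using sum_list_splittings[OF _ ab] R(1) by simp
      ultimately have "?c * sum_list \<delta>s \<le> M0 + M1" by linarith
      then have "sum_list \<delta>s \<le> 8 * R * (M0 + M1)"
        using R(1) by (simp add: divide_le_eq mult_ac)
      with \<delta>s show ?thesis by (simp add: D_def)
    qed
    show ?thesis
    proof (rule field_le_epsilon)
      fix e :: real assume "e > 0"
      define n where "n = 2 * real ?N + 1"
      have n: "n > 0" by (simp add: n_def add_nonneg_pos)
      \<comment> \<open>The length of the list is fixed, so the error vanishes with \<eta>. This
        choice makes it e / 4, which becomes e after multiplication by 4.\<close>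
      have "e / (4 * n) > 0" using \<open>e > 0\<close> n by simp
      from step[OF this] have "sum_list \<epsilon>s / 4 - n * (e / (4 * n)) \<le> 8 * R * (M0 + M1)"
        by (simp add: n_def add.commute)
      moreover have "n * (e / (4 * n)) = e / 4" using n by simp
      ultimately show "sum_list \<epsilon>s \<le> 32 * R * (M0 + M1) + e" by linarith
    qed
  qed
  then show ?thesis
    unfolding op_has_summable_szlenk_index_def has_summable_szlenk_index_def has_M_summable_szlenk_index_def
    using R(1) M0(1) M1(1) by (intro exI[of _ "32 * R * (M0 + M1)"]) auto
qed

section \<open>Passage from the tensor product back to its factors\<close>

lemma tensor_functional_adjoint:
  assumes y0: "y0 \<in> ns_cball (dual_space Y0)" and y1: "y1 \<in> ns_cball (dual_space Y1)"
  shows "tensor_functional X0 X1 (adjoint_op X0 A0 y0) (adjoint_op X1 A1 y1) \<in> adjoint_ball_tensor"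
proof
  have D: "y0 \<in> ns_carrier (dual_space Y0)" "y1 \<in> ns_carrier (dual_space Y1)"
    "ns_norm (dual_space Y0) y0 \<le> 1" "ns_norm (dual_space Y1) y1 \<le> 1"
    using y0 y1 by (auto simp: ns_cball_def)
  have "ns_norm (dual_space Y0) y0 * ns_norm (dual_space Y1) y1 \<le> 1 * 1"
    using D normed_space.norm_nonneg[OF normed_space_dual[OF Y1]] by (intro mult_mono) auto
  then show "tensor_functional Y0 Y1 y0 y1 \<in> ns_cball (dual_space (injective_tensor Y0 Y1))"
    using tensor_functional_dual[OF Y0 Y1 D(1,2)] by (simp add: ns_cball_def)
  \<comment> \<open>On the tensor product both sides send \<open>u\<close> to
    \<open>y0 (A0 (u (adjoint_op X1 A1 y1)))\<close>.\<close>
  show "tensor_functional X0 X1 (adjoint_op X0 A0 y0) (adjoint_op X1 A1 y1) =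
    adjoint_op (injective_tensor X0 X1) (tensor_op X1 Y1 A0 A1) (tensor_functional Y0 Y1 y0 y1)"
  proof
    fix u
    show "tensor_functional X0 X1 (adjoint_op X0 A0 y0) (adjoint_op X1 A1 y1) u =
      adjoint_op (injective_tensor X0 X1) (tensor_op X1 Y1 A0 A1) (tensor_functional Y0 Y1 y0 y1) u"
    proof (cases "u \<in> ns_carrier (injective_tensor X0 X1)")
      case True
      have "tensor_op X1 Y1 A0 A1 u \<in> ns_carrier (injective_tensor Y0 Y1)"
        using tensor_op_bounded[OF X0 X1 Y0 Y1 A0 A1] True unfolding bounded_linear_op_def by blast
      moreover have "u (adjoint_op X1 A1 y1) \<in> ns_carrier X0"
        using True injective_tensor_iff[OF X0 X1] adjoint_ball(2)[OF X1 Y1 A1] y1 operator_spaceD(1) by blast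
      ultimately show ?thesis
        using True D by (simp add: tensor_functional_def[OF X0 X1] tensor_functional_def[OF Y0 Y1]
            adjoint_op_def[of X0] adjoint_op_def[of "injective_tensor X0 X1"] tensor_op_def)
    next
      case False
      then show ?thesis
        by (simp add: tensor_functional_def[OF X0 X1] adjoint_op_def[of "injective_tensor X0 X1"])
    qed
  qed
qed

text \<open>Tensoring with \<open>f1\<close>, respectively \<open>f0\<close>, is the map to which
  \<open>has_summable_szlenk_index_transfer\<close> applies; the vectors \<open>x1\<close> and
  \<open>x0\<close>, at which these functionals do not vanish, give the constants in the lower norm
  estimates.\<close>

lemma summable_factors:
  assumes "\<exists>x\<in>ns_carrier X0. A0 x \<noteq> 0" and "\<exists>x\<in>ns_carrier X1. A1 x \<noteq> 0"
    and "op_has_summable_szlenk_index (injective_tensor X0 X1) (injective_tensor Y0 Y1)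
      (tensor_op X1 Y1 A0 A1)"
  shows "op_has_summable_szlenk_index X0 Y0 A0" "op_has_summable_szlenk_index X1 Y1 A1"
proof -
  note I = normed_space_injective_tensor[OF X0 X1] and J = normed_space_injective_tensor[OF Y0 Y1]
  note K0 = adjoint_ball(2)[OF X0 Y0 A0] and K1 = adjoint_ball(2)[OF X1 Y1 A1]
    and K = adjoint_ball(2)[OF I J tensor_op_bounded[OF X0 X1 Y0 Y1 A0 A1]]
  note summable = assms(3)[unfolded op_has_summable_szlenk_index_def]
  obtain x0 f0 where x0: "x0 \<in> ns_carrier X0" and f0: "f0 \<in> adjoint_ball0" "f0 x0 \<noteq> 0"
    using adjoint_op_nonvanishing[OF Y0 A0] assms(1) by blast
  obtain x1 f1 where x1: "x1 \<in> ns_carrier X1" and f1: "f1 \<in> adjoint_ball1" "f1 x1 \<noteq> 0"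
    using adjoint_op_nonvanishing[OF Y1 A1] assms(2) by blast
  have f0D: "f0 \<in> ns_carrier (dual_space X0)" and f1D: "f1 \<in> ns_carrier (dual_space X1)"
    using f0(1) f1(1) K0 K1 by auto
  show "op_has_summable_szlenk_index X0 Y0 A0"
    unfolding op_has_summable_szlenk_index_def
  proof (rule has_summable_szlenk_index_transfer[OF X0 I K0 K _ _ _ _ summable])
    let ?J = "\<lambda>f. tensor_functional X0 X1 f f1"
    \<comment> \<open>Each coordinate of the map is evaluation of \<open>f\<close> at the fixed
      vector \<open>u f1\<close>.\<close>
    show "continuous_on adjoint_ball0 ?J"
    proof (rule continuous_on_coordinatewise_then_product)
      fix u show "continuous_on adjoint_ball0 (\<lambda>f. ?J f u)"
        by (cases "u \<in> ns_carrier (injective_tensor X0 X1)")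
          (auto simp: tensor_functional_def[OF X0 X1] intro: continuous_on_subset[OF continuous_on_product_coordinates])
    qed
    show "?J ` adjoint_ball0 \<subseteq> adjoint_ball_tensor" using tensor_functional_adjoint f1(1) by blast
    show "norm (f1 x1) / ns_norm X1 x1 > 0" using f1(2) norm_pos_of_dual_nonzero[OF X1 f1D x1 f1(2)] by simp
    show "norm (f1 x1) / ns_norm X1 x1 * ns_norm (dual_space X0) (f - g)
        \<le> ns_norm (dual_space (injective_tensor X0 X1)) (?J f - ?J g)" if "f \<in> adjoint_ball0" "g \<in> adjoint_ball0" for f g
      using tensor_functional_lower(1)[OF X0 X1 _ _ f1D x1 f1(2)] K0 that by blast
  qed
  show "op_has_summable_szlenk_index X1 Y1 A1"
    unfolding op_has_summable_szlenk_index_def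
  proof (rule has_summable_szlenk_index_transfer[OF X1 I K1 K _ _ _ _ summable])
    let ?J = "\<lambda>g. tensor_functional X0 X1 f0 g"
    obtain R0 where R0: "\<forall>f\<in>adjoint_ball0. ns_norm (dual_space X0) f \<le> R0"
      using adjoint_ball(3)[OF X0 Y0 A0] by blast
    obtain R1 where R1: "\<forall>f\<in>adjoint_ball1. ns_norm (dual_space X1) f \<le> R1"
      using adjoint_ball(3)[OF X1 Y1 A1] by blast
    \<comment> \<open>Here the variable \<open>g\<close> enters as the argument of the operator
      \<open>u\<close>, so a coordinate is no evaluation of \<open>g\<close>. Weak-star continuity
      needs the approximation of \<open>u\<close> by finite sums of elementary tensors on a bounded
      set.\<close>
    show "continuous_on adjoint_ball1 ?J"
    proof (rule continuous_on_coordinatewise_then_product)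
      fix u show "continuous_on adjoint_ball1 (\<lambda>g. ?J g u)"
      proof (cases "u \<in> ns_carrier (injective_tensor X0 X1)")
        case True
        have "continuous_on (adjoint_ball0 \<times> adjoint_ball1) (\<lambda>p. fst p (u (snd p)))"
          by (rule continuous_on_tensor_pairing[OF X0 X1 True, where R = "max R0 R1"])
             (use K0 K1 R0 R1 in \<open>auto simp: le_max_iff_disj\<close>)
        then have "continuous_on adjoint_ball1 (\<lambda>g. fst (f0, g) (u (snd (f0, g))))"
          by (rule continuous_on_compose2) (use f0(1) in \<open>auto intro!: continuous_intros\<close>)
        with True show ?thesis by (simp add: tensor_functional_def[OF X0 X1])
      qed (simp add: tensor_functional_def[OF X0 X1])
    qed
    show "?J ` adjoint_ball1 \<subseteq> adjoint_ball_tensor" using tensor_functional_adjoint f0(1) by blast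
    show "norm (f0 x0) / ns_norm X0 x0 > 0" using f0(2) norm_pos_of_dual_nonzero[OF X0 f0D x0 f0(2)] by simp
    show "norm (f0 x0) / ns_norm X0 x0 * ns_norm (dual_space X1) (f - g)
        \<le> ns_norm (dual_space (injective_tensor X0 X1)) (?J f - ?J g)" if "f \<in> adjoint_ball1" "g \<in> adjoint_ball1" for f g
      using tensor_functional_lower(2)[OF X0 X1 f0D _ _ x0 f0(2)] K1 that by blast
  qed
qed

end

theorem theorem1p3:
  fixes X0 :: "('k::real_or_complex, 'x0::ab_group_add) nspace"
    and X1 :: "('k, 'x1::ab_group_add) nspace"
    and Y0 :: "('k, 'y0::ab_group_add) nspace"
    and Y1 :: "('k, 'y1::ab_group_add) nspace"
    and A0 :: "'x0 \<Rightarrow> 'y0" and A1 :: "'x1 \<Rightarrow> 'y1"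
  assumes "banach_space X0" and "banach_space X1" and "banach_space Y0" and "banach_space Y1"
    and "bounded_linear_op X0 Y0 A0" and "bounded_linear_op X1 Y1 A1"
  shows "(op_has_summable_szlenk_index X0 Y0 A0 \<and> op_has_summable_szlenk_index X1 Y1 A1 \<longrightarrow>
            op_has_summable_szlenk_index (injective_tensor X0 X1) (injective_tensor Y0 Y1)
              (tensor_op X1 Y1 A0 A1))
       \<and> ((\<exists>x\<in>ns_carrier X0. A0 x \<noteq> 0) \<and> (\<exists>x\<in>ns_carrier X1. A1 x \<noteq> 0) \<longrightarrow>
            op_has_summable_szlenk_index (injective_tensor X0 X1) (injective_tensor Y0 Y1)
              (tensor_op X1 Y1 A0 A1) \<longrightarrow>
            op_has_summable_szlenk_index X0 Y0 A0 \<and> op_has_summable_szlenk_index X1 Y1 A1)"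
proof -
  note normed = assms(1-4)[THEN banach_space.axioms(1)]
  show ?thesis
    using tensor_op_summable[OF normed assms(5,6)] summable_factors[OF normed assms(5,6)] by blast
qed

end
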